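(* Let $\tfrac14\le\alpha<\tfrac38$ and $0<T\le1$. Let $\epsilon,\delta$ be positive numbers such that $$\epsilon<\min\Bigl\{\frac{3-8\alpha}4,\ \frac{(5-8\alpha)(24\alpha-5)}{12(1+8\alpha)}\Bigr\},\qquad\delta<\frac{2\epsilon}{5-8\alpha}.$$ Then there exists $\eta=\eta(\epsilon,\alpha)>0$ such that $$\|uvw\|_{\mathcal X_T^{2\alpha-\frac14+\epsilon-1,-\frac12+\delta}}\lesssim T^\eta\,\|u\|_{L^\infty_TW_x^{-\alpha-\frac\epsilon2,\infty}}\,\|v\|_{\mathcal X_T^{2\alpha-\frac14+\epsilon,\frac12+\delta}}\,\|w\|_{\mathcal X_T^{2\alpha-\frac14+\epsilon,\frac12+\delta}}$$ for all $u,v,w$, with a constant independent of $u,v,w$ and $T$.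
   Context: $\mathbb T^2=(\mathbb R/2\pi\mathbb Z)^2$, $\langle x\rangle=\sqrt{1+|x|^2}$. $\mathcal X^{s,b}$ is the closure of the Schwartz functions on $\mathbb R\times\mathbb T^2$ under $\|u\|_{\mathcal X^{s,b}}=\|\langle n\rangle^s\langle|\lambda|-\langle n\rangle\rangle^b\,\widetilde u(\lambda,n)\|_{L^2_\lambda\ell^2_n(\mathbb R\times\mathbb Z^2)}$, $\widetilde u$ being the space-time Fourier transform. $\|u\|_{\mathcal X^{s,b}_T}=\inf\{\|w\|_{\mathcal X^{s,b}}:w|_{[0,T]}=u\}$. $\|u\|_{L^\infty_TW^{s,\infty}_x}=\operatorname{ess\,sup}_{t\in[0,T]}\|(1-\Delta)^{s/2}u(t)\|_{L^\infty(\mathbb T^2)}$. *)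

theory Defs
  imports "HOL-Analysis.Analysis" "HOL-Probability.Essential_Supremum"
begin

text \<open>
  The torus is \<open>(\<real>/2\<pi>\<int>)\<^sup>2\<close>; functions on it are \<open>2\<pi>\<close>-periodic functions on \<open>\<real> \<times> \<real>\<close> (or functions
  on the fundamental square).  Fourier conventions:
  \<open>f\<^sub>n = (2\<pi>)\<^sup>-\<^sup>2 \<integral> f(x) exp(-i n\<cdot>x) dx\<close> on the torus, and
  \<open>\<integral>\<integral> u(t,x) exp(-i(\<lambda>t + n\<cdot>x)) dx dt\<close> on \<open>\<real> \<times> T\<^sup>2\<close>.

  A distribution on the torus is given by its Fourier coefficients, so an element of type
  \<open>real \<Rightarrow> int \<times> int \<Rightarrow> complex\<close> is a time-dependent distribution on the torus.
\<close>

type_synonym torus_distr = "int \<times> int \<Rightarrow> complex"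

definition freq :: "int \<times> int \<Rightarrow> real \<times> real" where
  "freq n = (real_of_int (fst n), real_of_int (snd n))"

definition bracket :: "'a::real_normed_vector \<Rightarrow> real" where
  "bracket x = sqrt (1 + (norm x)\<^sup>2)"

definition torus :: "(real \<times> real) set" where
  "torus = cbox (0, 0) (2 * pi, 2 * pi)"

definition torus_measure :: "(real \<times> real) measure" where
  "torus_measure = restrict_space lborel torus"


section \<open>Smooth functions and Schwartz functions on \<open>\<real> \<times> T\<^sup>2\<close>\<close>

text \<open>Iterated directional derivatives; only used with directions in \<open>Basis\<close>.\<close>

fun iter_deriv :: "'a list \<Rightarrow> ('a::euclidean_space \<Rightarrow> complex) \<Rightarrow> 'a \<Rightarrow> complex" where
  "iter_deriv [] f = f"
| "iter_deriv (b # bs) f = (\<lambda>x. frechet_derivative (iter_deriv bs f) (at x) b)"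

definition smooth :: "('a::euclidean_space \<Rightarrow> complex) \<Rightarrow> bool" where
  "smooth f \<longleftrightarrow> (\<forall>bs. set bs \<subseteq> Basis \<longrightarrow> iter_deriv bs f differentiable_on UNIV)"

definition schwartz :: "(real \<times> real \<times> real \<Rightarrow> complex) \<Rightarrow> bool" where
  "schwartz \<phi> \<longleftrightarrow>
     (\<forall>t x y. \<phi> (t, x + 2 * pi, y) = \<phi> (t, x, y) \<and> \<phi> (t, x, y + 2 * pi) = \<phi> (t, x, y)) \<and>
     smooth \<phi> \<and>
     (\<forall>bs k. set bs \<subseteq> Basis \<longrightarrow> bounded (range (\<lambda>z. of_real (fst z) ^ k * iter_deriv bs \<phi> z)))"

text \<open>Smooth functions of time with compact support in the open interval \<open>(0, T)\<close>.\<close>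

definition time_test :: "real \<Rightarrow> (real \<Rightarrow> complex) \<Rightarrow> bool" where
  "time_test T \<phi> \<longleftrightarrow> smooth \<phi> \<and> closure {t. \<phi> t \<noteq> 0} \<subseteq> {0<..<T}"


section \<open>The spaces \<open>X\<^sup>s\<^sup>,\<^sup>b\<close>\<close>

definition st_fourier :: "(real \<times> real \<times> real \<Rightarrow> complex) \<Rightarrow> real \<times> int \<times> int \<Rightarrow> complex" where
  "st_fourier \<phi> = (\<lambda>(l, n). set_lebesgue_integral lborel (UNIV \<times> torus)
      (\<lambda>(t, x). \<phi> (t, x) * cis (- (l * t + freq n \<bullet> x))))"

definition dual_measure :: "(real \<times> int \<times> int) measure" where
  "dual_measure = lborel \<Otimes>\<^sub>M count_space UNIV"

definition X_weight :: "real \<Rightarrow> real \<Rightarrow> real \<times> int \<times> int \<Rightarrow> real" where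
  "X_weight s b = (\<lambda>(l, n). bracket (freq n) powr s * bracket (\<bar>l\<bar> - bracket (freq n)) powr b)"

text \<open>The square of the norm, as a function of the space-time Fourier transform.\<close>

definition X_sq :: "real \<Rightarrow> real \<Rightarrow> (real \<times> int \<times> int \<Rightarrow> complex) \<Rightarrow> ennreal" where
  "X_sq s b F = (\<integral>\<^sup>+ z. ennreal ((X_weight s b z * cmod (F z))\<^sup>2) \<partial>dual_measure)"

definition X_norm :: "real \<Rightarrow> real \<Rightarrow> (real \<times> int \<times> int \<Rightarrow> complex) \<Rightarrow> real" where
  "X_norm s b F = sqrt (enn2real (X_sq s b F))"

text \<open>
  An element of \<open>X\<^sup>s\<^sup>,\<^sup>b\<close> is a space-time distribution; it is given here by its space-time Fourier
  transform \<open>F\<close>.  The space is the closure of the Schwartz functions.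
\<close>

definition X_space :: "real \<Rightarrow> real \<Rightarrow> (real \<times> int \<times> int \<Rightarrow> complex) set" where
  "X_space s b = {F. F \<in> borel_measurable dual_measure \<and> X_sq s b F < \<infinity> \<and>
     (\<forall>e>0. \<exists>\<phi>. schwartz \<phi> \<and> X_sq s b (\<lambda>z. F z - st_fourier \<phi> z) < ennreal e)}"

text \<open>
  The distribution with space-time Fourier transform \<open>F\<close> restricts on \<open>[0, T]\<close> to \<open>u\<close>: both agree as
  distributions on \<open>(0, T) \<times> T\<^sup>2\<close>, that is, when tested against all \<open>\<phi>(t) exp(-i n\<cdot>x)\<close>.
  The constant comes from \<open>u\<^sub>n(t) = (2\<pi>)\<^sup>-\<^sup>3 \<integral> F(\<lambda>,n) exp(i\<lambda>t) d\<lambda>\<close>.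
  The integrability condition says that every \<open>u\<^sub>n\<close> is locally integrable on \<open>(0, T)\<close>; the integral
  over \<open>\<lambda>\<close> converges absolutely for every \<open>F\<close> in some \<open>X_space s b\<close>.
\<close>

definition restricts_to :: "real \<Rightarrow> (real \<times> int \<times> int \<Rightarrow> complex) \<Rightarrow> (real \<Rightarrow> torus_distr) \<Rightarrow> bool" where
  "restricts_to T F u \<longleftrightarrow> (\<forall>n \<phi>. time_test T \<phi> \<longrightarrow>
     integrable lborel (\<lambda>t. u t n * \<phi> t) \<and>
     (LINT t|lborel. u t n * \<phi> t) =
       (LINT l|lborel. F (l, n) * (LINT t|lborel. \<phi> t * cis (l * t))) / of_real ((2 * pi) ^ 3))"

definition XT_space :: "real \<Rightarrow> real \<Rightarrow> real \<Rightarrow> (real \<Rightarrow> torus_distr) set" where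
  "XT_space T s b = {u. \<exists>F \<in> X_space s b. restricts_to T F u}"

definition XT_norm :: "real \<Rightarrow> real \<Rightarrow> real \<Rightarrow> (real \<Rightarrow> torus_distr) \<Rightarrow> real" where
  "XT_norm T s b u = Inf {X_norm s b F | F. F \<in> X_space s b \<and> restricts_to T F u}"


section \<open>The spaces \<open>L\<^sup>\<infinity>\<^sub>T W\<^sup>s\<^sup>,\<^sup>\<infinity>\<close>\<close>

definition torus_coeff :: "(real \<times> real \<Rightarrow> complex) \<Rightarrow> torus_distr" where
  "torus_coeff g n = (LINT x|torus_measure. g x * cis (- (freq n \<bullet> x))) / of_real ((2 * pi)\<^sup>2)"

text \<open>
  The function \<open>g\<close> below is \<open>(1 - \<Delta>)\<^sup>s\<^sup>/\<^sup>2 f\<close>; it is unique up to null sets, so that the infimum runs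
  over a single value, and it is \<open>\<infinity>\<close> if \<open>(1 - \<Delta>)\<^sup>s\<^sup>/\<^sup>2 f\<close> is not a bounded function.
\<close>

definition W_inf_norm :: "real \<Rightarrow> torus_distr \<Rightarrow> ennreal" where
  "W_inf_norm s f = Inf {esssup torus_measure (\<lambda>x. ennreal (cmod (g x))) | g.
     g \<in> borel_measurable torus_measure \<and>
     (\<forall>n. torus_coeff g n = of_real (bracket (freq n) powr s) * f n)}"

definition LW_esssup :: "real \<Rightarrow> real \<Rightarrow> (real \<Rightarrow> torus_distr) \<Rightarrow> ennreal" where
  "LW_esssup T s u = esssup (restrict_space lborel {0..T}) (\<lambda>t. W_inf_norm s (u t))"

definition LW_space :: "real \<Rightarrow> real \<Rightarrow> (real \<Rightarrow> torus_distr) set" where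
  "LW_space T s = {u. (\<forall>n. (\<lambda>t. u t n) \<in> borel_measurable (restrict_space lborel {0..T})) \<and>
     LW_esssup T s u < \<infinity>}"

definition LW_norm :: "real \<Rightarrow> real \<Rightarrow> (real \<Rightarrow> torus_distr) \<Rightarrow> real" where
  "LW_norm T s u = enn2real (LW_esssup T s u)"


section \<open>Products of distributions on the torus\<close>

text \<open>
  Approximate identities consisting of trigonometric polynomials \<open>K\<^sub>N(x) = \<Sum> a\<^sub>N(k) exp(i k\<cdot>x)\<close> (for
  instance the Fejer kernels).  Convolution with \<open>(2\<pi>)\<^sup>-\<^sup>2 K\<^sub>N\<close> multiplies Fourier coefficients
  by \<open>a\<^sub>N\<close>.
\<close>

definition approx_identity :: "(nat \<Rightarrow> int \<times> int \<Rightarrow> complex) \<Rightarrow> bool" where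
  "approx_identity a \<longleftrightarrow>
     (\<forall>N. finite {k. a N k \<noteq> 0}) \<and>
     (\<forall>k. (\<lambda>N. a N k) \<longlonglongrightarrow> 1) \<and>
     (\<exists>M. \<forall>N. (LINT x|torus_measure.
        cmod (\<Sum>k \<in> {k. a N k \<noteq> 0}. a N k * cis (freq k \<bullet> x))) \<le> M)"

text \<open>Fourier coefficients of the product of the three regularised distributions.\<close>

definition reg_product ::
  "(int \<times> int \<Rightarrow> complex) \<Rightarrow> torus_distr \<Rightarrow> torus_distr \<Rightarrow> torus_distr \<Rightarrow> torus_distr" where
  "reg_product a f g h n = (\<Sum>k \<in> {k. a k \<noteq> 0}. \<Sum>l \<in> {l. a l \<noteq> 0}.
      (a k * f k) * (a l * g l) * (a (n - k - l) * h (n - k - l)))"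

text \<open>
  The product \<open>fgh\<close> exists and equals \<open>p\<close>: the products of the regularisations converge to \<open>p\<close>,
  whatever the regularisation.
\<close>

definition is_product :: "torus_distr \<Rightarrow> torus_distr \<Rightarrow> torus_distr \<Rightarrow> torus_distr \<Rightarrow> bool" where
  "is_product f g h p \<longleftrightarrow>
     (\<forall>a. approx_identity a \<longrightarrow> (\<forall>n. (\<lambda>N. reg_product (a N) f g h n) \<longlonglongrightarrow> p n))"

end

theory Submission
  imports Defs "HOL-Probability.Probability" "HOL-Library.Periodic_Fun" "HOL-Real_Asymp.Real_Asymp"
begin

text \<open>
  The assumptions on \<open>\<alpha>\<close> and \<open>\<epsilon>\<close> imply, with \<open>s = 2\<alpha> - 1/4 + \<epsilon>\<close> and \<open>\<sigma> = \<alpha> + \<epsilon>/2 = s/2 + 1/8\<close>,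
  that \<open>0 < \<sigma> < s \<le> 1/2\<close>, and the bound on \<open>\<delta>\<close> makes \<open>-1/2 + \<delta>\<close> negative.  In this range
  the product can be estimated separately at each time, without Strichartz estimates.

  In time, \<open>X\<^sup>s\<^sup>,\<^sup>b\<close> with \<open>b > 1/2\<close> embeds into the bounded functions with values in \<open>H\<^sup>s\<close>
  (\<open>time_coeff_hs_bounded\<close>), and the weight of \<open>X\<^sup>s\<^sup>-\<^sup>1\<^sup>,\<^sup>b\<close> with \<open>b \<le> 0\<close> is at most that of
  \<open>L\<^sup>2\<close> in time with values in \<open>H\<^sup>s\<^sup>-\<^sup>1\<close>.  A flow that is bounded by \<open>K\<close> in \<open>H\<^sup>s\<^sup>-\<^sup>1\<close> on \<open>[0, T]\<close>
  and zero elsewhere therefore has norm at most a constant times \<open>T\<^sup>1\<^sup>/\<^sup>2 K\<close>, which gives \<open>\<eta> = 1/2\<close>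
  (\<open>bounded_flow\<close>).

  In space, what is left is \<open>\<parallel>fgh\<parallel> \<le> C \<parallel>f\<parallel> \<parallel>g\<parallel> \<parallel>h\<parallel>\<close> for the norms of \<open>H\<^sup>s\<^sup>-\<^sup>1\<close>, \<open>W\<^sup>-\<^sup>\<sigma>\<^sup>,\<^sup>\<infinity>\<close>, \<open>H\<^sup>s\<close>
  and \<open>H\<^sup>s\<close>.  Write \<open>f = (1 - \<Delta>)\<^sup>\<sigma>\<^sup>/\<^sup>2 F\<close> with \<open>F\<close> bounded.  By duality with \<open>\<phi>\<close> in \<open>H\<^sup>1\<^sup>-\<^sup>s\<close> the claim is a
  bound of \<open>(1 - \<Delta>)\<^sup>\<sigma>\<^sup>/\<^sup>2 (g h \<phi>)\<close> in \<open>L\<^sup>1\<close>.  Decompose \<open>g\<close>, \<open>h\<close>, \<open>\<phi>\<close> into dyadic frequency blocks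
  \<open>2\<^sup>i\<close>, \<open>2\<^sup>j\<close>, \<open>2\<^sup>k\<close>.  The fractional power costs \<open>2\<close> to the power \<open>\<sigma> max(i, j, k)\<close>, Hoelder's inequality with
  the lowest frequency in \<open>L\<^sup>\<infinity>\<close> costs \<open>2\<close> to the power \<open>min(i, j, k)\<close>, and the Sobolev weights of the
  three factors gain \<open>s i + s j + (1 - s) k\<close> in the exponent.  The net exponent is at most
  \<open>-(s - \<sigma>) max(i, j, k)\<close> (\<open>dyadic_exponent\<close>), so the sum over the blocks converges
  (\<open>trilinear_estimate\<close>).

  The fractional power is reduced to the heat semigroup: \<open>a\<^sup>\<theta>\<close> is a positive multiple of
  \<open>\<integral> (1 - exp(-ta)) t\<^sup>-\<^sup>1\<^sup>-\<^sup>\<theta> dt\<close> over \<open>t > 0\<close>.  Since the heat semigroup averages translates over a Gaussian, it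
  contracts \<open>L\<^sup>1\<close> of the torus, and \<open>(1 - \<Delta>)\<^sup>\<theta> G\<close> is controlled by \<open>G\<close> and \<open>(1 - \<Delta>) G\<close>
  (\<open>subordination_bound\<close>, \<open>trig_l1_heat\<close>); for a product of three blocks the latter follows from the
  Leibniz rule.  Kernels of approximate identities act on \<open>L\<^sup>1\<close> in the same way, so the estimate is uniform
  in the regularisation, and density of trigonometric polynomials in \<open>H\<^sup>s\<close> gives convergence of the
  regularised products (\<open>torus_product_is_product\<close>).

  Two facts on the line connect this with restrictions to \<open>(0, T)\<close>.  The fundamental lemma of the calculus of
  variations shows that an element of \<open>X\<^sup>s\<^sup>,\<^sup>b\<close> with \<open>b > 1/2\<close> that restricts to \<open>v\<close> agrees with \<open>v\<close> at almost every time.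
  Bessel's inequality and Parseval's identity for the Fourier transform in time, both obtained from Gaussian summation
  (\<open>gauss_ft_identity\<close>), and density of smooth functions in \<open>L\<^sup>2\<close> put the Fourier
  transform of the product into \<open>X\<^sup>s\<^sup>-\<^sup>1\<^sup>,\<^sup>b\<close> and show that it restricts to the product.
\<close>

section \<open>Fractional powers by subordination\<close>

text \<open>
  The measure \<open>t\<^sup>-\<^sup>1\<^sup>-\<^sup>\<theta> dt\<close> on \<open>(0,
  \<infinity>)\<close>, the Levy measure of the \<open>\<theta>\<close>-stable subordinator. It is
  kept as a density with respect to Lebesgue measure on the line so that substitutions are those
  of \<open>lborel\<close>.
\<close>

definition levy_weight :: "real \<Rightarrow> (real \<Rightarrow> real) \<Rightarrow> real \<Rightarrow> real" where
  "levy_weight \<theta> h t = indicator {0<..} t * (h t * t powr (- 1 - \<theta>))"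

text \<open>
  The substitution \<open>t \<mapsto> a t\<close>. It produces the fractional power: applied to
  \<open>1 - exp(-t)\<close> it says that the integral of \<open>1 - exp(-at)\<close> is
  \<open>a\<^sup>\<theta>\<close> times a constant.
\<close>

lemma levy_weight_scale:
  assumes "integrable lborel (levy_weight \<theta> h)" "0 < a"
  shows "integrable lborel (levy_weight \<theta> (\<lambda>t. h (a * t)))"
    and "(LINT t|lborel. levy_weight \<theta> (\<lambda>t. h (a * t)) t) = a powr \<theta> * (LINT t|lborel. levy_weight \<theta> h t)"
proof -
  have eq: "levy_weight \<theta> h (0 + a * t) = a powr (- 1 - \<theta>) * levy_weight \<theta> (\<lambda>t. h (a * t)) t" for t
    using assms(2) by (auto simp: levy_weight_def indicator_def powr_mult zero_less_mult_iff)
  have "integrable lborel (\<lambda>t. levy_weight \<theta> h (0 + a * t))"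
    using assms by (intro lborel_integrable_real_affine) auto
  then show int: "integrable lborel (levy_weight \<theta> (\<lambda>t. h (a * t)))"
    unfolding eq using assms(2) by simp
  have "(LINT t|lborel. levy_weight \<theta> h t) = a * (LINT t|lborel. levy_weight \<theta> h (0 + a * t))"
    using lborel_integral_real_affine[of a "levy_weight \<theta> h" 0] assms(2) by simp
  also have "\<dots> = a powr (- \<theta>) * (LINT t|lborel. levy_weight \<theta> (\<lambda>t. h (a * t)) t)"
    unfolding eq using powr_mult_base[of a "-1-\<theta>"] assms(2) by (simp add: mult.assoc[symmetric])
  finally show "(LINT t|lborel. levy_weight \<theta> (\<lambda>t. h (a * t)) t) = a powr \<theta> * (LINT t|lborel. levy_weight \<theta> h t)"
    using assms(2) by (simp add: powr_minus field_simps)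
qed

text \<open>
  Near zero the integrand is \<open>t\<^sup>-\<^sup>\<theta>\<close>, integrable as
  \<open>\<theta> < 1\<close>; at infinity it is \<open>2
  t\<^sup>-\<^sup>1\<^sup>-\<^sup>\<theta>\<close>, integrable as \<open>\<theta> > 0\<close>.
\<close>

lemma levy_weight_min_integrable:
  assumes "0 < \<theta>" "\<theta> < 1"
  shows "integrable lborel (levy_weight \<theta> (\<lambda>t. min 2 t))"
proof -
  define g where "g = (\<lambda>t::real. indicator {0..1} t * t powr (- \<theta>) + 2 * (indicator {1..} t * t powr (- 1 - \<theta>)))"
  have "integral\<^sup>N lborel (\<lambda>t. ennreal (indicator {0..1} t * t powr (- \<theta>))) = ennreal (1 powr (-\<theta>+1) / (-\<theta>+1))"
    using nn_integral_has_integral_lebesgue[OF _ has_integral_powr_from_0[of "-\<theta>" 1]] assms by simp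
  then have 1: "integrable lborel (\<lambda>t::real. indicator {0..1} t * t powr (- \<theta>))"
    by (intro integrableI_nonneg) auto
  have "integral\<^sup>N lborel (\<lambda>t. ennreal (indicator {1..} t * t powr (-1- \<theta>))) = ennreal (- (1 powr (-1-\<theta>+1)) / (-1-\<theta>+1))"
    using nn_integral_has_integral_lebesgue[OF _ has_integral_powr_to_inf[of "-1-\<theta>" 1]] assms by simp
  then have 2: "integrable lborel (\<lambda>t::real. indicator {1..} t * t powr (-1- \<theta>))"
    by (intro integrableI_nonneg) auto
  have g: "integrable lborel g" unfolding g_def
    using 1 2 by simp
  show ?thesis
  proof (rule Bochner_Integration.integrable_bound[OF g])
    show "levy_weight \<theta> (min 2) \<in> borel_measurable lborel"
      unfolding levy_weight_def by measurable
    have "norm (levy_weight \<theta> (min 2) t) \<le> norm (g t)" for t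
    proof -
      consider "t \<le> 0" | "0 < t" "t < 1" | "1 \<le> t" by linarith
      then show ?thesis
      proof cases
        case 2
        then have "t * t powr (-1-\<theta>) = t powr (-\<theta>)"
          using powr_mult_base[of t "-1-\<theta>"] by simp
        with 2 show ?thesis by (simp add: levy_weight_def g_def)
      next
        case 3
        then have "min 2 t * t powr (-1-\<theta>) \<le> 2 * t powr (-1-\<theta>)"
          by (intro mult_right_mono) auto
        moreover have "0 \<le> t powr (-\<theta>)" by simp
        ultimately show ?thesis using 3 by (auto simp: levy_weight_def g_def indicator_def intro: order_trans)
      qed (auto simp: levy_weight_def)
    qed
    then show "AE t in lborel. norm (levy_weight \<theta> (min 2) t) \<le> norm (g t)" by simp
  qed
qed

lemma levy_weight_exp_integrable:
  assumes "0 < \<theta>" "\<theta> < 1"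
  shows "integrable lborel (levy_weight \<theta> (\<lambda>t. 1 - exp (- t)))"
proof (rule Bochner_Integration.integrable_bound[OF levy_weight_min_integrable[OF assms]])
  show "levy_weight \<theta> (\<lambda>t. 1 - exp (- t)) \<in> borel_measurable lborel"
    unfolding levy_weight_def by measurable
  have "norm (levy_weight \<theta> (\<lambda>t. 1 - exp (- t)) t) \<le> norm (levy_weight \<theta> (min 2) t)" for t :: real
  proof (cases "0 < t")
    case True
    have "1 - exp (-t) \<le> min 2 t" using exp_ge_add_one_self[of "-t"] exp_ge_zero[of "-t"] by (simp del: exp_ge_zero)
    then show ?thesis using True
      by (auto simp: levy_weight_def abs_mult intro!: mult_right_mono)
  qed (simp add: levy_weight_def)
  then show "AE t in lborel. norm (levy_weight \<theta> (\<lambda>t. 1 - exp (- t)) t) \<le> norm (levy_weight \<theta> (min 2) t)"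
    by simp
qed

definition levy_const :: "real \<Rightarrow> real" where
  "levy_const \<theta> = (LINT t|lborel. levy_weight \<theta> (\<lambda>t. 1 - exp (- t)) t)"

definition subord_const :: "real \<Rightarrow> real" where
  "subord_const \<theta> = (LINT t|lborel. levy_weight \<theta> (min 2) t) / levy_const \<theta>"

lemma levy_const_pos:
  assumes "0 < \<theta>" "\<theta> < 1"
  shows "0 < levy_const \<theta>"
proof -
  have nn: "AE t in lborel. 0 \<le> levy_weight \<theta> (\<lambda>t. 1 - exp (- t)) t"
    by (auto simp: levy_weight_def indicator_def)
  have "levy_const \<theta> \<noteq> 0"
  proof
    assume "levy_const \<theta> = 0"
    then have "AE t in lborel. levy_weight \<theta> (\<lambda>t. 1 - exp (- t)) t = 0"
      using integral_nonneg_eq_0_iff_AE[OF levy_weight_exp_integrable[OF assms] nn] by (simp add: levy_const_def)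
    then have "AE t in lborel. t \<notin> {0<..(1::real)}"
      by eventually_elim (auto simp: levy_weight_def indicator_def split: if_splits)
    then have "emeasure lborel {0<..(1::real)} = 0"
      by (subst (asm) AE_iff_measurable[where N="{0<..1}"]) auto
    then show False by simp
  qed
  moreover have "0 \<le> levy_const \<theta>"
    unfolding levy_const_def by (rule integral_nonneg_AE[OF nn])
  ultimately show ?thesis by simp
qed

lemma subord_const_nonneg:
  assumes "0 < \<theta>" "\<theta> < 1"
  shows "0 \<le> subord_const \<theta>"
  unfolding subord_const_def using levy_const_pos[OF assms]
  by (intro divide_nonneg_pos integral_nonneg_AE) (auto simp: levy_weight_def indicator_def)

text \<open>
  Interpolation between a sum and the sum weighted by \<open>a\<close>, when both are bounded
  along the semigroup \<open>exp(-ta)\<close>. The function \<open>\<Sum> z (1 - exp(-ta))\<close>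
  of \<open>t\<close> is at most \<open>2 X\<close>, and its derivative is at most \<open>Q
  X\<close>; as it vanishes at \<open>0\<close> it is at most \<open>X min(2, Q t)\<close>.
  Integrating against the Levy measure turns \<open>1 - exp(-ta)\<close> into
  \<open>a\<^sup>\<theta>\<close> and \<open>min(2, Q t)\<close> into
  \<open>Q\<^sup>\<theta>\<close>.
\<close>

lemma subordination_bound:
  fixes z :: "'i \<Rightarrow> complex" and a :: "'i \<Rightarrow> real"
  assumes \<theta>: "0 < \<theta>" "\<theta> < 1"
    and "finite I" and a: "\<And>i. i \<in> I \<Longrightarrow> 0 < a i" and "0 < Q" 
    and X: "\<And>t. 0 \<le> t \<Longrightarrow> cmod (\<Sum>i\<in>I. z i * of_real (exp (- (t * a i)))) \<le> X"
    and Y: "\<And>t. 0 \<le> t \<Longrightarrow> cmod (\<Sum>i\<in>I. z i * of_real (a i * exp (- (t * a i)))) \<le> Q * X"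
  shows "cmod (\<Sum>i\<in>I. z i * of_real (a i powr \<theta>)) \<le> subord_const \<theta> * X * Q powr \<theta>"
proof -
  let ?W = "\<lambda>i. levy_weight \<theta> (\<lambda>t. 1 - exp (- (a i * t)))"
  let ?M = "levy_weight \<theta> (\<lambda>t. min 2 (Q * t))"
  have int: "integrable lborel (?W i)" "(LINT t|lborel. ?W i t) = a i powr \<theta> * levy_const \<theta>" if "i \<in> I" for i
    using levy_weight_scale[OF levy_weight_exp_integrable[OF \<theta>] a[OF that]] by (simp_all add: levy_const_def)
  have intM: "integrable lborel ?M" "(LINT t|lborel. ?M t) = Q powr \<theta> * (LINT t|lborel. levy_weight \<theta> (min 2) t)"
    using levy_weight_scale[OF levy_weight_min_integrable[OF \<theta>] \<open>0 < Q\<close>] by simp_all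
  have X0: "0 \<le> X" using X[of 0] norm_ge_zero order_trans by blast
  \<comment> \<open>Two bounds of the increment of the semigroup: by the triangle inequality, and by the mean
    value inequality.\<close>
  have D: "cmod (\<Sum>i\<in>I. z i * of_real (1 - exp (- (a i * t)))) \<le> X * min 2 (Q * t)" if "0 < t" for t
  proof -
    have "(\<Sum>i\<in>I. z i * of_real (1 - exp (- (a i * t)))) = (\<Sum>i\<in>I. z i * of_real (exp (- (0 * a i)))) - (\<Sum>i\<in>I. z i * of_real (exp (- (t * a i))))"
      by (simp add: sum_subtractf algebra_simps)
    then have 1: "cmod (\<Sum>i\<in>I. z i * of_real (1 - exp (- (a i * t)))) \<le> X + X"
      using norm_triangle_ineq4[of "\<Sum>i\<in>I. z i * of_real (exp (- (0 * a i)))" "\<Sum>i\<in>I. z i * of_real (exp (- (t * a i)))"]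
        X[of 0] X[of t] that by simp
    define f where "f = (\<lambda>t. \<Sum>i\<in>I. z i * of_real (1 - exp (- (t * a i))))"
    have "norm (f t - f 0) \<le> (Q * X) * norm (t - 0)"
    proof (rule differentiable_bound[where f=f and S="{0..}" and f' = "\<lambda>t h. h *\<^sub>R (\<Sum>i\<in>I. z i * of_real (a i * exp (- (t * a i))))"])
      fix s :: real assume "s \<in> {0..}"
      have "(f has_vector_derivative (\<Sum>i\<in>I. z i * of_real (a i * exp (- (s * a i))))) (at s within {0..})"
        unfolding f_def
        by (auto intro!: derivative_eq_intros sum.cong simp: mult_ac)
      then show "(f has_derivative (\<lambda>h. h *\<^sub>R (\<Sum>i\<in>I. z i * of_real (a i * exp (- (s * a i)))))) (at s within {0..})"
        by (simp add: has_vector_derivative_def)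
      show "onorm (\<lambda>h. h *\<^sub>R (\<Sum>i\<in>I. z i * of_real (a i * exp (- (s * a i))))) \<le> Q * X"
        using Y[of s] \<open>s \<in> {0..}\<close> by (subst onorm_scaleR_left) (auto simp: onorm_id)
    qed (use that in auto)
    then have "cmod (f t) \<le> Q * X * t" using that by (simp add: f_def)
    then have 2: "cmod (\<Sum>i\<in>I. z i * of_real (1 - exp (- (a i * t)))) \<le> Q * X * t" by (simp add: f_def mult.commute)
    from 1 2 show ?thesis using X0 by (auto simp: min_def mult_ac)
  qed
  have "of_real (levy_const \<theta>) * (\<Sum>i\<in>I. z i * of_real (a i powr \<theta>)) = (LINT t|lborel. (\<Sum>i\<in>I. z i * of_real (?W i t)))"
    using int by (subst Bochner_Integration.integral_sum) (auto simp: sum_distrib_left mult_ac simp flip: of_real_mult)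
  also have "cmod \<dots> \<le> (LINT t|lborel. X * ?M t)"
  proof (rule order_trans[OF integral_norm_bound integral_mono])
    show "integrable lborel (\<lambda>t. cmod (\<Sum>i\<in>I. z i * of_real (?W i t)))"
      using int(1) by (intro integrable_norm Bochner_Integration.integrable_sum integrable_mult_right integrable_of_real) auto
    show "integrable lborel (\<lambda>t. X * ?M t)" using intM by simp
    fix t :: real
    show "cmod (\<Sum>i\<in>I. z i * of_real (?W i t)) \<le> X * ?M t"
    proof (cases "0 < t")
      case True
      have "(\<Sum>i\<in>I. z i * of_real (?W i t)) = (\<Sum>i\<in>I. z i * of_real (1 - exp (- (a i * t)))) * of_real (t powr (-1-\<theta>))"
        using True by (simp add: levy_weight_def sum_distrib_left mult_ac)
      then show ?thesis using D[OF True] True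
        by (auto simp: norm_mult levy_weight_def mult.assoc[symmetric] intro!: mult_right_mono)
    qed (simp add: levy_weight_def)
  qed
  finally have "levy_const \<theta> * cmod (\<Sum>i\<in>I. z i * of_real (a i powr \<theta>)) \<le> X * (Q powr \<theta> * (LINT t|lborel. levy_weight \<theta> (min 2) t))"
    using levy_const_pos[OF \<theta>] intM(2) by (simp add: norm_mult)
  then show ?thesis
    using levy_const_pos[OF \<theta>] by (simp add: subord_const_def field_simps)
qed

section \<open>Trigonometric sums on the torus\<close>

text \<open>
  A trigonometric polynomial given by a family of frequencies that may repeat. This lets products
  of trigonometric polynomials be written over the product of the index sets, without computing
  convolutions.
\<close>

definition trig_sum :: "'i set \<Rightarrow> ('i \<Rightarrow> int \<times> int) \<Rightarrow> ('i \<Rightarrow> complex) \<Rightarrow> real \<times> real \<Rightarrow> complex" where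
  "trig_sum I \<kappa> z x = (\<Sum>i\<in>I. z i * cis (- (freq (\<kappa> i) \<bullet> x)))"

definition trig_l1 :: "'i set \<Rightarrow> ('i \<Rightarrow> int \<times> int) \<Rightarrow> ('i \<Rightarrow> complex) \<Rightarrow> real" where
  "trig_l1 I \<kappa> z = (LINT x|torus_measure. cmod (trig_sum I \<kappa> z x))"

lemma cis_measurable [measurable]: "cis \<in> borel_measurable borel"
  by (intro borel_measurable_continuous_onI continuous_intros)

lemma trig_sum_measurable [measurable]: "trig_sum I \<kappa> z \<in> borel_measurable borel"
  unfolding trig_sum_def by (intro borel_measurable_continuous_onI continuous_intros)

lemma torus_sets [measurable]: "torus \<in> sets borel"
  by (simp add: torus_def)

lemma space_torus_measure [simp]: "space torus_measure = torus"
  by (simp add: torus_measure_def space_restrict_space)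

lemma emeasure_torus: "emeasure torus_measure torus = ennreal ((2 * pi)\<^sup>2)"
proof -
  have "torus = {0..2*pi} \<times> {0..2*pi}" by (auto simp: torus_def cbox_Pair_eq)
  then have "emeasure lborel torus = emeasure (lborel \<Otimes>\<^sub>M lborel) ({0..2*pi} \<times> {0..2*pi::real})"
    by (simp add: lborel_prod)
  also have "\<dots> = ennreal (2 * pi - 0) * ennreal (2 * pi - 0)"
    by (subst lborel.emeasure_pair_measure_Times) simp_all
  also have "\<dots> = ennreal ((2 * pi)\<^sup>2)"
    by (subst ennreal_mult[symmetric]) (simp_all add: power2_eq_square)
  finally show ?thesis
    by (simp add: torus_measure_def emeasure_restrict_space)
qed

lemma finite_measure_torus: "finite_measure torus_measure"
  by (rule finite_measureI) (simp add: emeasure_torus)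

lemma measurable_torus_measureI: "f \<in> borel_measurable borel \<Longrightarrow> f \<in> borel_measurable torus_measure"
  unfolding torus_measure_def by (rule measurable_restrict_space1) simp

lemma integrable_torus_bounded:
  fixes f :: "real \<times> real \<Rightarrow> 'b::{banach, second_countable_topology}"
  assumes "f \<in> borel_measurable borel" "\<And>x. norm (f x) \<le> B"
  shows "integrable torus_measure f"
proof (rule finite_measure.integrable_const_bound[OF finite_measure_torus])
  show "f \<in> borel_measurable torus_measure" by (rule measurable_torus_measureI) fact
  show "AE x in torus_measure. norm (f x) \<le> B" using assms(2) by simp
qed

lemma cmod_trig_sum_le: "cmod (trig_sum I \<kappa> z x) \<le> (\<Sum>i\<in>I. cmod (z i))"
  unfolding trig_sum_def by (rule order_trans[OF norm_sum]) (simp add: norm_mult)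

lemma trig_sum_integrable: "integrable torus_measure (trig_sum I \<kappa> z)" "integrable torus_measure (\<lambda>x. cmod (trig_sum I \<kappa> z x))"
  using cmod_trig_sum_le by (auto intro!: integrable_torus_bounded)

lemma nn_integral_trig_sum: "(\<integral>\<^sup>+x. ennreal (cmod (trig_sum I \<kappa> z x)) \<partial>torus_measure) = ennreal (trig_l1 I \<kappa> z)"
  unfolding trig_l1_def by (rule nn_integral_eq_integral) (auto intro: trig_sum_integrable)

lemma trig_l1_nonneg: "0 \<le> trig_l1 I \<kappa> z"
  unfolding trig_l1_def by (rule integral_nonneg_AE) simp

lemma nn_integral_torus:
  assumes [measurable]: "f \<in> borel_measurable borel"
  shows "(\<integral>\<^sup>+x. f x \<partial>torus_measure) =
    (\<integral>\<^sup>+a. (\<integral>\<^sup>+b. f (a, b) * indicator {0..2*pi} b \<partial>lborel) * indicator {0..2*pi} a \<partial>lborel)"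
proof -
  have *: "indicator torus (a, b) = (indicator {0..2*pi} b * indicator {0..2*pi} a :: ennreal)" for a b
    by (auto simp: torus_def cbox_Pair_eq indicator_def)
  have [measurable]: "f \<in> borel_measurable (borel \<Otimes>\<^sub>M borel)" by (simp add: borel_prod)
  have "(\<integral>\<^sup>+x. f x \<partial>torus_measure) = (\<integral>\<^sup>+x. f x * indicator torus x \<partial>(lborel \<Otimes>\<^sub>M lborel))"
    unfolding torus_measure_def lborel_prod by (rule nn_integral_restrict_space) simp
  also have "\<dots> = (\<integral>\<^sup>+a. (\<integral>\<^sup>+b. f (a, b) * indicator torus (a, b) \<partial>lborel) \<partial>lborel)"
    by (rule lborel.nn_integral_fst[symmetric]) (simp add: lborel_prod)
  also have "\<dots> = (\<integral>\<^sup>+a. (\<integral>\<^sup>+b. f (a, b) * indicator {0..2*pi} b * indicator {0..2*pi} a \<partial>lborel) \<partial>lborel)"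
    by (simp add: * mult.assoc)
  also have "\<dots> = (\<integral>\<^sup>+a. (\<integral>\<^sup>+b. f (a, b) * indicator {0..2*pi} b \<partial>lborel) * indicator {0..2*pi} a \<partial>lborel)"
    by (intro nn_integral_cong nn_integral_multc) measurable
  finally show ?thesis .
qed

text \<open>
  Reduce the shift modulo the period to \<open>y'\<close> in \<open>[0, 2\<pi>)\<close>, cut the
  shifted interval \<open>[y', y' + 2\<pi>)\<close> at \<open>2\<pi>\<close>, and move the second
  piece back by one period.
\<close>

lemma nn_integral_period_translate:
  fixes f :: "real \<Rightarrow> ennreal"
  assumes [measurable]: "f \<in> borel_measurable borel" and per: "\<And>x. f (x + 2 * pi) = f x"
  shows "(\<integral>\<^sup>+x. f (x + y) * indicator {0..2*pi} x \<partial>lborel) = (\<integral>\<^sup>+x. f x * indicator {0..2*pi} x \<partial>lborel)"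
proof -
  interpret periodic_fun_simple f "2 * pi" by unfold_locales (rule per)
  define y' where "y' = y - 2 * pi * of_int \<lfloor>y / (2 * pi)\<rfloor>"
  have y': "0 \<le> y'" "y' < 2 * pi"
    using floor_divide_lower[of "2 * pi" y] floor_divide_upper[of "2*pi" y]
    by (simp_all add: y'_def algebra_simps)
  have shift: "f (x + y) = f (x + y')" for x
    using plus_of_int[of "x + y'" "\<lfloor>y / (2 * pi)\<rfloor>"] by (simp add: y'_def algebra_simps)
  have closed: "(\<integral>\<^sup>+x. g x * indicator {0..2*pi} x \<partial>lborel) = (\<integral>\<^sup>+x. g x * indicator {0..<2*pi} x \<partial>lborel)" for g :: "real \<Rightarrow> ennreal"
    using AE_lborel_singleton[of "2 * pi"] by (intro nn_integral_cong_AE) (auto simp: indicator_def)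
  have "(\<integral>\<^sup>+x. f (x + y') * indicator {0..<2*pi} x \<partial>lborel)
      = (\<integral>\<^sup>+x. f x * indicator {y'..<y'+2*pi} x \<partial>lborel)"
    by (subst (2) nn_integral_real_affine[where c=1 and t=y']) (auto simp: indicator_def add.commute intro!: nn_integral_cong)
  also have "\<dots> = (\<integral>\<^sup>+x. f x * indicator {y'..<2*pi} x + f x * indicator {2*pi..<y'+2*pi} x \<partial>lborel)"
    using y' by (intro nn_integral_cong) (auto simp: indicator_def)
  also have "\<dots> = (\<integral>\<^sup>+x. f x * indicator {y'..<2*pi} x \<partial>lborel) + (\<integral>\<^sup>+x. f x * indicator {2*pi..<y'+2*pi} x \<partial>lborel)"
    by (rule nn_integral_add) auto
  also have "(\<integral>\<^sup>+x. f x * indicator {2*pi..<y'+2*pi} x \<partial>lborel) = (\<integral>\<^sup>+x. f x * indicator {0..<y'} x \<partial>lborel)"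
    by (subst nn_integral_real_affine[where c=1 and t="2*pi"]) (auto simp: indicator_def add.commute[of "2*pi"] per intro!: nn_integral_cong)
  also have "(\<integral>\<^sup>+x. f x * indicator {y'..<2*pi} x \<partial>lborel) + (\<integral>\<^sup>+x. f x * indicator {0..<y'} x \<partial>lborel)
      = (\<integral>\<^sup>+x. f x * indicator {y'..<2*pi} x + f x * indicator {0..<y'} x \<partial>lborel)"
    by (rule nn_integral_add[symmetric]) auto
  also have "\<dots> = (\<integral>\<^sup>+x. f x * indicator {0..<2*pi} x \<partial>lborel)"
    using y' by (intro nn_integral_cong) (auto simp: indicator_def)
  finally show ?thesis by (simp add: closed shift)
qed

lemma nn_integral_torus_translate:
  fixes f :: "real \<times> real \<Rightarrow> ennreal"
  assumes [measurable]: "f \<in> borel_measurable borel"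
    and per: "\<And>a b. f (a + 2 * pi, b) = f (a, b)" "\<And>a b. f (a, b + 2 * pi) = f (a, b)"
  shows "(\<integral>\<^sup>+x. f (x + y) \<partial>torus_measure) = (\<integral>\<^sup>+x. f x \<partial>torus_measure)"
proof -
  obtain y1 y2 where y: "y = (y1, y2)" by (cases y)
  have [measurable]: "f \<in> borel_measurable (borel \<Otimes>\<^sub>M borel)" by (simp add: borel_prod)
  let ?g = "\<lambda>a. (\<integral>\<^sup>+b. f (a, b) * indicator {0..2*pi} b \<partial>lborel)"
  have "(\<integral>\<^sup>+x. f (x + y) \<partial>torus_measure) =
    (\<integral>\<^sup>+a. (\<integral>\<^sup>+b. f (a + y1, b + y2) * indicator {0..2*pi} b \<partial>lborel) * indicator {0..2*pi} a \<partial>lborel)"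
    by (subst nn_integral_torus) (simp_all add: y)
  also have "\<dots> = (\<integral>\<^sup>+a. ?g (a + y1) * indicator {0..2*pi} a \<partial>lborel)"
    by (subst nn_integral_period_translate[where f="\<lambda>b. f (_ + y1, b)"]) (auto simp: per)
  also have "\<dots> = (\<integral>\<^sup>+a. ?g a * indicator {0..2*pi} a \<partial>lborel)"
    by (rule nn_integral_period_translate) (auto simp: per)
  also have "\<dots> = (\<integral>\<^sup>+x. f x \<partial>torus_measure)"
    by (rule nn_integral_torus[symmetric]) measurable
  finally show ?thesis .
qed

lemma cis_int_period: "cis (- (freq k \<bullet> (a + 2 * pi, b))) = cis (- (freq k \<bullet> (a, b)))"
  "cis (- (freq k \<bullet> (a, b + 2 * pi))) = cis (- (freq k \<bullet> (a, b)))"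
proof -
  have *: "cis (x + 2 * pi * of_int n) = cis x" for x n
    by (simp add: cis_multiple_2pi flip: cis_mult)
  have "- (freq k \<bullet> (a + 2 * pi, b)) = - (freq k \<bullet> (a, b)) + 2 * pi * of_int (- fst k)"
    "- (freq k \<bullet> (a, b + 2 * pi)) = - (freq k \<bullet> (a, b)) + 2 * pi * of_int (- snd k)"
    by (simp_all add: freq_def algebra_simps)
  then show "cis (- (freq k \<bullet> (a + 2 * pi, b))) = cis (- (freq k \<bullet> (a, b)))"
    "cis (- (freq k \<bullet> (a, b + 2 * pi))) = cis (- (freq k \<bullet> (a, b)))"
    by (simp_all only: *)
qed

lemma cis_freq_add: "cis (- (freq k \<bullet> (x + y))) = cis (- (freq k \<bullet> x)) * cis (- (freq k \<bullet> y))"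
  by (simp add: cis_mult inner_add_right)

lemma trig_sum_period: "trig_sum I \<kappa> z (a + 2 * pi, b) = trig_sum I \<kappa> z (a, b)" "trig_sum I \<kappa> z (a, b + 2 * pi) = trig_sum I \<kappa> z (a, b)"
  unfolding trig_sum_def by (simp_all only: cis_int_period)

text \<open>
  A multiplier that is the Fourier transform of a complex measure \<open>w M\<close>, pushed
  forward by \<open>Y\<close>, acts on a trigonometric polynomial by averaging its translates; its
  norm on \<open>L\<^sup>1\<close> is at most the total mass, by translation invariance. It serves
  both for the heat semigroup, where the measure is Gaussian, and for the kernels of an
  approximate identity.
\<close>

lemma trig_l1_multiplier:
  assumes M: "sigma_finite_measure M" and w: "integrable M w" and Y [measurable]: "Y \<in> M \<rightarrow>\<^sub>M borel"
    and m: "\<And>i. i \<in> I \<Longrightarrow> m (\<kappa> i) = (LINT u|M. w u * cis (- (freq (\<kappa> i) \<bullet> Y u)))"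
  shows "trig_l1 I \<kappa> (\<lambda>i. m (\<kappa> i) * z i) \<le> (LINT u|M. cmod (w u)) * trig_l1 I \<kappa> z"
proof -
  interpret M: sigma_finite_measure M by fact
  interpret T: finite_measure torus_measure by (rule finite_measure_torus)
  interpret pair_sigma_finite M torus_measure ..
  have w' [measurable]: "w \<in> borel_measurable M" using w by simp
  have [measurable]: "(\<lambda>p. p) \<in> torus_measure \<rightarrow>\<^sub>M borel" by (rule measurable_torus_measureI) simp
  have wc: "integrable M (\<lambda>u. w u * cis (f u))" if [measurable]: "f \<in> borel_measurable M" for f
    by (rule Bochner_Integration.integrable_bound[OF w]) (auto simp: norm_mult)
  \<comment> \<open>The multiplier averages translates.\<close>
  have conv: "trig_sum I \<kappa> (\<lambda>i. m (\<kappa> i) * z i) x = (LINT u|M. w u * trig_sum I \<kappa> z (x + Y u))" for x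
  proof -
    have "w u * trig_sum I \<kappa> z (x + Y u) = (\<Sum>i\<in>I. z i * cis (- (freq (\<kappa> i) \<bullet> x)) * (w u * cis (- (freq (\<kappa> i) \<bullet> Y u))))" for u
      unfolding trig_sum_def cis_freq_add sum_distrib_left by (intro sum.cong refl) simp
    then have "(LINT u|M. w u * trig_sum I \<kappa> z (x + Y u)) = (LINT u|M. (\<Sum>i\<in>I. z i * cis (- (freq (\<kappa> i) \<bullet> x)) * (w u * cis (- (freq (\<kappa> i) \<bullet> Y u)))))"
      by simp
    also have "\<dots> = (\<Sum>i\<in>I. (LINT u|M. z i * cis (- (freq (\<kappa> i) \<bullet> x)) * (w u * cis (- (freq (\<kappa> i) \<bullet> Y u)))))"
      by (intro Bochner_Integration.integral_sum integrable_mult_right wc) measurable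
    also have "\<dots> = (\<Sum>i\<in>I. z i * cis (- (freq (\<kappa> i) \<bullet> x)) * m (\<kappa> i))"
    proof (intro sum.cong refl)
      fix i assume "i \<in> I"
      show "(LINT u|M. z i * cis (- (freq (\<kappa> i) \<bullet> x)) * (w u * cis (- (freq (\<kappa> i) \<bullet> Y u)))) = z i * cis (- (freq (\<kappa> i) \<bullet> x)) * m (\<kappa> i)"
        unfolding m[OF \<open>i \<in> I\<close>] by (rule integral_mult_right_zero)
    qed
    finally show ?thesis by (simp add: trig_sum_def mult_ac)
  qed
  have "ennreal (trig_l1 I \<kappa> (\<lambda>i. m (\<kappa> i) * z i)) = (\<integral>\<^sup>+x. ennreal (cmod (LINT u|M. w u * trig_sum I \<kappa> z (x + Y u))) \<partial>torus_measure)"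
    by (simp add: nn_integral_trig_sum[symmetric] conv)
  also have "\<dots> \<le> (\<integral>\<^sup>+x. (\<integral>\<^sup>+u. ennreal (cmod (w u)) * ennreal (cmod (trig_sum I \<kappa> z (x + Y u))) \<partial>M) \<partial>torus_measure)"
  proof (intro nn_integral_mono)
    fix x
    have "norm (w u * trig_sum I \<kappa> z (x + Y u)) \<le> norm (complex_of_real (\<Sum>i\<in>I. cmod (z i)) * w u)" for u
      using mult_left_mono[OF cmod_trig_sum_le[of I \<kappa> z "x + Y u"] norm_ge_zero[of "w u"]]
      by (simp add: norm_mult sum_nonneg mult.commute del: of_real_sum)
    then have "integrable M (\<lambda>u. w u * trig_sum I \<kappa> z (x + Y u))"
      by (intro Bochner_Integration.integrable_bound[OF integrable_mult_right[OF w, of "of_real (\<Sum>i\<in>I. cmod (z i))"]]) auto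
    then have "ennreal (cmod (LINT u|M. w u * trig_sum I \<kappa> z (x + Y u))) \<le> (\<integral>\<^sup>+u. ennreal (cmod (w u * trig_sum I \<kappa> z (x + Y u))) \<partial>M)"
      by (rule integral_norm_bound_ennreal)
    then show "ennreal (cmod (LINT u|M. w u * trig_sum I \<kappa> z (x + Y u))) \<le> (\<integral>\<^sup>+u. ennreal (cmod (w u)) * ennreal (cmod (trig_sum I \<kappa> z (x + Y u))) \<partial>M)"
      by (simp add: norm_mult ennreal_mult)
  qed
  also have "\<dots> = (\<integral>\<^sup>+u. (\<integral>\<^sup>+x. ennreal (cmod (w u)) * ennreal (cmod (trig_sum I \<kappa> z (x + Y u))) \<partial>torus_measure) \<partial>M)"
    by (rule Fubini') measurable
  also have "\<dots> = (\<integral>\<^sup>+u. ennreal (cmod (w u)) * (\<integral>\<^sup>+x. ennreal (cmod (trig_sum I \<kappa> z (x + Y u))) \<partial>torus_measure) \<partial>M)"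
    by (intro nn_integral_cong nn_integral_cmult) measurable
  also have "\<dots> = (\<integral>\<^sup>+u. ennreal (cmod (w u)) * ennreal (trig_l1 I \<kappa> z) \<partial>M)"
    by (subst nn_integral_torus_translate[where f="\<lambda>x. ennreal (cmod (trig_sum I \<kappa> z x))"]) (auto simp: trig_sum_period nn_integral_trig_sum)
  also have "\<dots> = (\<integral>\<^sup>+u. ennreal (cmod (w u)) \<partial>M) * ennreal (trig_l1 I \<kappa> z)"
    by (rule nn_integral_multc) measurable
  also have "(\<integral>\<^sup>+u. ennreal (cmod (w u)) \<partial>M) = ennreal (LINT u|M. cmod (w u))"
    using w by (intro nn_integral_eq_integral) auto
  also have "\<dots> * ennreal (trig_l1 I \<kappa> z) = ennreal ((LINT u|M. cmod (w u)) * trig_l1 I \<kappa> z)"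
    by (simp add: ennreal_mult trig_l1_nonneg)
  finally show ?thesis by (simp add: trig_l1_nonneg)
qed

text \<open>
  The one-dimensional heat semigroup along a coordinate direction \<open>e\<close>: \<open>exp(-t
  (k\<cdot>e)\<^sup>2)\<close> is the characteristic function of a Gaussian of variance
  \<open>2t\<close>, at \<open>k\<cdot>e\<close>.
\<close>

lemma trig_l1_heat_direction:
  assumes "0 \<le> t" and e: "e = (1, 0) \<or> e = (0, 1)"
  shows "trig_l1 I \<kappa> (\<lambda>i. of_real (exp (- (t * (freq (\<kappa> i) \<bullet> e)\<^sup>2))) * z i) \<le> trig_l1 I \<kappa> z"
proof -
  interpret N: prob_space std_normal_distribution by (rule prob_space_normal_density) simp
  let ?m = "\<lambda>k. complex_of_real (exp (- (t * (freq k \<bullet> e)\<^sup>2)))"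
  have "trig_l1 I \<kappa> (\<lambda>i. ?m (\<kappa> i) * z i) \<le> (LINT u|std_normal_distribution. cmod 1) * trig_l1 I \<kappa> z"
  \<comment> \<open>A standard normal variable, scaled to variance \<open>2 t\<close> and placed on the axis
    \<open>e\<close>.\<close>
  proof (rule trig_l1_multiplier[where Y="\<lambda>u. (sqrt (2 * t) * u) *\<^sub>R e"])
    show "sigma_finite_measure std_normal_distribution" ..
    fix i
    have "char std_normal_distribution (- (sqrt (2 * t) * (freq (\<kappa> i) \<bullet> e))) = ?m (\<kappa> i)"
      using assms(1) by (simp add: char_std_normal_distribution power_mult_distrib)
    then show "?m (\<kappa> i) = (LINT u|std_normal_distribution. 1 * cis (- (freq (\<kappa> i) \<bullet> (sqrt (2 * t) * u) *\<^sub>R e)))"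
      by (simp add: char_def cis_conv_exp mult_ac)
  qed auto
  moreover have "measure std_normal_distribution UNIV = 1" using N.prob_space by simp
  ultimately show ?thesis by simp
qed

text \<open>
  The semigroup generated by \<open>-(1 - \<Delta>)\<close> contracts \<open>L\<^sup>1\<close>:
  the symbol is \<open>\<langle>k\<rangle>\<^sup>2 = 1 + k\<^sub>1\<^sup>2 +
  k\<^sub>2\<^sup>2\<close>, so the semigroup is a product of the number \<open>exp(-t)\<close>
  and the two directional heat semigroups.
\<close>

lemma trig_l1_heat:
  assumes "0 \<le> t"
  shows "trig_l1 I \<kappa> (\<lambda>i. z i * of_real (exp (- (t * (bracket (freq (\<kappa> i)))\<^sup>2)))) \<le> trig_l1 I \<kappa> z"
proof -
  let ?m = "\<lambda>e i. of_real (exp (- (t * (freq (\<kappa> i) \<bullet> e)\<^sup>2)))"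
  have eq: "(\<lambda>i. z i * of_real (exp (- (t * (bracket (freq (\<kappa> i)))\<^sup>2)))) = (\<lambda>i. of_real (exp (-t)) * (?m (1,0) i * (?m (0,1) i * z i)))"
  proof
    fix i
    have "(bracket (freq (\<kappa> i)))\<^sup>2 = 1 + (freq (\<kappa> i) \<bullet> (1,0))\<^sup>2 + (freq (\<kappa> i) \<bullet> (0,1))\<^sup>2"
      by (simp add: bracket_def freq_def norm_Pair)
    then have "- (t * (bracket (freq (\<kappa> i)))\<^sup>2) = -t + - (t * (freq (\<kappa> i) \<bullet> (1,0))\<^sup>2) + - (t * (freq (\<kappa> i) \<bullet> (0,1))\<^sup>2)"
      by (simp add: algebra_simps)
    then show "z i * of_real (exp (- (t * (bracket (freq (\<kappa> i)))\<^sup>2))) = of_real (exp (-t)) * (?m (1,0) i * (?m (0,1) i * z i))"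
      by (simp only: exp_add of_real_mult) (simp only: mult_ac)
  qed
  have "trig_l1 I \<kappa> (\<lambda>i. of_real (exp (-t)) * v i) = exp (-t) * trig_l1 I \<kappa> v" for v
    by (simp add: trig_l1_def trig_sum_def mult.assoc norm_mult flip: sum_distrib_left)
  then have "trig_l1 I \<kappa> (\<lambda>i. z i * of_real (exp (- (t * (bracket (freq (\<kappa> i)))\<^sup>2)))) = exp (-t) * trig_l1 I \<kappa> (\<lambda>i. ?m (1,0) i * (?m (0,1) i * z i))"
    unfolding eq by simp
  also have "\<dots> \<le> 1 * trig_l1 I \<kappa> (\<lambda>i. ?m (1,0) i * (?m (0,1) i * z i))"
    using assms by (intro mult_right_mono trig_l1_nonneg) simp
  also have "\<dots> \<le> trig_l1 I \<kappa> z"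
    using trig_l1_heat_direction[OF assms, of "(1,0)" I \<kappa> "\<lambda>i. ?m (0,1) i * z i"] trig_l1_heat_direction[OF assms, of "(0,1)" I \<kappa> z] by simp
  finally show ?thesis .
qed

section \<open>Orthogonality and duality with bounded functions\<close>

lemma integral_cis_period:
  "(LINT x|lborel. indicator {0..2*pi} x *\<^sub>R cis (- (of_int k * x))) = (if k = 0 then of_real (2 * pi) else 0)"
proof (cases "k = 0")
  case False
  define F where "F = (\<lambda>x::real. cis (- (of_int k * x)) * (\<i> / of_int k))"
  have "has_bochner_integral lborel (\<lambda>x. indicator {0..2*pi} x *\<^sub>R cis (- (of_int k * x))) (F (2 * pi) - F 0)"
  proof (rule has_bochner_integral_FTC_Icc)
    fix x :: real
    show "(F has_vector_derivative cis (- (of_int k * x))) (at x within {0..2 * pi})"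
      unfolding F_def cis_conv_exp
      by (rule derivative_eq_intros has_vector_derivative_real_field refl | simp add: False)+
  qed (auto intro!: continuous_intros)
  moreover have "cis (- (of_int k * (2 * pi))) = 1"
    using cis_multiple_2pi[of "- of_int k"] by (simp add: mult_ac)
  ultimately show ?thesis using False by (simp add: has_bochner_integral_iff F_def)
qed (simp add: scaleR_conv_of_real)

lemma (in pair_sigma_finite) integral_tensor:
  fixes f :: "'a \<Rightarrow> complex" and g :: "'b \<Rightarrow> complex"
  assumes f: "integrable M1 f" and g: "integrable M2 g"
  shows "integrable (M1 \<Otimes>\<^sub>M M2) (\<lambda>x. f (fst x) * g (snd x))"
    and "(LINT x|(M1 \<Otimes>\<^sub>M M2). f (fst x) * g (snd x)) = (LINT a|M1. f a) * (LINT b|M2. g b)"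
proof -
  have [measurable]: "f \<in> borel_measurable M1" "g \<in> borel_measurable M2" using f g by simp_all
  show int: "integrable (M1 \<Otimes>\<^sub>M M2) (\<lambda>x. f (fst x) * g (snd x))"
    by (rule Fubini_integrable) (use f g in \<open>auto simp: norm_mult\<close>)
  show "(LINT x|(M1 \<Otimes>\<^sub>M M2). f (fst x) * g (snd x)) = (LINT a|M1. f a) * (LINT b|M2. g b)"
    using integral_fst'[OF int] by simp
qed

definition torus_area :: real where "torus_area = (2 * pi)\<^sup>2"

lemma torus_area_pos [simp]: "0 < torus_area"
  by (simp add: torus_area_def)

lemma torus_area_nonneg [simp]: "0 \<le> torus_area" "torus_area \<noteq> 0" "\<bar>torus_area\<bar> = torus_area"
  by (simp_all add: torus_area_def)

lemma torus_coeff_area: "torus_coeff g n = (LINT x|torus_measure. g x * cis (- (freq n \<bullet> x))) / of_real torus_area"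
  by (simp only: torus_coeff_def torus_area_def)

lemma integral_cis_torus:
  "(LINT x|torus_measure. cis (- (freq k \<bullet> x))) = (if k = 0 then of_real (torus_area) else 0)"
proof -
  let ?f = "\<lambda>j x::real. indicator {0..2*pi} x *\<^sub>R cis (- (of_int j * x))"
  have eq: "indicator torus x *\<^sub>R cis (- (freq k \<bullet> x)) = ?f (fst k) (fst x) * ?f (snd k) (snd x)" for x
    by (cases x) (auto simp: torus_def cbox_Pair_eq indicator_def freq_def cis_mult)
  have int: "integrable lborel (?f j)" for j
    by (rule borel_integrable_compact) (auto intro!: continuous_intros)
  have "(LINT x|torus_measure. cis (- (freq k \<bullet> x))) = (LINT x|(lborel \<Otimes>\<^sub>M lborel). ?f (fst k) (fst x) * ?f (snd k) (snd x))"
    unfolding torus_measure_def lborel_prod eq[symmetric] by (rule integral_restrict_space) simp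
  also have "\<dots> = (LINT a|lborel. ?f (fst k) a) * (LINT b|lborel. ?f (snd k) b)"
    by (rule lborel_pair.integral_tensor(2)[OF int int])
  finally show ?thesis by (simp only: integral_cis_period) (auto simp: prod_eq_iff power2_eq_square torus_area_def)
qed

lemma freq_diff: "freq (k - l) = freq k - freq l"
  by (simp add: freq_def)

lemma freq_add: "freq (k + l) = freq k + freq l"
  by (simp add: freq_def)

lemma freq_minus: "freq (- k) = - freq k"
  by (simp add: freq_def)

lemma integral_cis_torus_pair:
  "(LINT x|torus_measure. cis (- (freq k \<bullet> x)) * cnj (cis (- (freq l \<bullet> x)))) = (if k = l then of_real (torus_area) else 0)"
proof -
  have "cis (- (freq k \<bullet> x)) * cnj (cis (- (freq l \<bullet> x))) = cis (- (freq (k - l) \<bullet> x))" for x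
    by (simp add: cis_cnj cis_mult freq_diff inner_diff_left)
  then show ?thesis by (simp add: integral_cis_torus)
qed

lemma trig_sum_parseval:
  assumes "finite I" "inj_on \<kappa> I"
  shows "(LINT x|torus_measure. (cmod (trig_sum I \<kappa> z x))\<^sup>2) = torus_area * (\<Sum>i\<in>I. (cmod (z i))\<^sup>2)"
proof -
  have int: "integrable torus_measure (\<lambda>x. c * (cis (- (freq k \<bullet> x)) * cnj (cis (- (freq l \<bullet> x)))))" for c k l
  proof (rule integrable_torus_bounded[where B="cmod c"])
    show "(\<lambda>x. c * (cis (- (freq k \<bullet> x)) * cnj (cis (- (freq l \<bullet> x))))) \<in> borel_measurable borel"
      by (intro borel_measurable_continuous_onI continuous_intros)
  qed (simp add: norm_mult)
  have "complex_of_real (LINT x|torus_measure. (cmod (trig_sum I \<kappa> z x))\<^sup>2)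
     = (LINT x|torus_measure. trig_sum I \<kappa> z x * cnj (trig_sum I \<kappa> z x))"
    by (subst integral_complex_of_real[symmetric]) (simp only: complex_norm_square)
  also have "\<dots> = (LINT x|torus_measure. (\<Sum>i\<in>I. \<Sum>j\<in>I. (z i * cnj (z j)) * (cis (- (freq (\<kappa> i) \<bullet> x)) * cnj (cis (- (freq (\<kappa> j) \<bullet> x))))))"
    unfolding trig_sum_def cnj_sum sum_product by (simp only: complex_cnj_mult mult_ac)
  also have "\<dots> = (\<Sum>i\<in>I. \<Sum>j\<in>I. (z i * cnj (z j)) * (if \<kappa> i = \<kappa> j then of_real (torus_area) else 0))"
    by (simp only: Bochner_Integration.integral_sum Bochner_Integration.integrable_sum int integral_mult_right_zero integral_cis_torus_pair)
  also have "\<dots> = (\<Sum>i\<in>I. \<Sum>j\<in>I. if i = j then (z i * cnj (z j)) * of_real (torus_area) else 0)"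
    using assms(2) by (intro sum.cong refl) (auto simp: inj_on_def)
  also have "\<dots> = complex_of_real (torus_area * (\<Sum>i\<in>I. (cmod (z i))\<^sup>2))"
    using assms(1) by (simp add: sum.delta complex_norm_square[symmetric] sum_distrib_left mult_ac)
  finally show ?thesis by (simp only: of_real_eq_iff)
qed

text \<open>
  Cauchy-Schwarz on the torus followed by Parseval's identity for both factors.
\<close>

lemma integral_CS_trig_sum:
  assumes "finite I" "inj_on \<kappa> I" "finite J" "inj_on \<kappa>' J"
  shows "(LINT x|torus_measure. cmod (trig_sum I \<kappa> z x) * cmod (trig_sum J \<kappa>' w x))
    \<le> torus_area * (L2_set (\<lambda>i. cmod (z i)) I * L2_set (\<lambda>i. cmod (w i)) J)"
proof -
  let ?f = "\<lambda>x. cmod (trig_sum I \<kappa> z x)" and ?g = "\<lambda>x. cmod (trig_sum J \<kappa>' w x)"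
  have [measurable]: "?f \<in> borel_measurable torus_measure" "?g \<in> borel_measurable torus_measure"
    by (auto intro!: measurable_torus_measureI)
  have b: "?f x \<le> (\<Sum>i\<in>I. cmod (z i))" "?g x \<le> (\<Sum>i\<in>J. cmod (w i))" for x
    by (rule cmod_trig_sum_le)+
  have int: "integrable torus_measure (\<lambda>x. ?f x * ?g x)" "integrable torus_measure (\<lambda>x. (?f x)\<^sup>2)" "integrable torus_measure (\<lambda>x. (?g x)\<^sup>2)"
    by (rule integrable_torus_bounded[where B="(\<Sum>i\<in>I. cmod (z i)) * (\<Sum>i\<in>J. cmod (w i))"]
             integrable_torus_bounded[where B="(\<Sum>i\<in>I. cmod (z i))\<^sup>2"] integrable_torus_bounded[where B="(\<Sum>i\<in>J. cmod (w i))\<^sup>2"],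
        simp, use b in \<open>auto simp: abs_mult power2_eq_square intro!: mult_mono sum_nonneg\<close>)+
  have nn: "(\<integral>\<^sup>+x. ennreal (h x) \<partial>torus_measure) = ennreal (LINT x|torus_measure. h x)" if "integrable torus_measure h" "\<And>x. 0 \<le> h x" for h
    by (rule nn_integral_eq_integral) (use that in auto)
  have "(\<integral>\<^sup>+x. ennreal (?f x) * ennreal (?g x) \<partial>torus_measure)\<^sup>2 \<le> (\<integral>\<^sup>+x. ennreal (?f x) ^ 2 \<partial>torus_measure) * (\<integral>\<^sup>+x. ennreal (?g x) ^ 2 \<partial>torus_measure)"
    by (rule Cauchy_Schwarz_nn_integral) auto
  then have "(\<integral>\<^sup>+x. ennreal (?f x * ?g x) \<partial>torus_measure)\<^sup>2 \<le> (\<integral>\<^sup>+x. ennreal ((?f x) ^ 2) \<partial>torus_measure) * (\<integral>\<^sup>+x. ennreal ((?g x) ^ 2) \<partial>torus_measure)"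
    by (simp add: ennreal_mult ennreal_power)
  then have "(ennreal (LINT x|torus_measure. ?f x * ?g x))\<^sup>2 \<le> ennreal (LINT x|torus_measure. (?f x)\<^sup>2) * ennreal (LINT x|torus_measure. (?g x)\<^sup>2)"
    by (simp add: nn int)
  then have le: "(LINT x|torus_measure. ?f x * ?g x)\<^sup>2 \<le> (LINT x|torus_measure. (?f x)\<^sup>2) * (LINT x|torus_measure. (?g x)\<^sup>2)"
    by (simp add: ennreal_power ennreal_mult[symmetric] integral_nonneg_AE)
  have "sqrt (torus_area * a * (torus_area * b)) = torus_area * (sqrt a * sqrt b)" for a b
    by (simp add: real_sqrt_mult)
  note sq = this
  have "(LINT x|torus_measure. ?f x * ?g x) \<le> sqrt ((LINT x|torus_measure. (?f x)\<^sup>2) * (LINT x|torus_measure. (?g x)\<^sup>2))"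
    using le by (rule real_le_rsqrt)
  also have "\<dots> = torus_area * (L2_set (\<lambda>i. cmod (z i)) I * L2_set (\<lambda>i. cmod (w i)) J)"
    by (simp add: trig_sum_parseval[OF assms(1,2)] trig_sum_parseval[OF assms(3,4)] L2_set_def sq)
  finally show ?thesis .
qed

type_synonym freq3 = "(int \<times> int) \<times> (int \<times> int) \<times> (int \<times> int)"

text \<open>
  In the pairing of \<open>f g h\<close> with a test function, \<open>l\<close>, \<open>m\<close>
  and \<open>n\<close> are the frequencies of \<open>g\<close>, \<open>h\<close> and of the test
  function, and \<open>n - l - m\<close> is the one left for \<open>f\<close>.
\<close>

definition tri_freq :: "freq3 \<Rightarrow> int \<times> int" where
  "tri_freq = (\<lambda>(l, m, n). n - l - m)"

text \<open>
  The coefficients \<open>c\<close> define a functional of norm at most \<open>B\<close> on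
  trigonometric polynomials with the \<open>L\<^sup>1\<close> norm. Bounded functions have this
  property, and it is the only information on them that the estimates use; unlike boundedness it
  is visibly inherited by \<open>a c\<close> when the multiplier \<open>a\<close> averages
  translates. The index type is fixed because a definition cannot quantify over types; triples are
  what the product needs.
\<close>

definition dual_bounded :: "real \<Rightarrow> torus_distr \<Rightarrow> bool" where
  "dual_bounded B c \<longleftrightarrow> 0 \<le> B \<and>
    (\<forall>I z. finite I \<longrightarrow> cmod (\<Sum>i\<in>I. c (tri_freq i) * z i) \<le> B * trig_l1 I tri_freq z)"

lemma dual_bounded_torus_coeff:
  assumes [measurable]: "g \<in> borel_measurable torus_measure" and B: "AE x in torus_measure. cmod (g x) \<le> B" and "0 \<le> B"
  shows "dual_bounded (B / torus_area) (torus_coeff g)"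
proof -
  interpret finite_measure torus_measure by (rule finite_measure_torus)
  have [measurable]: "(\<lambda>x. cis (- (freq k \<bullet> x))) \<in> borel_measurable torus_measure" for k
    by (intro measurable_torus_measureI) measurable
  have [measurable]: "trig_sum I \<kappa> z \<in> borel_measurable torus_measure" for I and \<kappa> :: "freq3 \<Rightarrow> _" and z
    by (intro measurable_torus_measureI) measurable
  have int: "integrable torus_measure (\<lambda>x. g x * cis (- (freq k \<bullet> x)))" for k
    by (rule integrable_const_bound[where B=B]) (use B in \<open>auto simp: norm_mult\<close>)
  have "cmod (\<Sum>i\<in>I. torus_coeff g (tri_freq i) * z i) \<le> B / torus_area * trig_l1 I tri_freq z" if "finite I" for I z
  proof -
    have "(\<Sum>i\<in>I. torus_coeff g (tri_freq i) * z i) = (LINT x|torus_measure. g x * trig_sum I tri_freq z x) / of_real (torus_area)"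
    proof -
      have "(LINT x|torus_measure. g x * trig_sum I tri_freq z x) = (LINT x|torus_measure. (\<Sum>i\<in>I. z i * (g x * cis (- (freq (tri_freq i) \<bullet> x)))))"
        by (simp add: trig_sum_def sum_distrib_left mult_ac)
      also have "\<dots> = (\<Sum>i\<in>I. z i * (LINT x|torus_measure. g x * cis (- (freq (tri_freq i) \<bullet> x))))"
        by (simp only: Bochner_Integration.integral_sum integrable_mult_right int integral_mult_right_zero)
      finally show ?thesis by (simp add: torus_coeff_area sum_divide_distrib mult_ac)
    qed
    moreover have "cmod (LINT x|torus_measure. g x * trig_sum I tri_freq z x) \<le> (LINT x|torus_measure. B * cmod (trig_sum I tri_freq z x))"
    proof (rule order_trans[OF integral_norm_bound integral_mono_AE])
      show "integrable torus_measure (\<lambda>x. B * cmod (trig_sum I tri_freq z x))"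
        by (intro integrable_mult_right trig_sum_integrable)
      show *: "AE x in torus_measure. cmod (g x * trig_sum I tri_freq z x) \<le> B * cmod (trig_sum I tri_freq z x)"
        using B by eventually_elim (auto simp: norm_mult intro!: mult_right_mono)
      show "integrable torus_measure (\<lambda>x. cmod (g x * trig_sum I tri_freq z x))"
      proof (rule Bochner_Integration.integrable_bound)
        show "integrable torus_measure (\<lambda>x. B * cmod (trig_sum I tri_freq z x))"
          by (intro integrable_mult_right trig_sum_integrable)
        show "AE x in torus_measure. norm (cmod (g x * trig_sum I tri_freq z x)) \<le> norm (B * cmod (trig_sum I tri_freq z x))"
          using * by eventually_elim auto
      qed measurable
    qed
    ultimately show ?thesis by (simp add: trig_l1_def norm_divide divide_right_mono)
  qed
  with \<open>0 \<le> B\<close> show ?thesis by (simp add: dual_bounded_def)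
qed

definition kernel_bound :: "real \<Rightarrow> torus_distr \<Rightarrow> bool" where
  "kernel_bound M a \<longleftrightarrow> finite {k. a k \<noteq> 0} \<and>
     (LINT x|torus_measure. cmod (\<Sum>k \<in> {k. a k \<noteq> 0}. a k * cis (freq k \<bullet> x))) \<le> M"

text \<open>
  The coefficients are recovered from the kernel, which exhibits them as a multiplier of the form
  treated in \<open>trig_l1_multiplier\<close>.
\<close>

lemma kernel_coeff:
  assumes "finite {k. a k \<noteq> 0}"
  shows "(LINT x|torus_measure. (\<Sum>k \<in> {k. a k \<noteq> 0}. a k * cis (freq k \<bullet> x)) / of_real (torus_area) * cis (- (freq l \<bullet> x))) = a l"
proof -
  have eq: "(\<Sum>k \<in> {k. a k \<noteq> 0}. a k * cis (freq k \<bullet> x)) / of_real (torus_area) * cis (- (freq l \<bullet> x))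
      = (\<Sum>k \<in> {k. a k \<noteq> 0}. a k / of_real (torus_area) * cis (- (freq (l - k) \<bullet> x)))" for x
  proof -
    have "cis (freq k \<bullet> x) * cis (- (freq l \<bullet> x)) = cis (- (freq (l - k) \<bullet> x))" for k
      by (simp add: cis_mult freq_diff inner_diff_left)
    then show ?thesis
      by (simp add: sum_divide_distrib sum_distrib_right mult.assoc)
  qed
  have int: "integrable torus_measure (\<lambda>x. c * cis (- (freq k \<bullet> x)))" for c k
    by (rule integrable_torus_bounded[where B="cmod c"]) (auto simp: norm_mult)
  have "(LINT x|torus_measure. (\<Sum>k \<in> {k. a k \<noteq> 0}. a k / of_real (torus_area) * cis (- (freq (l - k) \<bullet> x))))
     = (\<Sum>k \<in> {k. a k \<noteq> 0}. a k / of_real (torus_area) * (if l - k = 0 then of_real (torus_area) else 0))"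
    by (simp only: Bochner_Integration.integral_sum int integral_mult_right_zero integral_cis_torus)
  also have "\<dots> = (\<Sum>k \<in> {k. a k \<noteq> 0}. if l = k then a k else 0)"
    by (intro sum.cong refl) auto
  also have "\<dots> = a l" using assms by (simp add: sum.delta)
  finally show ?thesis by (simp only: eq)
qed

lemma kernel_integrable: "integrable torus_measure (\<lambda>x. (\<Sum>k \<in> {k. a k \<noteq> 0}. a k * cis (freq k \<bullet> x)) / of_real (torus_area))"
  by (rule integrable_torus_bounded[where B="(\<Sum>k \<in> {k. a k \<noteq> 0}. cmod (a k)) / torus_area"])
     (auto simp: norm_divide norm_mult sum_nonneg intro!: divide_right_mono order_trans[OF norm_sum])

lemma kernel_l1:
  "(LINT x|torus_measure. cmod ((\<Sum>k \<in> {k. a k \<noteq> 0}. a k * cis (freq k \<bullet> x)) / of_real (torus_area)))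
   = (LINT x|torus_measure. cmod (\<Sum>k \<in> {k. a k \<noteq> 0}. a k * cis (freq k \<bullet> x))) / torus_area"
  by (simp add: norm_divide)

lemma kernel_bound_coeff:
  assumes "kernel_bound M a"
  shows "cmod (a k) \<le> M / torus_area"
proof -
  let ?w = "\<lambda>x. (\<Sum>k \<in> {k. a k \<noteq> 0}. a k * cis (freq k \<bullet> x)) / of_real (torus_area)"
  have "cmod (a k) = cmod (LINT x|torus_measure. ?w x * cis (- (freq k \<bullet> x)))"
    using assms by (subst kernel_coeff) (auto simp: kernel_bound_def)
  also have "\<dots> \<le> (LINT x|torus_measure. cmod (?w x * cis (- (freq k \<bullet> x))))"
    by (rule integral_norm_bound)
  also have "\<dots> = (LINT x|torus_measure. cmod (?w x))" by (simp only: norm_mult norm_cis mult_1_right)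
  also have "\<dots> \<le> M / torus_area"
    unfolding kernel_l1 using assms by (intro divide_right_mono) (auto simp: kernel_bound_def)
  finally show ?thesis .
qed

lemma dual_bounded_kernel:
  assumes B: "dual_bounded B c" and a: "kernel_bound M a"
  shows "dual_bounded (B * (M / torus_area)) (\<lambda>k. a k * c k)"
proof -
  have M: "0 \<le> M / torus_area" using kernel_bound_coeff[OF a] norm_ge_zero order_trans by blast
  have "cmod (\<Sum>i\<in>I. a (tri_freq i) * c (tri_freq i) * z i) \<le> B * (M / torus_area) * trig_l1 I tri_freq z" if "finite I" for I z
  proof -
    have 1: "cmod (\<Sum>i\<in>I. c (tri_freq i) * (a (tri_freq i) * z i)) \<le> B * trig_l1 I tri_freq (\<lambda>i. a (tri_freq i) * z i)"
      using B that by (simp add: dual_bounded_def)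
    have "trig_l1 I tri_freq (\<lambda>i. a (tri_freq i) * z i) \<le> 
       (LINT x|torus_measure. cmod ((\<Sum>k \<in> {k. a k \<noteq> 0}. a k * cis (freq k \<bullet> x)) / of_real (torus_area))) * trig_l1 I tri_freq z"
    proof (rule trig_l1_multiplier[where Y="\<lambda>x. x"])
      interpret finite_measure torus_measure by (rule finite_measure_torus)
      show "sigma_finite_measure torus_measure" ..
      show "(\<lambda>x. x) \<in> torus_measure \<rightarrow>\<^sub>M borel" by (intro measurable_torus_measureI) simp
    qed (use a in \<open>simp_all only: kernel_coeff kernel_bound_def kernel_integrable\<close>)
    also have "\<dots> \<le> M / torus_area * trig_l1 I tri_freq z"
      unfolding kernel_l1 using a by (intro mult_right_mono divide_right_mono trig_l1_nonneg) (auto simp: kernel_bound_def)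
    finally have "B * trig_l1 I tri_freq (\<lambda>i. a (tri_freq i) * z i) \<le> B * (M / torus_area * trig_l1 I tri_freq z)"
      using B by (intro mult_left_mono) (auto simp: dual_bounded_def)
    with 1 show ?thesis by (simp add: mult_ac)
  qed
  moreover have "0 \<le> B * (M / torus_area)" using B M by (intro mult_nonneg_nonneg) (auto simp: dual_bounded_def)
  ultimately show ?thesis by (simp add: dual_bounded_def)
qed

section \<open>The estimate on dyadic blocks\<close>

lemma trig_l1_triangle: "trig_l1 I \<kappa> (\<lambda>i. z i + w i) \<le> trig_l1 I \<kappa> z + trig_l1 I \<kappa> w"
proof -
  have eq: "trig_sum I \<kappa> (\<lambda>i. z i + w i) x = trig_sum I \<kappa> z x + trig_sum I \<kappa> w x" for x
    by (simp add: trig_sum_def sum.distrib distrib_right)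
  show ?thesis
    unfolding trig_l1_def eq
    by (subst Bochner_Integration.integral_add[symmetric])
       (auto intro!: integral_mono trig_sum_integrable integrable_norm Bochner_Integration.integrable_add norm_triangle_ineq)
qed

lemma trig_l1_minus: "trig_l1 I \<kappa> (\<lambda>i. - z i) = trig_l1 I \<kappa> z"
  by (simp add: trig_l1_def trig_sum_def sum_negf)

text \<open>
  The coefficients of \<open>g(x) h(x) \<phi>(-x)\<close> as a sum over triples of frequencies.
\<close>

definition tri_prod :: "torus_distr \<Rightarrow> torus_distr \<Rightarrow> torus_distr \<Rightarrow> freq3 \<Rightarrow> complex" where
  "tri_prod g h \<phi> = (\<lambda>(l, m, n). g l * h m * \<phi> n)"

abbreviation l2norm :: "(int \<times> int \<Rightarrow> complex) \<Rightarrow> (int \<times> int) set \<Rightarrow> real" where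
  "l2norm g A \<equiv> L2_set (\<lambda>l. cmod (g l)) A"

lemma trig_sum_tri_prod:
  "trig_sum (A \<times> B \<times> C) tri_freq (tri_prod g h \<phi>) x = trig_sum A uminus g x * trig_sum B uminus h x * trig_sum C id \<phi> x"
proof -
  have "trig_sum (A \<times> B \<times> C) tri_freq (tri_prod g h \<phi>) x
     = (\<Sum>l\<in>A. \<Sum>m\<in>B. \<Sum>n\<in>C. (g l * cis (- (freq (- l) \<bullet> x))) * ((h m * cis (- (freq (- m) \<bullet> x))) * (\<phi> n * cis (- (freq n \<bullet> x)))))"
    unfolding trig_sum_def sum.cartesian_product
    by (intro sum.cong refl) (simp add: case_prod_beta tri_freq_def tri_prod_def freq_diff freq_minus freq_add inner_diff_left inner_add_left cis_mult algebra_simps)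
  also have "\<dots> = trig_sum A uminus g x * trig_sum B uminus h x * trig_sum C id \<phi> x"
    unfolding trig_sum_def id_apply
    by (simp only: sum_distrib_left[symmetric] sum_distrib_right[symmetric]) (simp only: mult.assoc)
  finally show ?thesis .
qed

lemma cmod_trig_sum_le_card:
  assumes "finite I" "real (card I) \<le> K\<^sup>2" "0 \<le> K"
  shows "cmod (trig_sum I \<kappa> z x) \<le> K * l2norm z I"
proof -
  have "cmod (trig_sum I \<kappa> z x) \<le> (\<Sum>i\<in>I. \<bar>1\<bar> * \<bar>cmod (z i)\<bar>)"
    using cmod_trig_sum_le[of I \<kappa> z x] by simp
  also have "\<dots> \<le> L2_set (\<lambda>_. 1) I * l2norm z I"
    by (rule L2_set_mult_ineq)
  also have "\<dots> \<le> K * l2norm z I"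
    using assms by (intro mult_right_mono L2_set_nonneg) (auto simp: L2_set_constant intro: real_le_lsqrt)
  finally show ?thesis .
qed

text \<open>
  Hoelder's inequality with exponents \<open>\<infinity>\<close>, \<open>2\<close>,
  \<open>2\<close>. The factor with few frequencies goes into \<open>L\<^sup>\<infinity>\<close>,
  where its norm is at most the square root of the number of frequencies times the
  \<open>l\<^sup>2\<close> norm of its coefficients.
\<close>

lemma trig_l1_tri_prod:
  assumes fin: "finite A" "finite B" "finite C" and "0 \<le> K"
    and K: "real (card A) \<le> K\<^sup>2 \<or> real (card B) \<le> K\<^sup>2 \<or> real (card C) \<le> K\<^sup>2"
  shows "trig_l1 (A \<times> B \<times> C) tri_freq (tri_prod g h \<phi>) \<le> torus_area * K * (l2norm g A * l2norm h B * l2norm \<phi> C)"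
proof -
  have inj: "inj_on uminus S" "inj_on id S" for S :: "(int \<times> int) set" by auto
  have key: "(LINT x|torus_measure. cmod (trig_sum I \<kappa> z x) * (cmod (trig_sum I' \<kappa>' z' x) * cmod (trig_sum I'' \<kappa>'' z'' x)))
      \<le> torus_area * K * (l2norm z I * l2norm z' I' * l2norm z'' I'')"
    if "finite I" "real (card I) \<le> K\<^sup>2" "finite I'" "finite I''" "inj_on \<kappa>' I'" "inj_on \<kappa>'' I''" 
    for I I' I'' :: "(int \<times> int) set" and \<kappa> \<kappa>' \<kappa>'' z z' z''
  proof -
    have int: "integrable torus_measure (\<lambda>x. cmod (trig_sum I \<kappa> z x) * (cmod (trig_sum I' \<kappa>' z' x) * cmod (trig_sum I'' \<kappa>'' z'' x)))"
      "integrable torus_measure (\<lambda>x. cmod (trig_sum I' \<kappa>' z' x) * cmod (trig_sum I'' \<kappa>'' z'' x))"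
      by (rule integrable_torus_bounded[where B="(\<Sum>i\<in>I. cmod (z i)) * ((\<Sum>i\<in>I'. cmod (z' i)) * (\<Sum>i\<in>I''. cmod (z'' i)))"]
            integrable_torus_bounded[where B="(\<Sum>i\<in>I'. cmod (z' i)) * (\<Sum>i\<in>I''. cmod (z'' i))"],
          simp, auto simp: abs_mult intro!: mult_mono cmod_trig_sum_le sum_nonneg mult_nonneg_nonneg)+
    have "(LINT x|torus_measure. cmod (trig_sum I \<kappa> z x) * (cmod (trig_sum I' \<kappa>' z' x) * cmod (trig_sum I'' \<kappa>'' z'' x)))
       \<le> (LINT x|torus_measure. (K * l2norm z I) * (cmod (trig_sum I' \<kappa>' z' x) * cmod (trig_sum I'' \<kappa>'' z'' x)))"
      using that \<open>0 \<le> K\<close> by (intro integral_mono int integrable_mult_right mult_right_mono cmod_trig_sum_le_card) auto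
    also have "\<dots> = (K * l2norm z I) * (LINT x|torus_measure. cmod (trig_sum I' \<kappa>' z' x) * cmod (trig_sum I'' \<kappa>'' z'' x))"
      by simp
    also have "\<dots> \<le> (K * l2norm z I) * (torus_area * (l2norm z' I' * l2norm z'' I''))"
      using that \<open>0 \<le> K\<close> by (intro mult_left_mono integral_CS_trig_sum) auto
    finally show ?thesis by (simp add: mult_ac)
  qed
  have "trig_l1 (A \<times> B \<times> C) tri_freq (tri_prod g h \<phi>) = (LINT x|torus_measure. cmod (trig_sum A uminus g x) * (cmod (trig_sum B uminus h x) * cmod (trig_sum C id \<phi> x)))"
    unfolding trig_l1_def trig_sum_tri_prod by (simp add: norm_mult mult_ac)
  with K key[of A B C uminus id uminus g h \<phi>] key[of B A C uminus id uminus h g \<phi>] key[of C A B uminus uminus id \<phi> g h] fin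
  show ?thesis by (auto simp: mult_ac)
qed

lemma l2norm_weight:
  assumes "\<And>k. k \<in> A \<Longrightarrow> \<bar>c k\<bar> \<le> Q" "0 \<le> Q"
  shows "l2norm (\<lambda>k. of_real (c k) * g k) A \<le> Q * l2norm g A"
  unfolding L2_set_right_distrib[OF assms(2)]
  using assms by (intro L2_set_mono) (auto simp: norm_mult intro!: mult_right_mono)

text \<open>
  The Leibniz rule: a derivative of the product is a sum of three products in which one factor is
  differentiated, which costs a factor \<open>Q\<close> because all frequencies are at most
  \<open>Q\<close>. The number of derivatives is arbitrary to make the induction work; it is used
  for \<open>2\<close>.
\<close>

lemma trig_l1_tri_prod_weight:
  assumes fin: "finite A" "finite B" "finite C" and "0 \<le> K" "0 \<le> Q"
    and K: "real (card A) \<le> K\<^sup>2 \<or> real (card B) \<le> K\<^sup>2 \<or> real (card C) \<le> K\<^sup>2"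
    and Q: "\<And>k. k \<in> A \<union> B \<union> C \<Longrightarrow> \<bar>freq k \<bullet> e\<bar> \<le> Q"
  shows "trig_l1 (A \<times> B \<times> C) tri_freq (\<lambda>i. of_real ((freq (tri_freq i) \<bullet> e) ^ p) * tri_prod g h \<phi> i)
     \<le> (3 * Q) ^ p * (torus_area * K * (l2norm g A * l2norm h B * l2norm \<phi> C))"
proof (induction p arbitrary: g h \<phi>)
  case 0
  then show ?case using trig_l1_tri_prod[OF fin \<open>0 \<le> K\<close> K] by simp
next
  case (Suc p)
  let ?c = "\<lambda>k. freq k \<bullet> e"
  let ?w = "\<lambda>g k. complex_of_real (?c k) * g k"
  let ?I = "A \<times> B \<times> C"
  let ?T = "\<lambda>g h \<phi> i. of_real ((?c (tri_freq i)) ^ p) * tri_prod g h \<phi> i"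
  let ?N = "\<lambda>g h \<phi>. torus_area * K * (l2norm g A * l2norm h B * l2norm \<phi> C)"
  have eq: "(\<lambda>i. of_real ((?c (tri_freq i)) ^ Suc p) * tri_prod g h \<phi> i)
      = (\<lambda>i. ?T g h (?w \<phi>) i + (- ?T (?w g) h \<phi> i + - ?T g (?w h) \<phi> i))"
  proof
    fix i :: freq3
    obtain l m n where i: "i = (l, m, n)" by (cases i) auto
    have "?c (tri_freq i) = ?c n - ?c l - ?c m" by (simp add: i tri_freq_def freq_diff inner_diff_left)
    then have "complex_of_real (?c (tri_freq i) ^ Suc p) = (of_real (?c n) - of_real (?c l) - of_real (?c m)) * of_real (?c (tri_freq i) ^ p)"
      by simp
    then show "of_real ((?c (tri_freq i)) ^ Suc p) * tri_prod g h \<phi> i = ?T g h (?w \<phi>) i + (- ?T (?w g) h \<phi> i + - ?T g (?w h) \<phi> i)"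
      by (simp only:) (simp add: i tri_prod_def algebra_simps)
  qed
  have "trig_l1 ?I tri_freq (\<lambda>i. of_real ((?c (tri_freq i)) ^ Suc p) * tri_prod g h \<phi> i)
     \<le> trig_l1 ?I tri_freq (?T g h (?w \<phi>)) + (trig_l1 ?I tri_freq (?T (?w g) h \<phi>) + trig_l1 ?I tri_freq (?T g (?w h) \<phi>))"
    unfolding eq
    using trig_l1_triangle[of ?I tri_freq "?T g h (?w \<phi>)" "\<lambda>i. - ?T (?w g) h \<phi> i + - ?T g (?w h) \<phi> i"]
      trig_l1_triangle[of ?I tri_freq "\<lambda>i. - ?T (?w g) h \<phi> i" "\<lambda>i. - ?T g (?w h) \<phi> i"]
    by (simp only: trig_l1_minus)
  also have "\<dots> \<le> (3 * Q) ^ p * ?N g h (?w \<phi>) + ((3 * Q) ^ p * ?N (?w g) h \<phi> + (3 * Q) ^ p * ?N g (?w h) \<phi>)"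
    by (intro add_mono Suc.IH)
  also have "\<dots> \<le> (3 * Q) ^ p * (Q * ?N g h \<phi>) + ((3 * Q) ^ p * (Q * ?N g h \<phi>) + (3 * Q) ^ p * (Q * ?N g h \<phi>))"
  proof -
    have w: "l2norm (?w g) A \<le> Q * l2norm g A" "l2norm (?w h) B \<le> Q * l2norm h B" "l2norm (?w \<phi>) C \<le> Q * l2norm \<phi> C"
      using Q \<open>0 \<le> Q\<close> by (intro l2norm_weight; blast)+
    have tK: "0 \<le> torus_area * K" using \<open>0 \<le> K\<close> by simp
    have n1: "?N g h (?w \<phi>) \<le> torus_area * K * (l2norm g A * l2norm h B * (Q * l2norm \<phi> C))"
      by (intro mult_left_mono[OF _ tK] mult_left_mono w mult_nonneg_nonneg L2_set_nonneg)
    have n2: "?N (?w g) h \<phi> \<le> torus_area * K * ((Q * l2norm g A) * l2norm h B * l2norm \<phi> C)"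
      by (intro mult_left_mono[OF _ tK] mult_right_mono w L2_set_nonneg)
    have n3: "?N g (?w h) \<phi> \<le> torus_area * K * (l2norm g A * (Q * l2norm h B) * l2norm \<phi> C)"
      by (intro mult_left_mono[OF _ tK] mult_right_mono[OF mult_left_mono] w L2_set_nonneg)
    have 2: "(3 * Q) ^ p \<ge> 0" using \<open>0 \<le> Q\<close> by simp
    show ?thesis
      using n1 n2 n3 by (intro add_mono mult_left_mono[OF _ 2]) (simp_all add: mult_ac)
  qed
  also have "\<dots> = (3 * Q) ^ Suc p * ?N g h \<phi>" by (simp add: algebra_simps)
  finally show ?case .
qed

lemma bracket_sq: "(bracket (freq k))\<^sup>2 = 1 + (freq k \<bullet> (1, 0))\<^sup>2 + (freq k \<bullet> (0, 1))\<^sup>2"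
  by (simp add: bracket_def freq_def norm_Pair)

lemma bracket_ge_1: "1 \<le> bracket x"
  by (simp add: bracket_def)

lemma bracket_pos [simp]: "0 < bracket x" "0 \<le> bracket x" "bracket x \<noteq> 0"
  using bracket_ge_1[of x] by linarith+

text \<open>
  The bound of \<open>(1 - \<Delta>)\<^sup>\<sigma>\<^sup>/\<^sup>2\<close> of a product of three
  frequency-localised functions, tested against a bounded function. It is subordination with
  \<open>\<theta> = \<sigma>/2\<close> and \<open>a = \<langle>n - l - m\<rangle>\<^sup>2\<close>:
  the semigroup acts as a contraction, and \<open>1 - \<Delta>\<close> costs at most \<open>19
  Q\<^sup>2\<close> by the Leibniz rule.
\<close>

lemma block_estimate:
  assumes c: "dual_bounded \<beta> c" and fin: "finite A" "finite B" "finite C" and "0 \<le> K" "1 \<le> Q"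
    and K: "real (card A) \<le> K\<^sup>2 \<or> real (card B) \<le> K\<^sup>2 \<or> real (card C) \<le> K\<^sup>2"
    and Q: "\<And>k. k \<in> A \<union> B \<union> C \<Longrightarrow> bracket (freq k) \<le> Q"
    and \<sigma>: "0 < \<sigma>" "\<sigma> < 2"
  shows "cmod (\<Sum>i\<in>A \<times> B \<times> C. of_real (bracket (freq (tri_freq i)) powr \<sigma>) * c (tri_freq i) * tri_prod g h \<phi> i)
     \<le> subord_const (\<sigma> / 2) * 19 powr (\<sigma> / 2) * \<beta> * torus_area * K * Q powr \<sigma> * (l2norm g A * l2norm h B * l2norm \<phi> C)"
proof -
  let ?I = "A \<times> B \<times> C" and ?b = "\<lambda>i. bracket (freq (tri_freq i))"
  define N where "N = torus_area * K * (l2norm g A * l2norm h B * l2norm \<phi> C)"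
  have N: "0 \<le> N" using \<open>0 \<le> K\<close> by (simp add: N_def)
  have \<beta>: "0 \<le> \<beta>" using c by (simp add: dual_bounded_def)
  have finI: "finite ?I" using fin by simp
  have coord: "\<bar>freq k \<bullet> e\<bar> \<le> Q" if "k \<in> A \<union> B \<union> C" "e = (1, 0) \<or> e = (0, 1)" for k e
  proof -
    have "(freq k \<bullet> e)\<^sup>2 \<le> (bracket (freq k))\<^sup>2" using that(2) by (auto simp: bracket_sq)
    then have "\<bar>freq k \<bullet> e\<bar> \<le> bracket (freq k)" by (simp add: abs_le_square_iff[symmetric])
    then show ?thesis using Q[OF that(1)] by simp
  qed
  have db: "cmod (\<Sum>i\<in>?I. c (tri_freq i) * z i) \<le> \<beta> * trig_l1 ?I tri_freq z" for z
    using c finI by (simp add: dual_bounded_def)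
  have N1: "trig_l1 ?I tri_freq (tri_prod g h \<phi>) \<le> N"
    unfolding N_def by (rule trig_l1_tri_prod[OF fin \<open>0 \<le> K\<close> K])
  have N2: "trig_l1 ?I tri_freq (\<lambda>i. of_real ((?b i)\<^sup>2) * tri_prod g h \<phi> i) \<le> 19 * Q\<^sup>2 * N"
  proof -
    have eq: "(\<lambda>i. of_real ((?b i)\<^sup>2) * tri_prod g h \<phi> i) = (\<lambda>i. tri_prod g h \<phi> i +
        (of_real ((freq (tri_freq i) \<bullet> (1, 0))\<^sup>2) * tri_prod g h \<phi> i + of_real ((freq (tri_freq i) \<bullet> (0, 1))\<^sup>2) * tri_prod g h \<phi> i))"
      by (simp add: bracket_sq distrib_right add.assoc)
    have w: "trig_l1 ?I tri_freq (\<lambda>i. of_real ((freq (tri_freq i) \<bullet> e)\<^sup>2) * tri_prod g h \<phi> i) \<le> (3 * Q)\<^sup>2 * N"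
      if "e = (1, 0) \<or> e = (0, 1)" for e
      unfolding N_def using coord[OF _ that] \<open>1 \<le> Q\<close> by (intro trig_l1_tri_prod_weight fin \<open>0 \<le> K\<close> K) auto
    have "trig_l1 ?I tri_freq (\<lambda>i. of_real ((?b i)\<^sup>2) * tri_prod g h \<phi> i) \<le> N + ((3 * Q)\<^sup>2 * N + (3 * Q)\<^sup>2 * N)"
      unfolding eq by (rule order_trans[OF trig_l1_triangle] order_trans[OF add_left_mono[OF trig_l1_triangle]] add_mono N1 w | simp)+
    also have "\<dots> \<le> Q\<^sup>2 * N + ((3 * Q)\<^sup>2 * N + (3 * Q)\<^sup>2 * N)"
      using \<open>1 \<le> Q\<close> N mult_right_mono[of 1 "Q\<^sup>2" N] by (simp add: one_le_power mult.commute)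
    also have "\<dots> = 19 * Q\<^sup>2 * N" by (simp add: power2_eq_square algebra_simps)
    finally show ?thesis .
  qed
  have "cmod (\<Sum>i\<in>?I. c (tri_freq i) * tri_prod g h \<phi> i * of_real ((?b i)\<^sup>2 powr (\<sigma> / 2)))
     \<le> subord_const (\<sigma> / 2) * (\<beta> * N) * (19 * Q\<^sup>2) powr (\<sigma> / 2)"
  proof (rule subordination_bound)
    fix t :: real assume t: "0 \<le> t"
    have "cmod (\<Sum>i\<in>?I. c (tri_freq i) * (tri_prod g h \<phi> i * of_real (exp (- (t * (?b i)\<^sup>2))))) \<le> \<beta> * N"
      using order_trans[OF db mult_left_mono[OF order_trans[OF trig_l1_heat[OF t] N1] \<beta>]] .
    then show "cmod (\<Sum>i\<in>?I. c (tri_freq i) * tri_prod g h \<phi> i * of_real (exp (- (t * (?b i)\<^sup>2)))) \<le> \<beta> * N"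
      by (simp only: mult.assoc)
    have "cmod (\<Sum>i\<in>?I. c (tri_freq i) * ((of_real ((?b i)\<^sup>2) * tri_prod g h \<phi> i) * of_real (exp (- (t * (?b i)\<^sup>2))))) \<le> \<beta> * (19 * Q\<^sup>2 * N)"
      using order_trans[OF db mult_left_mono[OF order_trans[OF trig_l1_heat[OF t] N2] \<beta>]] .
    then show "cmod (\<Sum>i\<in>?I. c (tri_freq i) * tri_prod g h \<phi> i * of_real ((?b i)\<^sup>2 * exp (- (t * (?b i)\<^sup>2)))) \<le> 19 * Q\<^sup>2 * (\<beta> * N)"
      by (simp only: of_real_mult mult_ac)
  qed (use finI \<sigma> \<open>1 \<le> Q\<close> in auto)
  moreover have sq: "(x\<^sup>2) powr (\<sigma> / 2) = x powr \<sigma>" if "0 < x" for x :: real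
    using powr_powr[of x 2 "\<sigma> / 2"] that by simp
  moreover have "(19 * Q\<^sup>2) powr (\<sigma> / 2) = 19 powr (\<sigma> / 2) * Q powr \<sigma>"
    using \<open>1 \<le> Q\<close> by (simp add: powr_mult sq)
  ultimately show ?thesis by (simp add: N_def mult_ac)
qed

section \<open>The product estimate at a fixed time\<close>

text \<open>
  The norm of the part of \<open>g\<close> in \<open>H\<^sup>s\<close> with frequencies in
  \<open>A\<close>.
\<close>

definition hs_norm :: "real \<Rightarrow> torus_distr \<Rightarrow> (int \<times> int) set \<Rightarrow> real" where
  "hs_norm s g A = L2_set (\<lambda>k. bracket (freq k) powr s * cmod (g k)) A"

lemma hs_norm_nonneg [simp]: "0 \<le> hs_norm s g A"
  by (simp add: hs_norm_def)

text \<open>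
  The block that contains the frequency \<open>k\<close>: the \<open>i\<close> with
  \<open>2\<^sup>i \<le> \<langle>k\<rangle> < 2\<^sup>i\<^sup>+\<^sup>1\<close>. The logarithm is
  never negative, as \<open>\<langle>k\<rangle> \<ge> 1\<close>.
\<close>

definition dyadic_index :: "int \<times> int \<Rightarrow> nat" where
  "dyadic_index k = nat \<lfloor>log 2 (bracket (freq k))\<rfloor>"

lemma dyadic_index_le: "2 ^ dyadic_index k \<le> bracket (freq k)"
  and dyadic_index_less: "bracket (freq k) < 2 * 2 ^ dyadic_index k"
proof -
  have nn: "0 \<le> log 2 (bracket (freq k))" using bracket_ge_1 by simp
  then have eq: "real (dyadic_index k) = of_int \<lfloor>log 2 (bracket (freq k))\<rfloor>"
    by (simp add: dyadic_index_def)
  have "real (dyadic_index k) \<le> log 2 (bracket (freq k))" unfolding eq by simp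
  then show "2 ^ dyadic_index k \<le> bracket (freq k)"
    by (subst (asm) le_log_iff) (auto simp: powr_realpow)
  have "log 2 (bracket (freq k)) < real (Suc (dyadic_index k))" using eq by simp linarith?
  then have "bracket (freq k) < 2 powr real (Suc (dyadic_index k))"
    by (subst (asm) log_less_iff) auto
  then show "bracket (freq k) < 2 * 2 ^ dyadic_index k"
    by (subst (asm) powr_realpow) auto
qed

text \<open>
  The block lies in a square with \<open>4\<cdot>2\<^sup>i + 1 \<le> 5\<cdot>2\<^sup>i\<close>
  integers on each side.
\<close>

lemma card_dyadic_block:
  assumes "finite A"
  shows "real (card {k \<in> A. dyadic_index k = i}) \<le> (5 * 2 ^ i)\<^sup>2"
proof -
  let ?S = "{- (2 * 2 ^ i) .. 2 * 2 ^ i} :: int set"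
  have "{k \<in> A. dyadic_index k = i} \<subseteq> ?S \<times> ?S"
  proof
    fix k assume "k \<in> {k \<in> A. dyadic_index k = i}"
    then have b: "bracket (freq k) \<le> 2 * 2 ^ i" using dyadic_index_less[of k] by auto
    have "(freq k \<bullet> (1, 0))\<^sup>2 \<le> (bracket (freq k))\<^sup>2" "(freq k \<bullet> (0, 1))\<^sup>2 \<le> (bracket (freq k))\<^sup>2"
      by (auto simp: bracket_sq)
    then have "\<bar>real_of_int (fst k)\<bar> \<le> 2 * 2 ^ i" "\<bar>real_of_int (snd k)\<bar> \<le> 2 * 2 ^ i"
      using b by (auto simp: abs_le_square_iff[symmetric] freq_def)
    then have "\<bar>fst k\<bar> \<le> 2 * 2 ^ i" "\<bar>snd k\<bar> \<le> 2 * 2 ^ i"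
      by (metis (mono_tags) of_int_abs of_int_le_iff of_int_mult of_int_numeral of_int_power)+
    then show "k \<in> ?S \<times> ?S" by (cases k) auto
  qed
  then have "card {k \<in> A. dyadic_index k = i} \<le> card (?S \<times> ?S)"
    by (intro card_mono) auto
  also have "\<dots> = (4 * 2 ^ i + 1)\<^sup>2"
    by (simp add: card_cartesian_product power2_eq_square nat_add_distrib nat_mult_distrib nat_power_eq)
  also have "\<dots> \<le> (5 * 2 ^ i)\<^sup>2"
    by (intro power_mono) auto
  finally have "real (card {k \<in> A. dyadic_index k = i}) \<le> real ((5 * 2 ^ i)\<^sup>2)"
    by (simp only: of_nat_le_iff)
  then show ?thesis by simp
qed

lemma l2norm_dyadic_block:
  assumes "finite A" "0 \<le> s"
  shows "l2norm g {k \<in> A. dyadic_index k = i} \<le> 2 powr (- s * i) * hs_norm s g A"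
proof -
  have "l2norm g {k \<in> A. dyadic_index k = i} \<le> L2_set (\<lambda>k. 2 powr (- s * i) * (bracket (freq k) powr s * cmod (g k))) {k \<in> A. dyadic_index k = i}"
  proof (rule L2_set_mono)
    fix k assume k: "k \<in> {k \<in> A. dyadic_index k = i}"
    have "(2 ^ i) powr s \<le> bracket (freq k) powr s"
      using k dyadic_index_le[of k] assms(2) by (intro powr_mono2) auto
    then have "1 \<le> 2 powr (- s * i) * bracket (freq k) powr s"
      by (simp add: powr_minus powr_powr field_simps flip: powr_realpow)
    then show "cmod (g k) \<le> 2 powr (- s * i) * (bracket (freq k) powr s * cmod (g k))"
      using mult_right_mono[OF _ norm_ge_zero[of "g k"], of 1] by (simp only: mult.assoc[symmetric] mult_1)
  qed simp
  also have "\<dots> = 2 powr (- s * i) * hs_norm s g {k \<in> A. dyadic_index k = i}"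
    unfolding hs_norm_def by (subst L2_set_right_distrib) auto
  also have "\<dots> \<le> 2 powr (- s * i) * hs_norm s g A"
    unfolding hs_norm_def using assms(1) by (intro mult_left_mono) (auto simp: L2_set_def intro!: sum_mono2)
  finally show ?thesis .
qed

text \<open>
  Here \<open>i\<close>, \<open>j\<close>, \<open>k\<close> are the logarithms of the frequencies
  of \<open>g\<close>, \<open>h\<close> and of the test function. If \<open>g\<close> has the
  highest frequency, its own weight pays for \<open>\<sigma>\<close> and leaves \<open>s -
  \<sigma>\<close>, and the minimum is at most the convex combination \<open>s j + (1 - s)
  k\<close>. If the test function has the highest frequency, the weights of \<open>g\<close> and
  \<open>h\<close> pay for \<open>2s\<close> times the minimum, and the remaining \<open>1 - 2s
  \<ge> 0\<close> is paid by the test function; this is where \<open>s \<le> 1/2\<close> enters.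
\<close>

lemma dyadic_exponent:
  fixes s \<sigma> :: real
  assumes "0 \<le> \<sigma>" "\<sigma> \<le> s" "s \<le> 1 / 2" "0 \<le> i" "0 \<le> j" "0 \<le> k"
  shows "\<sigma> * max i (max j k) + min i (min j k) - s * i - s * j - (1 - s) * k \<le> - (s - \<sigma>) * max i (max j k)"
proof -
  have low: "min x (min y k) \<le> s * y + (1 - s) * k" for x y
  proof -
    have "min x (min y k) = s * min x (min y k) + (1 - s) * min x (min y k)" by (simp add: algebra_simps)
    also have "\<dots> \<le> s * y + (1 - s) * k" using assms by (intro add_mono mult_left_mono) auto
    finally show ?thesis .
  qed
  consider "max i (max j k) = i" | "max i (max j k) = j" | "max i (max j k) = k" by linarith
  then show ?thesis
  proof cases
    case 1
    with low[of i j] show ?thesis by (simp add: algebra_simps)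
  next
    case 2
    with low[of j i] show ?thesis by (simp add: algebra_simps min.left_commute)
  next
    case 3
    let ?m = "min i (min j k)"
    have "s * ?m \<le> s * i" "s * ?m \<le> s * j" using assms by (intro mult_left_mono; simp)+
    moreover have "(1 - 2 * s) * ?m \<le> (1 - 2 * s) * k" using assms by (intro mult_left_mono) auto
    ultimately show ?thesis unfolding 3 by (simp add: algebra_simps)
  qed
qed

definition trilinear_const :: "real \<Rightarrow> real \<Rightarrow> real" where
  "trilinear_const s \<sigma> = subord_const (\<sigma> / 2) * 19 powr (\<sigma> / 2) * torus_area * 5 * 2 powr \<sigma> * (1 / (1 - 2 powr (- (s - \<sigma>) / 3))) ^ 3"

lemma trilinear_const_nonneg:
  assumes "0 < \<sigma>" "\<sigma> < s" "s \<le> 1 / 2"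
  shows "0 \<le> trilinear_const s \<sigma>"
proof -
  have "2 powr (- (s - \<sigma>) / 3) \<le> 1" using assms powr_mono[of "- (s - \<sigma>) / 3" 0 2] by simp
  then show ?thesis using subord_const_nonneg[of "\<sigma>/2"] assms
    by (auto simp: trilinear_const_def intro!: mult_nonneg_nonneg)
qed

text \<open>
  Summation of the block estimate. As \<open>3 max(i, j, k) \<ge> i + j + k\<close>, the factor
  \<open>2\<close> to the power \<open>-(s - \<sigma>) max(i, j, k)\<close> is at most
  \<open>r\<^sup>i r\<^sup>j r\<^sup>k\<close> for a number \<open>r < 1\<close>, so the triple
  sum is bounded by the cube of a geometric series, whatever the (finite) number of blocks.
\<close>

lemma trilinear_estimate:
  assumes c: "dual_bounded \<beta> c" and fin: "finite A" "finite B" "finite C"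
    and \<sigma>: "0 < \<sigma>" "\<sigma> < s" "s \<le> 1 / 2"
  shows "cmod (\<Sum>i\<in>A \<times> B \<times> C. of_real (bracket (freq (tri_freq i)) powr \<sigma>) * c (tri_freq i) * tri_prod g h \<phi> i)
     \<le> trilinear_const s \<sigma> * \<beta> * (hs_norm s g A * hs_norm s h B * hs_norm (1 - s) \<phi> C)"
proof -
  define F where "F = (\<lambda>i. of_real (bracket (freq (tri_freq i)) powr \<sigma>) * c (tri_freq i) * tri_prod g h \<phi> i)"
  define bl where "bl = (\<lambda>A i. {k \<in> A. dyadic_index k = i})"
  define J where "J = Suc (Max (insert 0 (dyadic_index ` (A \<union> B \<union> C))))"
  define N where "N = hs_norm s g A * hs_norm s h B * hs_norm (1 - s) \<phi> C"
  define C0 where "C0 = subord_const (\<sigma> / 2) * 19 powr (\<sigma> / 2) * \<beta> * torus_area"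
  define r where "r = (2::real) powr (- (s - \<sigma>) / 3)"
  have \<beta>: "0 \<le> \<beta>" using c by (simp add: dual_bounded_def)
  have N: "0 \<le> N" by (simp add: N_def)
  have C0: "0 \<le> C0" using subord_const_nonneg[of "\<sigma>/2"] \<sigma> \<beta> by (simp add: C0_def)
  have r: "0 \<le> r" "r < 1" using \<sigma> by (auto simp: r_def powr_less_one)
  have J: "dyadic_index k < J" if "k \<in> A \<union> B \<union> C" for k
    using that fin unfolding J_def less_Suc_eq_le by (intro Max_ge) auto
  have block: "cmod (\<Sum>x\<in>bl A i \<times> bl B j \<times> bl C k. F x) \<le> C0 * 5 * 2 powr \<sigma> * (r ^ i * r ^ j * r ^ k) * N" for i j k
  proof -
    let ?min = "min i (min j k)" and ?max = "max i (max j k)"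
    let ?g = "l2norm g (bl A i)" and ?h = "l2norm h (bl B j)" and ?p = "l2norm \<phi> (bl C k)"
    have fb: "finite (bl A i)" "finite (bl B j)" "finite (bl C k)" using fin by (auto simp: bl_def)
    have "?min = i \<or> ?min = j \<or> ?min = k" by linarith
    \<comment> \<open>The factor in the lowest block is the one that goes into the supremum norm.\<close>
    then have card: "real (card (bl A i)) \<le> (5 * 2 ^ ?min)\<^sup>2 \<or> real (card (bl B j)) \<le> (5 * 2 ^ ?min)\<^sup>2 \<or> real (card (bl C k)) \<le> (5 * 2 ^ ?min)\<^sup>2"
      using card_dyadic_block[OF fin(1), of i] card_dyadic_block[OF fin(2), of j] card_dyadic_block[OF fin(3), of k]
      unfolding bl_def by metis
    have Q: "bracket (freq l) \<le> 2 * 2 ^ ?max" if "l \<in> bl A i \<union> bl B j \<union> bl C k" for l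
    proof -
      have "(2::real) ^ dyadic_index l \<le> 2 ^ ?max" using that by (intro power_increasing) (auto simp: bl_def)
      then show ?thesis using dyadic_index_less[of l] by linarith
    qed
    have "cmod (\<Sum>x\<in>bl A i \<times> bl B j \<times> bl C k. F x) \<le> C0 * (5 * 2 ^ ?min) * (2 * 2 ^ ?max) powr \<sigma> * (?g * ?h * ?p)"
      unfolding F_def C0_def
      by (rule block_estimate[OF c fb _ _ card Q]) (use \<sigma> in \<open>auto intro: order_trans[OF _ mult_left_mono[of 1 "2 ^ _" 2]]\<close>)
    also have "\<dots> \<le> C0 * (5 * 2 ^ ?min) * (2 * 2 ^ ?max) powr \<sigma> * ((2 powr (- s * i) * hs_norm s g A) * (2 powr (- s * j) * hs_norm s h B) * (2 powr (- (1 - s) * k) * hs_norm (1 - s) \<phi> C))"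
      using C0 \<sigma> unfolding bl_def
      by (intro mult_left_mono mult_mono l2norm_dyadic_block fin mult_nonneg_nonneg) auto
    also have "\<dots> = C0 * 5 * 2 powr \<sigma> * (2 powr ?min * 2 powr (\<sigma> * ?max) * 2 powr (- s * i) * 2 powr (- s * j) * 2 powr (- (1 - s) * k)) * N"
      by (simp add: N_def powr_mult powr_powr mult_ac flip: powr_realpow)
    also have "\<dots> \<le> C0 * 5 * 2 powr \<sigma> * (r ^ i * r ^ j * r ^ k) * N"
    proof (intro mult_right_mono[OF _ N] mult_left_mono)
    have "2 powr ?min * 2 powr (\<sigma> * ?max) * 2 powr (- s * i) * 2 powr (- s * j) * 2 powr (- (1 - s) * k)
        = (2::real) powr (\<sigma> * real ?max + real ?min - s * i - s * j - (1 - s) * k)"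
      by (simp only: powr_add[symmetric]) (simp add: algebra_simps)
    also have "\<dots> \<le> 2 powr (- (s - \<sigma>) / 3 * i + - (s - \<sigma>) / 3 * j + - (s - \<sigma>) / 3 * k)"
    proof (rule powr_mono)
      have "\<sigma> * real ?max + real ?min - s * i - s * j - (1 - s) * k \<le> - (s - \<sigma>) * real ?max"
        using dyadic_exponent[of \<sigma> s i j k] \<sigma> by (simp add: of_nat_max of_nat_min)
      also have "\<dots> = (s - \<sigma>) / 3 * (- real ?max - real ?max - real ?max)" by (simp add: field_simps)
      also have "\<dots> \<le> (s - \<sigma>) / 3 * (- real i - real j - real k)"
        using \<sigma> by (intro mult_left_mono) auto
      also have "\<dots> = - (s - \<sigma>) / 3 * i + - (s - \<sigma>) / 3 * j + - (s - \<sigma>) / 3 * k" by (simp add: field_simps)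
      finally show "\<sigma> * real ?max + real ?min - s * i - s * j - (1 - s) * k \<le> - (s - \<sigma>) / 3 * i + - (s - \<sigma>) / 3 * j + - (s - \<sigma>) / 3 * k" .
    qed simp
    also have "\<dots> = r ^ i * r ^ j * r ^ k"
      unfolding powr_add r_def by (simp add: powr_powr flip: powr_realpow)
    finally show "2 powr ?min * 2 powr (\<sigma> * ?max) * 2 powr (- s * i) * 2 powr (- s * j) * 2 powr (- (1 - s) * k) \<le> r ^ i * r ^ j * r ^ k" .
    qed (use C0 in simp)
    finally show ?thesis .
  qed
  let ?T = "{..<J} \<times> {..<J} \<times> {..<J}"
  let ?d = "\<lambda>(l, m, n). (dyadic_index l, dyadic_index m, dyadic_index n)"
  have "(\<Sum>x\<in>A \<times> B \<times> C. F x) = (\<Sum>y\<in>?T. \<Sum>x\<in>{x \<in> A \<times> B \<times> C. ?d x = y}. F x)"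
    using fin J by (intro sum.group[symmetric]) auto
  also have "\<dots> = (\<Sum>(i, j, k)\<in>?T. \<Sum>x\<in>bl A i \<times> bl B j \<times> bl C k. F x)"
    by (intro sum.cong refl) (auto simp: bl_def intro!: sum.cong)
  finally have "cmod (\<Sum>x\<in>A \<times> B \<times> C. F x) \<le> (\<Sum>(i, j, k)\<in>?T. cmod (\<Sum>x\<in>bl A i \<times> bl B j \<times> bl C k. F x))"
    by (auto simp: case_prod_beta intro!: norm_sum)
  also have "\<dots> \<le> (\<Sum>(i, j, k)\<in>?T. C0 * 5 * 2 powr \<sigma> * (r ^ i * r ^ j * r ^ k) * N)"
    by (intro sum_mono) (auto intro: block)
  also have "\<dots> = C0 * 5 * 2 powr \<sigma> * N * ((\<Sum>i<J. r ^ i) * ((\<Sum>j<J. r ^ j) * (\<Sum>k<J. r ^ k)))"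
    by (simp add: sum.cartesian_product[symmetric] sum_product sum_distrib_left mult_ac)
  also have "\<dots> \<le> C0 * 5 * 2 powr \<sigma> * N * (1 / (1 - r) * (1 / (1 - r) * (1 / (1 - r))))"
  proof -
    have "(\<Sum>i<J. r ^ i) \<le> 1 / (1 - r)"
      using r by (simp add: sum_gp_strict divide_right_mono)
    then show ?thesis using C0 N r
      by (intro mult_left_mono mult_mono mult_nonneg_nonneg sum_nonneg) auto
  qed
  finally show ?thesis
    unfolding F_def by (simp add: trilinear_const_def C0_def N_def r_def power3_eq_cube mult_ac)
qed

text \<open>
  The Fourier coefficients of \<open>f g h\<close> when \<open>g\<close> is cut off to
  \<open>A\<close> and \<open>h\<close> to \<open>B\<close>.
\<close>

definition trilinear_coeff :: "torus_distr \<Rightarrow> torus_distr \<Rightarrow> torus_distr \<Rightarrow> (int \<times> int) set \<Rightarrow> (int \<times> int) set \<Rightarrow> torus_distr" where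
  "trilinear_coeff f g h A B n = (\<Sum>l\<in>A. \<Sum>m\<in>B. f (n - l - m) * (g l * h m))"

text \<open>
  The form in which \<open>f\<close> in
  \<open>W\<^sup>-\<^sup>\<sigma>\<^sup>,\<^sup>\<infinity>\<close> is used: \<open>f = (1 -
  \<Delta>)\<^sup>\<sigma>\<^sup>/\<^sup>2 F\<close> with \<open>F\<close> dual to
  \<open>L\<^sup>1\<close>.
\<close>

definition W_bounded :: "real \<Rightarrow> real \<Rightarrow> torus_distr \<Rightarrow> bool" where
  "W_bounded \<sigma> \<beta> f \<longleftrightarrow> (\<exists>c. dual_bounded \<beta> c \<and> (\<forall>k. f k = of_real (bracket (freq k) powr \<sigma>) * c k))"

text \<open>
  Duality between \<open>H\<^sup>s\<^sup>-\<^sup>1\<close> and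
  \<open>H\<^sup>1\<^sup>-\<^sup>s\<close>: test against the function \<open>\<phi>\<close> that
  makes the pairing the square of the norm \<open>S\<close> of the product and has norm
  \<open>S\<close> itself.
\<close>

lemma trilinear_coeff_bound:
  assumes f: "W_bounded \<sigma> \<beta> f" and fin: "finite A" "finite B" "finite C"
    and \<sigma>: "0 < \<sigma>" "\<sigma> < s" "s \<le> 1 / 2"
  shows "hs_norm (s - 1) (trilinear_coeff f g h A B) C \<le> trilinear_const s \<sigma> * \<beta> * (hs_norm s g A * hs_norm s h B)"
proof -
  obtain c where c: "dual_bounded \<beta> c" "\<And>k. f k = of_real (bracket (freq k) powr \<sigma>) * c k"
    using f by (auto simp: W_bounded_def)
  define p where "p = trilinear_coeff f g h A B"
  define S where "S = hs_norm (s - 1) p C"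
  \<comment> \<open>The extremal test function.\<close>
  define \<phi> where "\<phi> = (\<lambda>n. of_real (bracket (freq n) powr (2 * (s - 1))) * cnj (p n))"
  have "hs_norm (1 - s) \<phi> C = S"
    unfolding hs_norm_def S_def
    by (intro L2_set_cong refl) (simp add: \<phi>_def norm_mult mult.assoc[symmetric] powr_add[symmetric])
  moreover have "(\<Sum>i\<in>A \<times> B \<times> C. of_real (bracket (freq (tri_freq i)) powr \<sigma>) * c (tri_freq i) * tri_prod g h \<phi> i) = of_real (S\<^sup>2)"
  proof -
    have "(\<Sum>i\<in>A \<times> B \<times> C. of_real (bracket (freq (tri_freq i)) powr \<sigma>) * c (tri_freq i) * tri_prod g h \<phi> i)
        = (\<Sum>l\<in>A. \<Sum>m\<in>B. \<Sum>n\<in>C. \<phi> n * (f (n - l - m) * (g l * h m)))"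
      unfolding sum.cartesian_product
      by (intro sum.cong refl) (simp add: case_prod_beta tri_freq_def tri_prod_def c(2) mult_ac)
    also have "\<dots> = (\<Sum>l\<in>A. \<Sum>n\<in>C. \<Sum>m\<in>B. \<phi> n * (f (n - l - m) * (g l * h m)))"
      by (intro sum.cong refl sum.swap)
    also have "\<dots> = (\<Sum>n\<in>C. \<Sum>l\<in>A. \<Sum>m\<in>B. \<phi> n * (f (n - l - m) * (g l * h m)))"
      by (rule sum.swap)
    also have "\<dots> = (\<Sum>n\<in>C. \<phi> n * p n)"
      by (simp add: p_def trilinear_coeff_def sum_distrib_left)
    also have "\<dots> = (\<Sum>n\<in>C. of_real ((bracket (freq n) powr (s - 1) * cmod (p n))\<^sup>2))"
    proof (intro sum.cong refl)
      fix n
      have "bracket (freq n) powr (2 * (s - 1)) = (bracket (freq n) powr (s - 1))\<^sup>2"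
        by (simp add: power2_eq_square flip: powr_add)
      then show "\<phi> n * p n = of_real ((bracket (freq n) powr (s - 1) * cmod (p n))\<^sup>2)"
        by (simp add: \<phi>_def power_mult_distrib complex_norm_square mult_ac del: of_real_power)
    qed
    also have "\<dots> = of_real (S\<^sup>2)"
      by (simp add: S_def hs_norm_def L2_set_def sum_nonneg)
    finally show ?thesis .
  qed
  ultimately have "S\<^sup>2 \<le> trilinear_const s \<sigma> * \<beta> * (hs_norm s g A * hs_norm s h B * S)"
    using trilinear_estimate[OF c(1) fin \<sigma>, of g h \<phi>] by (simp add: norm_power)
  then have "S * S \<le> (trilinear_const s \<sigma> * \<beta> * (hs_norm s g A * hs_norm s h B)) * S"
    by (simp add: power2_eq_square mult_ac)
  moreover have "0 \<le> trilinear_const s \<sigma> * \<beta> * (hs_norm s g A * hs_norm s h B)"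
  proof -
    have "0 \<le> \<beta>" using c(1) by (simp add: dual_bounded_def)
    then show ?thesis using trilinear_const_nonneg[OF \<sigma>] by (intro mult_nonneg_nonneg) auto
  qed
  moreover have "0 \<le> S" by (simp add: S_def)
  ultimately have "S \<le> trilinear_const s \<sigma> * \<beta> * (hs_norm s g A * hs_norm s h B)"
    by (cases "S = 0") (auto simp: mult_le_cancel_right)
  then show ?thesis by (simp add: S_def p_def)
qed

section \<open>Existence of the product at a fixed time\<close>

text \<open>
  Membership of the ball of radius \<open>G\<close> in \<open>H\<^sup>s\<close>, expressed through
  finite sets of frequencies so that only finite sums occur.
\<close>

definition hs_bounded :: "real \<Rightarrow> real \<Rightarrow> torus_distr \<Rightarrow> bool" where
  "hs_bounded s G g \<longleftrightarrow> (\<forall>A. finite A \<longrightarrow> hs_norm s g A \<le> G)"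

definition freq_box :: "nat \<Rightarrow> (int \<times> int) set" where
  "freq_box J = {- int J..int J} \<times> {- int J..int J}"

text \<open>
  The candidate for the product: only \<open>g\<close> and \<open>h\<close> are cut off, to
  growing boxes of frequencies.
\<close>

definition torus_product :: "torus_distr \<Rightarrow> torus_distr \<Rightarrow> torus_distr \<Rightarrow> torus_distr" where
  "torus_product f g h n = lim (\<lambda>J. trilinear_coeff f g h (freq_box J) (freq_box J) n)"

lemma finite_freq_box [simp]: "finite (freq_box J)"
  by (simp add: freq_box_def)

lemma freq_box_mono: "J \<le> K \<Longrightarrow> freq_box J \<subseteq> freq_box K"
  by (auto simp: freq_box_def)

lemma freq_box_exhausts:
  assumes "finite A"
  shows "\<exists>J. A \<subseteq> freq_box J"
  using assms
proof (induction A)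
  case (insert k A)
  then obtain J where "A \<subseteq> freq_box J" by auto
  then have "insert k A \<subseteq> freq_box (max J (nat (max \<bar>fst k\<bar> \<bar>snd k\<bar>)))"
    using freq_box_mono[of J "max J (nat (max \<bar>fst k\<bar> \<bar>snd k\<bar>))"]
    by (cases k) (auto simp: freq_box_def)
  then show ?case by blast
qed simp

text \<open>
  The tails are small because a finite set that nearly exhausts the supremum of the partial sums
  lies in some box.
\<close>

lemma hs_norm_tail:
  assumes g: "hs_bounded s G g" and "0 < e"
  shows "\<exists>J0. \<forall>J\<ge>J0. \<forall>A. finite A \<longrightarrow> hs_norm s g (A - freq_box J) \<le> e"
proof -
  define w where "w = (\<lambda>k. (bracket (freq k) powr s * cmod (g k))\<^sup>2)"
  have w: "hs_norm s g A = sqrt (sum w A)" for A by (simp add: hs_norm_def L2_set_def w_def)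
  have "0 \<le> G" using g[unfolded hs_bounded_def, rule_format, of "{}"] by (simp add: hs_norm_def)
  have bdd: "bdd_above (sum w ` Collect finite)"
  proof (rule bdd_aboveI2)
    fix A :: "(int \<times> int) set" assume "A \<in> Collect finite"
    then have "sqrt (sum w A) \<le> G" using g w by (auto simp: hs_bounded_def)
    then show "sum w A \<le> G\<^sup>2" using sqrt_le_D by blast
  qed
  define S where "S = Sup (sum w ` Collect finite)"
  have le: "sum w A \<le> S" if "finite A" for A
    unfolding S_def using that bdd by (intro cSUP_upper) auto
  have "\<exists>x\<in>sum w ` Collect finite. S - e\<^sup>2 < x"
    using \<open>0 < e\<close> less_cSup_iff[of "sum w ` Collect finite" "S - e\<^sup>2"] bdd by (force simp: S_def)
  then obtain A0 where A0: "finite A0" "S - e\<^sup>2 < sum w A0" by auto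
  then obtain J0 where J0: "A0 \<subseteq> freq_box J0" using freq_box_exhausts by blast
  show ?thesis
  proof (intro exI allI impI)
    fix J and A :: "(int \<times> int) set" assume "J0 \<le> J" "finite A"
    have "A0 \<inter> (A - freq_box J) = {}" using J0 freq_box_mono[OF \<open>J0 \<le> J\<close>] by blast
    then have "sum w A0 + sum w (A - freq_box J) = sum w (A0 \<union> (A - freq_box J))"
      using A0 \<open>finite A\<close> by (intro sum.union_disjoint[symmetric]) auto
    also have "\<dots> \<le> S" using A0 \<open>finite A\<close> by (intro le) auto
    finally have "sum w (A - freq_box J) \<le> e\<^sup>2" using A0 by simp
    then show "hs_norm s g (A - freq_box J) \<le> e" unfolding w using \<open>0 < e\<close> by (intro real_le_lsqrt) (auto simp: w_def sum_nonneg)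
  qed
qed

lemma trilinear_coeff_pointwise:
  assumes "W_bounded \<sigma> \<beta> f" "finite A" "finite B" "0 < \<sigma>" "\<sigma> < s" "s \<le> 1 / 2"
  shows "cmod (trilinear_coeff f g h A B n) \<le> bracket (freq n) powr (1 - s) * (trilinear_const s \<sigma> * \<beta> * (hs_norm s g A * hs_norm s h B))"
proof -
  have "bracket (freq n) powr (s - 1) * cmod (trilinear_coeff f g h A B n) \<le> trilinear_const s \<sigma> * \<beta> * (hs_norm s g A * hs_norm s h B)"
    using trilinear_coeff_bound[of \<sigma> \<beta> f A B "{n}" s g h] assms by (simp add: hs_norm_def)
  then have "bracket (freq n) powr (1 - s) * (bracket (freq n) powr (s - 1) * cmod (trilinear_coeff f g h A B n)) \<le> bracket (freq n) powr (1 - s) * (trilinear_const s \<sigma> * \<beta> * (hs_norm s g A * hs_norm s h B))"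
    by (intro mult_left_mono) auto
  then show ?thesis by (simp add: mult.assoc[symmetric] flip: powr_add)
qed

lemma trilinear_coeff_diff:
  assumes "finite A" "B \<subseteq> A"
  shows "trilinear_coeff f g h A A n - trilinear_coeff f g h B B n
      = trilinear_coeff f g h (A - B) A n + trilinear_coeff f g h B (A - B) n"
proof -
  have fB: "finite B" using assms finite_subset by blast
  have 1: "sum F A = sum F (A - B) + sum F B" for F :: "_ \<Rightarrow> complex"
    using sum.subset_diff[OF assms(2,1)] .
  have "trilinear_coeff f g h A A n = trilinear_coeff f g h (A - B) A n + trilinear_coeff f g h B A n"
    unfolding trilinear_coeff_def by (rule 1)
  moreover have "trilinear_coeff f g h B A n = trilinear_coeff f g h B (A - B) n + trilinear_coeff f g h B B n"
    unfolding trilinear_coeff_def sum.distrib[symmetric] by (intro sum.cong refl 1)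
  ultimately show ?thesis by simp
qed

text \<open>
  Enlarging the cut-off from \<open>B\<close> to \<open>A\<close> changes one factor at a time, by
  a part whose norm is at most \<open>e\<close>. The bound depends on \<open>f\<close> only
  through \<open>\<beta>\<close>, which makes it uniform over regularisations.
\<close>

lemma trilinear_coeff_tail:
  assumes f: "W_bounded \<sigma> \<beta> f" and fin: "finite A" "B \<subseteq> A" and \<sigma>: "0 < \<sigma>" "\<sigma> < s" "s \<le> 1 / 2"
    and e: "hs_norm s g (A - B) \<le> e" "hs_norm s h (A - B) \<le> e" and G: "hs_norm s g B \<le> G" and H: "hs_norm s h A \<le> H"
  shows "cmod (trilinear_coeff f g h A A n - trilinear_coeff f g h B B n)
     \<le> bracket (freq n) powr (1 - s) * (trilinear_const s \<sigma> * \<beta> * ((G + H) * e))"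
proof -
  let ?b = "bracket (freq n) powr (1 - s)" and ?C = "trilinear_const s \<sigma> * \<beta>"
  have "0 \<le> \<beta>" using f by (auto simp: W_bounded_def dual_bounded_def)
  then have C: "0 \<le> ?C" using trilinear_const_nonneg[OF \<sigma>] by simp
  have e0: "0 \<le> e" "0 \<le> G" "0 \<le> H" using e(1) G H hs_norm_nonneg order_trans by blast+
  have fB: "finite B" using fin finite_subset by blast
  have "cmod (trilinear_coeff f g h A A n - trilinear_coeff f g h B B n)
     \<le> ?b * (?C * (hs_norm s g (A - B) * hs_norm s h A)) + ?b * (?C * (hs_norm s g B * hs_norm s h (A - B)))"
    unfolding trilinear_coeff_diff[OF fin] using fin fB
    by (intro order_trans[OF norm_triangle_ineq] add_mono trilinear_coeff_pointwise[OF f _ _ \<sigma>]) auto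
  also have "\<dots> \<le> ?b * (?C * (e * H)) + ?b * (?C * (G * e))"
    using e G H C e0 by (intro add_mono mult_left_mono mult_mono) auto
  finally show ?thesis by (simp add: algebra_simps)
qed

lemma torus_product_limit:
  assumes f: "W_bounded \<sigma> \<beta> f" and g: "hs_bounded s G g" and h: "hs_bounded s H h" and \<sigma>: "0 < \<sigma>" "\<sigma> < s" "s \<le> 1 / 2"
  shows "(\<lambda>J. trilinear_coeff f g h (freq_box J) (freq_box J) n) \<longlonglongrightarrow> torus_product f g h n"
proof -
  let ?y = "\<lambda>J. trilinear_coeff f g h (freq_box J) (freq_box J) n"
  define K where "K = bracket (freq n) powr (1 - s) * (trilinear_const s \<sigma> * \<beta> * (G + H))"
  have "Cauchy ?y"
  proof (rule CauchyI')
    fix e :: real assume "0 < e"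
    define e' where "e' = e / (\<bar>K\<bar> + 1)"
    have e': "0 < e'" using \<open>0 < e\<close> by (simp add: e'_def)
    obtain J1 where J1: "\<And>J A. J1 \<le> J \<Longrightarrow> finite A \<Longrightarrow> hs_norm s g (A - freq_box J) \<le> e'"
      using hs_norm_tail[OF g e'] by blast
    obtain J2 where J2: "\<And>J A. J2 \<le> J \<Longrightarrow> finite A \<Longrightarrow> hs_norm s h (A - freq_box J) \<le> e'"
      using hs_norm_tail[OF h e'] by blast
    have "dist (?y m) (?y j) < e" if "max J1 J2 \<le> m" "m < j" for m j
    proof -
      have "cmod (?y j - ?y m) \<le> bracket (freq n) powr (1 - s) * (trilinear_const s \<sigma> * \<beta> * ((G + H) * e'))"
        using J1[of m "freq_box j"] J2[of m "freq_box j"] that g h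
        by (intro trilinear_coeff_tail[OF f _ _ \<sigma>]) (auto simp: freq_box_mono hs_bounded_def)
      also have "\<dots> = K * e'" by (simp add: K_def)
      also have "\<dots> < (\<bar>K\<bar> + 1) * e'" using e' by (intro mult_strict_right_mono) auto
      also have "\<dots> = e" using abs_ge_zero[of K] by (simp add: e'_def)
      finally show ?thesis by (simp add: dist_norm norm_minus_commute)
    qed
    then show "\<exists>M. \<forall>m\<ge>M. \<forall>n>m. dist (?y m) (?y n) < e" by blast
  qed
  then show ?thesis
    unfolding torus_product_def using Cauchy_convergent convergent_LIMSEQ_iff by blast
qed

lemma torus_product_bound:
  assumes f: "W_bounded \<sigma> \<beta> f" and g: "hs_bounded s G g" and h: "hs_bounded s H h" and \<sigma>: "0 < \<sigma>" "\<sigma> < s" "s \<le> 1 / 2"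
  shows "hs_bounded (s - 1) (trilinear_const s \<sigma> * \<beta> * (G * H)) (torus_product f g h)"
  unfolding hs_bounded_def
proof (intro allI impI)
  fix C :: "(int \<times> int) set" assume "finite C"
  have C0: "0 \<le> trilinear_const s \<sigma> * \<beta>" using f trilinear_const_nonneg[OF \<sigma>] by (auto simp: W_bounded_def dual_bounded_def)
  have lim: "(\<lambda>J. hs_norm (s - 1) (trilinear_coeff f g h (freq_box J) (freq_box J)) C) \<longlonglongrightarrow> hs_norm (s - 1) (torus_product f g h) C"
    unfolding hs_norm_def L2_set_def
    by (intro tendsto_intros torus_product_limit[OF f g h \<sigma>])
  have bnd: "hs_norm (s - 1) (trilinear_coeff f g h (freq_box J) (freq_box J)) C \<le> trilinear_const s \<sigma> * \<beta> * (G * H)" for J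
  proof -
    have b: "hs_norm s g (freq_box J) \<le> G" "hs_norm s h (freq_box J) \<le> H" using g h by (auto simp: hs_bounded_def)
    have "0 \<le> G" using b(1) hs_norm_nonneg order_trans by blast
    then show ?thesis
      using b C0 by (intro order_trans[OF trilinear_coeff_bound[OF f _ _ \<open>finite C\<close> \<sigma>]] mult_left_mono mult_mono) auto
  qed
  show "hs_norm (s - 1) (torus_product f g h) C \<le> trilinear_const s \<sigma> * \<beta> * (G * H)"
    by (rule LIMSEQ_le_const2[OF lim]) (use bnd in blast)
qed

text \<open>
  In \<open>reg_product\<close> the summation runs over the frequencies of the first two factors,
  in \<open>trilinear_coeff\<close> over those of the last two; the substitution is \<open>k
  \<mapsto> n - l - k\<close>.
\<close>

lemma reg_product_eq_trilinear_coeff: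
  assumes "finite {k. a k \<noteq> 0}" "finite A" "{k. a k \<noteq> 0} \<subseteq> A"
  shows "reg_product a f g h n = trilinear_coeff (\<lambda>k. a k * f k) (\<lambda>k. a k * g k) (\<lambda>k. a k * h k) A A n"
proof -
  let ?S = "{k. a k \<noteq> 0}"
  have "reg_product a f g h n = (\<Sum>l\<in>?S. \<Sum>k\<in>?S. (a k * f k) * (a l * g l) * (a (n - l - k) * h (n - l - k)))"
    unfolding reg_product_def by (subst sum.swap) (simp add: algebra_simps)
  also have "\<dots> = (\<Sum>l\<in>?S. \<Sum>m\<in>A. (a (n - l - m) * f (n - l - m)) * ((a l * g l) * (a m * h m)))"
  proof (rule sum.cong[OF refl])
    fix l
    let ?u = "\<lambda>k. (a k * f k) * (a l * g l) * (a (n - l - k) * h (n - l - k))"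
    let ?v = "\<lambda>m. (a (n - l - m) * f (n - l - m)) * ((a l * g l) * (a m * h m))"
    show "sum ?u ?S = sum ?v A"
      by (rule sum.reindex_bij_witness_not_neutral[where i="\<lambda>m. n - l - m" and j="\<lambda>k. n - l - k"
            and S'="{k \<in> ?S. a (n - l - k) = 0}" and T'="{m \<in> A. a m = 0 \<or> a (n - l - m) = 0}"])
        (use assms in \<open>auto simp: mult_ac\<close>)
  qed
  also have "\<dots> = (\<Sum>l\<in>A. \<Sum>m\<in>A. (a (n - l - m) * f (n - l - m)) * ((a l * g l) * (a m * h m)))"
    using assms by (intro sum.mono_neutral_left) auto
  finally show ?thesis by (simp add: trilinear_coeff_def)
qed

lemma W_bounded_kernel:
  assumes "W_bounded \<sigma> \<beta> f" "kernel_bound M a"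
  shows "W_bounded \<sigma> (\<beta> * (M / torus_area)) (\<lambda>k. a k * f k)"
proof -
  obtain c where c: "dual_bounded \<beta> c" "\<And>k. f k = of_real (bracket (freq k) powr \<sigma>) * c k"
    using assms(1) by (auto simp: W_bounded_def)
  show ?thesis unfolding W_bounded_def
    by (rule exI[of _ "\<lambda>k. a k * c k"]) (use dual_bounded_kernel[OF c(1) assms(2)] in \<open>simp add: c(2) mult_ac\<close>)
qed

lemma hs_norm_kernel:
  assumes "kernel_bound M a"
  shows "hs_norm s (\<lambda>k. a k * g k) A \<le> M / torus_area * hs_norm s g A"
proof -
  have M: "cmod (a k) \<le> M / torus_area" for k using kernel_bound_coeff[OF assms] .
  then have M0: "0 \<le> M / torus_area" using norm_ge_zero order_trans by blast
  show ?thesis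
    unfolding hs_norm_def L2_set_right_distrib[OF M0]
  proof (rule L2_set_mono)
    fix k
    show "bracket (freq k) powr s * cmod (a k * g k) \<le> M / torus_area * (bracket (freq k) powr s * cmod (g k))"
      using mult_right_mono[OF M[of k], of "bracket (freq k) powr s * cmod (g k)"] by (simp add: norm_mult mult_ac)
  qed simp
qed

text \<open>
  An exchange of limits. By \<open>trilinear_coeff_tail\<close>, cutting off the regularised
  factors at a large box \<open>J\<close> is a small error uniformly in \<open>N\<close>, because
  regularisation enlarges all norms by a bounded factor only; and for a fixed box the sums are
  finite, so that they converge with the coefficients of the approximate identity.
\<close>

lemma torus_product_is_product:
  assumes f: "W_bounded \<sigma> \<beta> f" and g: "hs_bounded s G g" and h: "hs_bounded s H h" and \<sigma>: "0 < \<sigma>" "\<sigma> < s" "s \<le> 1 / 2"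
  shows "is_product f g h (torus_product f g h)"
  unfolding is_product_def
proof (intro allI impI)
  fix a n assume a: "approx_identity a"
  then obtain M where M: "\<And>N. kernel_bound M (a N)"
    by (auto simp: approx_identity_def kernel_bound_def)
  define \<mu> where "\<mu> = M / torus_area"
  have \<mu>: "0 \<le> \<mu>" unfolding \<mu>_def using kernel_bound_coeff[OF M] norm_ge_zero order_trans by blast
  let ?af = "\<lambda>N k. a N k * f k" and ?ag = "\<lambda>N k. a N k * g k" and ?ah = "\<lambda>N k. a N k * h k"
  let ?x = "\<lambda>N J. trilinear_coeff (?af N) (?ag N) (?ah N) (freq_box J) (freq_box J) n"
  let ?y = "\<lambda>J. trilinear_coeff f g h (freq_box J) (freq_box J) n"
  have G0: "0 \<le> G" "0 \<le> H" using g h hs_norm_nonneg order_trans unfolding hs_bounded_def by (metis finite.emptyI)+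
  define K where "K = bracket (freq n) powr (1 - s) * (trilinear_const s \<sigma> * (\<beta> * \<mu>) * ((\<mu> * G + \<mu> * H) * \<mu>))"
  have close: "\<exists>J0. \<forall>J\<ge>J0. \<forall>N. cmod (reg_product (a N) f g h n - ?x N J) < e" if "0 < e" for e
  proof -
    define e' where "e' = e / (\<bar>K\<bar> + 1)"
    have e': "0 < e'" using that by (simp add: e'_def)
    obtain J1 where J1: "\<And>J A. J1 \<le> J \<Longrightarrow> finite A \<Longrightarrow> hs_norm s g (A - freq_box J) \<le> e'"
      using hs_norm_tail[OF g e'] by blast
    obtain J2 where J2: "\<And>J A. J2 \<le> J \<Longrightarrow> finite A \<Longrightarrow> hs_norm s h (A - freq_box J) \<le> e'"
      using hs_norm_tail[OF h e'] by blast
    have "cmod (reg_product (a N) f g h n - ?x N J) < e" if J: "max J1 J2 \<le> J" for J N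
    proof -
      define A where "A = {k. a N k \<noteq> 0} \<union> freq_box J"
      have finS: "finite {k. a N k \<noteq> 0}" using M[of N] by (simp add: kernel_bound_def)
      then have A: "finite A" "freq_box J \<subseteq> A" "{k. a N k \<noteq> 0} \<subseteq> A" by (auto simp: A_def)
      have hs: "hs_norm s (\<lambda>k. a N k * u k) B \<le> \<mu> * X" if "hs_norm s u B \<le> X" for u B X
        using order_trans[OF hs_norm_kernel[OF M, of s N u B] mult_left_mono[OF that]] \<mu> by (simp add: \<mu>_def)
      have "reg_product (a N) f g h n = trilinear_coeff (?af N) (?ag N) (?ah N) A A n"
        by (rule reg_product_eq_trilinear_coeff[OF finS A(1,3)])
      moreover have h1: "hs_norm s (?ag N) (A - freq_box J) \<le> \<mu> * e'" and h2: "hs_norm s (?ah N) (A - freq_box J) \<le> \<mu> * e'"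
        using J1[of J A] J2[of J A] J A by (auto intro!: hs)
      moreover have h3: "hs_norm s (?ag N) (freq_box J) \<le> \<mu> * G" and h4: "hs_norm s (?ah N) A \<le> \<mu> * H"
        using g h A by (auto simp: hs_bounded_def intro!: hs)
      ultimately have "cmod (reg_product (a N) f g h n - ?x N J) \<le> bracket (freq n) powr (1 - s) * (trilinear_const s \<sigma> * (\<beta> * \<mu>) * ((\<mu> * G + \<mu> * H) * (\<mu> * e')))"
        using trilinear_coeff_tail[OF W_bounded_kernel[OF f M[of N]] A(1,2) \<sigma> h1 h2 h3 h4, of n] by (simp add: \<mu>_def)
      also have "\<dots> = K * e'" by (simp add: K_def)
      also have "\<dots> < (\<bar>K\<bar> + 1) * e'" using e' by (intro mult_strict_right_mono) auto
      also have "\<dots> = e" using abs_ge_zero[of K] by (simp add: e'_def)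
      finally show ?thesis .
    qed
    then show ?thesis by blast
  qed
  have x: "(\<lambda>N. ?x N J) \<longlonglongrightarrow> ?y J" for J
  proof -
    \<comment> \<open>For a fixed box, only finitely many coefficients are involved.\<close>
    have a1: "(\<lambda>N. a N k) \<longlonglongrightarrow> 1" for k using a unfolding approx_identity_def by blast
    have "(\<lambda>N. ?x N J) \<longlonglongrightarrow> (\<Sum>l\<in>freq_box J. \<Sum>m\<in>freq_box J. (1 * f (n - l - m)) * ((1 * g l) * (1 * h m)))"
      unfolding trilinear_coeff_def by (intro tendsto_intros a1)
    then show ?thesis by (simp add: trilinear_coeff_def)
  qed
  have y: "?y \<longlonglongrightarrow> torus_product f g h n" by (rule torus_product_limit[OF f g h \<sigma>])
  show "(\<lambda>N. reg_product (a N) f g h n) \<longlonglongrightarrow> torus_product f g h n"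
  proof (rule LIMSEQ_I)
    fix e :: real assume "0 < e"
    then have e3: "0 < e / 3" by simp
    obtain J1 where J1: "\<And>J N. J1 \<le> J \<Longrightarrow> cmod (reg_product (a N) f g h n - ?x N J) < e / 3" using close[OF e3] by blast
    obtain J2 where J2: "\<And>J. J2 \<le> J \<Longrightarrow> cmod (?y J - torus_product f g h n) < e / 3" using LIMSEQ_D[OF y e3] by blast
    define J where "J = max J1 J2"
    obtain N0 where N0: "\<And>N. N0 \<le> N \<Longrightarrow> cmod (?x N J - ?y J) < e / 3" using LIMSEQ_D[OF x e3] by blast
    have "cmod (reg_product (a N) f g h n - torus_product f g h n) < e" if "N0 \<le> N" for N
    proof -
      have tri: "cmod (u - v) < e" if "cmod (u - x) < e / 3" "cmod (x - y) < e / 3" "cmod (y - v) < e / 3" for u v x y :: complex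
        using that norm_triangle_ineq[of "u - x" "x - y"] norm_triangle_ineq[of "u - y" "y - v"] by simp
      have "J1 \<le> J" "J2 \<le> J" by (simp_all add: J_def)
      then show ?thesis using tri[OF J1 N0[OF that] J2] by blast
    qed
    then show "\<exists>no. \<forall>N\<ge>no. cmod (reg_product (a N) f g h n - torus_product f g h n) < e" by blast
  qed
qed

section \<open>The Fourier transform in time\<close>

definition ft :: "(real \<Rightarrow> complex) \<Rightarrow> real \<Rightarrow> complex" where
  "ft f l = (LINT t|lborel. f t * cis (- (l * t)))"

lemma integrable_mult_cis:
  assumes f: "integrable M f" and [measurable]: "g \<in> borel_measurable M"
  shows "integrable M (\<lambda>t. f t * cis (g t))"
  by (rule Bochner_Integration.integrable_bound[OF f]) (use f in \<open>auto simp: norm_mult\<close>)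

text \<open>
  Fubini's theorem for the kernel of the Fourier transform: the transform is symmetric as a
  bilinear form.
\<close>

lemma swap_cis:
  fixes a b :: "real \<Rightarrow> complex"
  assumes a: "integrable lborel a" and b: "integrable lborel b"
  shows "(LINT x|lborel. a x * (LINT y|lborel. b y * cis (c * (x * y)))) = (LINT y|lborel. b y * (LINT x|lborel. a x * cis (c * (x * y))))"
proof -
  have [measurable]: "a \<in> borel_measurable borel" "b \<in> borel_measurable borel" using a b by auto
  have int: "integrable (lborel \<Otimes>\<^sub>M lborel) (\<lambda>(x, y). a x * b y * cis (c * (x * y)))"
    by (rule lborel_pair.Fubini_integrable)
       (use a b in \<open>auto simp: norm_mult mult.assoc intro!: integrable_mult_right integrable_mult_cis\<close>)
  have "(LINT x|lborel. a x * (LINT y|lborel. b y * cis (c * (x * y)))) = (LINT x|lborel. LINT y|lborel. a x * b y * cis (c * (x * y)))"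
    by (simp add: mult.assoc)
  also have "\<dots> = (LINT y|lborel. LINT x|lborel. a x * b y * cis (c * (x * y)))"
    by (rule lborel_pair.Fubini_integral[OF int, symmetric])
  also have "\<dots> = (LINT y|lborel. LINT x|lborel. b y * (a x * cis (c * (x * y))))"
    by (simp only: mult_ac)
  finally show ?thesis by (simp only: integral_mult_right_zero)
qed

lemma ft_measurable [measurable]:
  assumes "integrable lborel f"
  shows "ft f \<in> borel_measurable borel"
proof -
  have [measurable]: "f \<in> borel_measurable borel" using assms by auto
  show ?thesis unfolding ft_def by measurable
qed

lemma ft_bound: "cmod (ft f l) \<le> (LINT t|lborel. cmod (f t))"
  unfolding ft_def by (rule order_trans[OF integral_norm_bound]) (simp add: norm_mult)

text \<open>
  The Fourier transform of a Gaussian, from the characteristic function of the standard normal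
  distribution by rescaling.
\<close>

lemma gauss_integrable: "0 < e \<Longrightarrow> integrable lborel (\<lambda>l. exp (- (e * l\<^sup>2 / 2)))"
  and gauss_ft: "0 < e \<Longrightarrow> (LINT l|lborel. of_real (exp (- (e * l\<^sup>2 / 2))) * cis (u * l)) = of_real (2 * pi * std_normal_density (u / sqrt e) / sqrt e)"
proof -
  assume e: "0 < e"
  have se: "sqrt e \<noteq> 0" "(sqrt e * l)\<^sup>2 = e * l\<^sup>2" for l using e by (auto simp: power_mult_distrib)
  have d: "std_normal_density (0 + sqrt e * l) = exp (- (e * l\<^sup>2 / 2)) / sqrt (2 * pi)" for l
    using e by (simp add: std_normal_density_def power_mult_distrib)
  have int1: "integrable lborel std_normal_density" by (rule integrable_normal_density) simp
  then have "integrable lborel (\<lambda>l. std_normal_density (0 + sqrt e * l))"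
    using se by (intro lborel_integrable_real_affine)
  then show "integrable lborel (\<lambda>l. exp (- (e * l\<^sup>2 / 2)))"
    unfolding d using integrable_mult_right[of "sqrt (2 * pi)" lborel "\<lambda>l. exp (- (e * l\<^sup>2 / 2)) / sqrt (2 * pi)"] by simp
  have "char std_normal_distribution (u / sqrt e) = (LINT z|lborel. std_normal_density z *\<^sub>R cis (u / sqrt e * z))"
    unfolding char_def by (subst integral_density) (auto simp: cis_conv_exp)
  also have "\<dots> = \<bar>sqrt e\<bar> *\<^sub>R (LINT l|lborel. std_normal_density (0 + sqrt e * l) *\<^sub>R cis (u / sqrt e * (0 + sqrt e * l)))"
    using se by (intro lborel_integral_real_affine)
  also have "\<dots> = of_real (sqrt e / sqrt (2 * pi)) * (LINT l|lborel. of_real (exp (- (e * l\<^sup>2 / 2))) * cis (u * l))"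
  proof -
    have "std_normal_density (0 + sqrt e * l) *\<^sub>R cis (u / sqrt e * (0 + sqrt e * l)) = of_real (1 / sqrt (2 * pi)) * (of_real (exp (- (e * l\<^sup>2 / 2))) * cis (u * l))" for l
      unfolding d using e by (simp add: scaleR_conv_of_real)
    then show ?thesis using e by (simp only: integral_mult_right_zero) (simp add: scaleR_conv_of_real)
  qed
  finally have "of_real (sqrt e / sqrt (2 * pi)) * (LINT l|lborel. of_real (exp (- (e * l\<^sup>2 / 2))) * cis (u * l)) = of_real (exp (- (u / sqrt e)\<^sup>2 / 2))"
    by (simp only: char_std_normal_distribution)
  then have "(LINT l|lborel. of_real (exp (- (e * l\<^sup>2 / 2))) * cis (u * l)) = of_real (exp (- (u / sqrt e)\<^sup>2 / 2)) / of_real (sqrt e / sqrt (2 * pi))"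
    using e by (subst eq_divide_eq) (simp add: mult.commute)
  also have "\<dots> = of_real (exp (- (u / sqrt e)\<^sup>2 / 2) * sqrt (2 * pi) / sqrt e)"
    by simp
  also have "exp (- (u / sqrt e)\<^sup>2 / 2) * sqrt (2 * pi) / sqrt e = 2 * pi * std_normal_density (u / sqrt e) / sqrt e"
  proof -
    have "2 * pi / sqrt (2 * pi) = sqrt (2 * pi)" by (simp add: real_div_sqrt)
    then have "exp (- (u / sqrt e)\<^sup>2 / 2) * (2 * pi / sqrt (2 * pi)) = exp (- (u / sqrt e)\<^sup>2 / 2) * sqrt (2 * pi)" by simp
    then show ?thesis by (simp add: std_normal_density_def mult_ac)
  qed
  finally show "(LINT l|lborel. of_real (exp (- (e * l\<^sup>2 / 2))) * cis (u * l)) = of_real (2 * pi * std_normal_density (u / sqrt e) / sqrt e)" .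
qed

text \<open>
  The average of \<open>g\<close> over a Gaussian of variance \<open>e\<close> around
  \<open>t\<close>.
\<close>

definition gauss_avg :: "real \<Rightarrow> (real \<Rightarrow> complex) \<Rightarrow> real \<Rightarrow> complex" where
  "gauss_avg e g t = (LINT z|lborel. of_real (std_normal_density z) * g (t + sqrt e * z))"

text \<open>
  Parseval's identity with a Gaussian factor, which makes all integrals absolutely convergent.
  Letting \<open>e\<close> tend to \<open>0\<close> gives Bessel's inequality by Fatou's lemma and
  Parseval's identity by dominated convergence.
\<close>

lemma gauss_ft_identity:
  assumes f: "integrable lborel f" and g: "integrable lborel g" and e: "0 < e"
  shows "(LINT l|lborel. of_real (exp (- (e * l\<^sup>2 / 2))) * (ft f l * ft g (- l))) = 2 * pi * (LINT t|lborel. f t * gauss_avg e g t)"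
proof -
  let ?G = "\<lambda>l. complex_of_real (exp (- (e * l\<^sup>2 / 2)))"
  have [measurable]: "f \<in> borel_measurable borel" "g \<in> borel_measurable borel" using f g by auto
  have G: "integrable lborel ?G" using gauss_integrable[OF e] by simp
  have gl: "ft g (- l) = (LINT s|lborel. g s * cis (1 * (l * s)))" for l by (simp add: ft_def)
  have Gg: "integrable lborel (\<lambda>l. ?G l * ft g (- l))"
  proof (rule Bochner_Integration.integrable_bound)
    show "integrable lborel (\<lambda>l. of_real (LINT t|lborel. cmod (g t)) * ?G l)" using G by simp
    show "AE l in lborel. cmod (?G l * ft g (- l)) \<le> cmod (of_real (LINT t|lborel. cmod (g t)) * ?G l)"
      using ft_bound[of g] by (auto simp: norm_mult intro!: mult_right_mono)
    show "(\<lambda>l. ?G l * ft g (- l)) \<in> borel_measurable lborel" unfolding ft_def by measurable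
  qed
  have Gc: "integrable lborel (\<lambda>l. ?G l * cis (- (l * t)))" for t
    using G by (intro integrable_mult_cis) auto
  have inner: "(LINT l|lborel. ?G l * ft g (- l) * cis (- (l * t))) = 2 * pi * gauss_avg e g t" for t
  proof -
    have "(LINT l|lborel. ?G l * ft g (- l) * cis (- (l * t))) = (LINT l|lborel. (?G l * cis (- (l * t))) * (LINT s|lborel. g s * cis (1 * (l * s))))"
      unfolding gl by (simp only: mult_ac)
    also have "\<dots> = (LINT s|lborel. g s * (LINT l|lborel. (?G l * cis (- (l * t))) * cis (1 * (l * s))))"
      by (rule swap_cis[OF Gc g])
    also have "\<dots> = (LINT s|lborel. g s * of_real (2 * pi * std_normal_density ((s - t) / sqrt e) / sqrt e))"
    proof -
      have "(LINT l|lborel. (?G l * cis (- (l * t))) * cis (1 * (l * s))) = (LINT l|lborel. ?G l * cis ((s - t) * l))" for s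
      proof -
        have "cis (- (l * t)) * cis (1 * (l * s)) = cis ((s - t) * l)" for l
          by (simp add: cis_mult algebra_simps)
        then show ?thesis by (simp only: mult.assoc)
      qed
      then show ?thesis by (simp only: gauss_ft[OF e])
    qed
    also have "\<dots> = \<bar>sqrt e\<bar> *\<^sub>R (LINT z|lborel. g (t + sqrt e * z) * of_real (2 * pi * std_normal_density ((t + sqrt e * z - t) / sqrt e) / sqrt e))"
      using e by (intro lborel_integral_real_affine) auto
    also have "\<dots> = (LINT z|lborel. complex_of_real (2 * pi) * (of_real (std_normal_density z) * g (t + sqrt e * z)))"
      using e by (subst integral_scaleR_right[symmetric]) (auto simp: scaleR_conv_of_real mult_ac intro!: Bochner_Integration.integral_cong)
    also have "\<dots> = 2 * pi * gauss_avg e g t"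
      by (simp only: integral_mult_right_zero gauss_avg_def)
    finally show ?thesis .
  qed
  have "(LINT l|lborel. ?G l * (ft f l * ft g (- l))) = (LINT l|lborel. (?G l * ft g (- l)) * (LINT t|lborel. f t * cis ((-1) * (l * t))))"
    by (simp add: ft_def mult_ac)
  also have "\<dots> = (LINT t|lborel. f t * (LINT l|lborel. (?G l * ft g (- l)) * cis ((-1) * (l * t))))"
    by (rule swap_cis[OF Gg f])
  also have "\<dots> = (LINT t|lborel. of_real (2 * pi) * (f t * gauss_avg e g t))"
    using inner by (simp add: mult_ac)
  finally show ?thesis by (simp only: integral_mult_right_zero)
qed

lemma norm_integral_le_nn:
  fixes f :: "'a \<Rightarrow> complex"
  shows "ennreal (cmod (LINT x|M. f x)) \<le> (\<integral>\<^sup>+x. ennreal (cmod (f x)) \<partial>M)"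
  by (cases "integrable M f") (auto intro: integral_norm_bound_ennreal simp: not_integrable_integral_eq)

abbreviation l2_sq :: "(real \<Rightarrow> complex) \<Rightarrow> ennreal" where
  "l2_sq f \<equiv> (\<integral>\<^sup>+x. ennreal ((cmod (f x))\<^sup>2) \<partial>lborel)"

text \<open>
  By \<open>2ab \<le> a\<^sup>2 + b\<^sup>2\<close> and invariance under translation, the
  correlation of \<open>f\<close> with any of its translates is at most the square of its
  \<open>L\<^sup>2\<close> norm, and so is the average of these correlations.
\<close>

lemma gauss_pairing_bound:
  assumes f: "f \<in> borel_measurable borel"
  shows "ennreal (cmod (LINT t|lborel. f t * gauss_avg e (\<lambda>t. cnj (f t)) t)) \<le> l2_sq f"
proof -
  note [measurable] = f
  let ?S = "l2_sq f"
  have shift: "l2_sq (\<lambda>t. f (t + y)) = ?S" for y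
    using nn_integral_real_affine[of "\<lambda>t. ennreal ((cmod (f t))\<^sup>2)" 1 y] by (simp add: add.commute)
  \<comment> \<open>The correlation of \<open>|f|\<close> with each of its translates.\<close>
  have amgm: "(\<integral>\<^sup>+t. ennreal (cmod (f t) * cmod (f (t + y))) \<partial>lborel) \<le> ?S" for y
  proof -
    have "(\<integral>\<^sup>+t. ennreal (cmod (f t) * cmod (f (t + y))) \<partial>lborel)
      \<le> (\<integral>\<^sup>+t. ennreal (1 / 2) * (ennreal ((cmod (f t))\<^sup>2) + ennreal ((cmod (f (t + y)))\<^sup>2)) \<partial>lborel)"
    proof (rule nn_integral_mono)
      fix t
      have "cmod (f t) * cmod (f (t + y)) \<le> 1 / 2 * ((cmod (f t))\<^sup>2 + (cmod (f (t + y)))\<^sup>2)"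
        using sum_squares_bound[of "cmod (f t)" "cmod (f (t + y))"] by simp
      then show "ennreal (cmod (f t) * cmod (f (t + y))) \<le> ennreal (1 / 2) * (ennreal ((cmod (f t))\<^sup>2) + ennreal ((cmod (f (t + y)))\<^sup>2))"
        by (simp only: ennreal_plus[symmetric] ennreal_mult[symmetric] zero_le_power2 add_nonneg_nonneg) 
           (rule ennreal_leI)
    qed
    also have "\<dots> = ennreal (1 / 2) * (?S + ?S)"
      by (simp add: nn_integral_cmult nn_integral_add shift)
    also have "\<dots> = (ennreal (1 / 2) * 2) * ?S" by (simp only: mult_2[symmetric] mult.assoc)
    also have "ennreal (1 / 2) * 2 = 1" 
      using ennreal_mult[of "1/2" 2] by simp
    finally show ?thesis by simp
  qed
  have "ennreal (cmod (LINT t|lborel. f t * gauss_avg e (\<lambda>t. cnj (f t)) t)) \<le> (\<integral>\<^sup>+t. ennreal (cmod (f t * gauss_avg e (\<lambda>t. cnj (f t)) t)) \<partial>lborel)"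
    by (rule norm_integral_le_nn)
  also have "\<dots> \<le> (\<integral>\<^sup>+t. (\<integral>\<^sup>+z. ennreal (std_normal_density z) * ennreal (cmod (f t) * cmod (f (t + sqrt e * z))) \<partial>lborel) \<partial>lborel)"
  proof (rule nn_integral_mono)
    fix t
    have "ennreal (cmod (f t * gauss_avg e (\<lambda>t. cnj (f t)) t)) = ennreal (cmod (f t)) * ennreal (cmod (gauss_avg e (\<lambda>t. cnj (f t)) t))"
      by (simp add: norm_mult ennreal_mult)
    also have "\<dots> \<le> ennreal (cmod (f t)) * (\<integral>\<^sup>+z. ennreal (cmod (of_real (std_normal_density z) * cnj (f (t + sqrt e * z)))) \<partial>lborel)"
      unfolding gauss_avg_def by (intro mult_left_mono norm_integral_le_nn) simp
    also have "\<dots> = (\<integral>\<^sup>+z. ennreal (std_normal_density z) * ennreal (cmod (f t) * cmod (f (t + sqrt e * z))) \<partial>lborel)"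
      by (subst nn_integral_cmult[symmetric]) (auto simp: norm_mult ennreal_mult[symmetric] mult_ac intro!: nn_integral_cong)
    finally show "ennreal (cmod (f t * gauss_avg e (\<lambda>t. cnj (f t)) t)) \<le> (\<integral>\<^sup>+z. ennreal (std_normal_density z) * ennreal (cmod (f t) * cmod (f (t + sqrt e * z))) \<partial>lborel)" .
  qed
  also have "\<dots> = (\<integral>\<^sup>+z. (\<integral>\<^sup>+t. ennreal (std_normal_density z) * ennreal (cmod (f t) * cmod (f (t + sqrt e * z))) \<partial>lborel) \<partial>lborel)"
    by (rule lborel_pair.Fubini') simp
  also have "\<dots> = (\<integral>\<^sup>+z. ennreal (std_normal_density z) * (\<integral>\<^sup>+t. ennreal (cmod (f t) * cmod (f (t + sqrt e * z))) \<partial>lborel) \<partial>lborel)"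
    by (intro nn_integral_cong nn_integral_cmult) simp
  also have "\<dots> \<le> (\<integral>\<^sup>+z. ennreal (std_normal_density z) * ?S \<partial>lborel)"
    by (intro nn_integral_mono mult_left_mono amgm) simp
  also have "\<dots> = (\<integral>\<^sup>+z. ennreal (std_normal_density z) \<partial>lborel) * ?S"
    by (rule nn_integral_multc) simp
  also have "(\<integral>\<^sup>+z. ennreal (std_normal_density z) \<partial>lborel) = 1"
    using prob_space.emeasure_space_1[OF prob_space_normal_density[of 1 0]] by (simp add: emeasure_density)
  finally show ?thesis by simp
qed

lemma ft_cnj: "ft (\<lambda>t. cnj (f t)) (- l) = cnj (ft f l)"
proof -
  have "cnj (ft f l) = (LINT t|lborel. cnj (f t * cis (- (l * t))))"
    unfolding ft_def by (rule Bochner_Integration.integral_cnj[symmetric])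
  also have "\<dots> = ft (\<lambda>t. cnj (f t)) (- l)" by (simp add: ft_def cis_cnj)
  finally show ?thesis ..
qed

lemma gauss_seq_tendsto: "(\<lambda>n. exp (- (1 / real (Suc n) * l\<^sup>2 / 2))) \<longlonglongrightarrow> 1"
proof -
  have "(\<lambda>n. exp (- (1 / real (Suc n) * l\<^sup>2 / 2))) \<longlonglongrightarrow> exp (- (0 * l\<^sup>2 / 2))"
    by (intro tendsto_intros LIMSEQ_Suc[OF lim_1_over_n]) simp
  then show ?thesis by simp
qed

theorem ft_bessel:
  assumes f: "integrable lborel f"
  shows "l2_sq (\<lambda>l. ft f l) \<le> ennreal (2 * pi) * l2_sq f"
proof -
  have [measurable]: "f \<in> borel_measurable borel" using f by auto
  have ftm [measurable]: "ft f \<in> borel_measurable borel" using f by simp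
  let ?S = "l2_sq f"
  let ?u = "\<lambda>n l. exp (- (1 / real (Suc n) * l\<^sup>2 / 2)) * (cmod (ft f l))\<^sup>2"
  have b: "(\<integral>\<^sup>+l. ennreal (?u n l) \<partial>lborel) \<le> ennreal (2 * pi) * ?S" for n
  proof -
    let ?e = "1 / real (Suc n)"
    have e: "0 < ?e" by simp
    have int: "integrable lborel (?u n)"
    proof (rule Bochner_Integration.integrable_bound)
      show "integrable lborel (\<lambda>l. (LINT t|lborel. cmod (f t))\<^sup>2 * exp (- (?e * l\<^sup>2 / 2)))"
        using gauss_integrable[OF e] by (rule integrable_mult_right)
      show "AE l in lborel. norm (?u n l) \<le> norm ((LINT t|lborel. cmod (f t))\<^sup>2 * exp (- (?e * l\<^sup>2 / 2)))"
        using ft_bound[of f] by (auto intro!: AE_I2 power_mono)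
    qed simp
    have "complex_of_real (LINT l|lborel. ?u n l) = (LINT l|lborel. of_real (exp (- (?e * l\<^sup>2 / 2))) * (ft f l * ft (\<lambda>t. cnj (f t)) (- l)))"
      by (subst integral_complex_of_real[symmetric]) (simp only: of_real_mult complex_norm_square ft_cnj)
    also have "\<dots> = 2 * pi * (LINT t|lborel. f t * gauss_avg ?e (\<lambda>t. cnj (f t)) t)"
      using f by (intro gauss_ft_identity e) auto
    finally have "cmod (complex_of_real (LINT l|lborel. ?u n l)) = cmod (2 * pi * (LINT t|lborel. f t * gauss_avg ?e (\<lambda>t. cnj (f t)) t))"
      by (rule arg_cong)
    then have "(LINT l|lborel. ?u n l) \<le> 2 * pi * cmod (LINT t|lborel. f t * gauss_avg ?e (\<lambda>t. cnj (f t)) t)"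
      by (simp add: norm_mult)
    moreover have "(\<integral>\<^sup>+l. ennreal (?u n l) \<partial>lborel) = ennreal (LINT l|lborel. ?u n l)"
      using int by (intro nn_integral_eq_integral) auto
    ultimately have "(\<integral>\<^sup>+l. ennreal (?u n l) \<partial>lborel) \<le> ennreal (2 * pi * cmod (LINT t|lborel. f t * gauss_avg ?e (\<lambda>t. cnj (f t)) t))"
      by (simp add: ennreal_leI)
    also have "\<dots> = ennreal (2 * pi) * ennreal (cmod (LINT t|lborel. f t * gauss_avg ?e (\<lambda>t. cnj (f t)) t))"
      by (rule ennreal_mult) auto
    also have "\<dots> \<le> ennreal (2 * pi) * ?S"
      by (intro mult_left_mono gauss_pairing_bound) auto
    finally show ?thesis .
  qed
  have lim: "(\<lambda>n. ennreal (?u n l)) \<longlonglongrightarrow> ennreal ((cmod (ft f l))\<^sup>2)" for l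
    using tendsto_mult[OF gauss_seq_tendsto tendsto_const, of l "(cmod (ft f l))\<^sup>2"] by (intro tendsto_ennrealI) simp
  have "l2_sq (\<lambda>l. ft f l) = (\<integral>\<^sup>+l. liminf (\<lambda>n. ennreal (?u n l)) \<partial>lborel)"
    by (intro nn_integral_cong lim_imp_Liminf[OF _ lim, symmetric]) simp
  also have "\<dots> \<le> liminf (\<lambda>n. \<integral>\<^sup>+l. ennreal (?u n l) \<partial>lborel)"
    by (rule nn_integral_liminf) simp
  also have "\<dots> \<le> ennreal (2 * pi) * ?S"
    by (intro Liminf_le always_eventually allI b) simp
  finally show ?thesis .
qed

theorem ft_parseval:
  fixes f g :: "real \<Rightarrow> complex"
  assumes f: "integrable lborel f" "l2_sq f < \<infinity>"
    and g: "integrable lborel g" and gc: "continuous_on UNIV g" and gB: "\<And>t. cmod (g t) \<le> B"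
  shows "(LINT l|lborel. ft f l * ft g (- l)) = 2 * pi * (LINT t|lborel. f t * g t)"
proof -
  have [measurable]: "f \<in> borel_measurable borel" "g \<in> borel_measurable borel" using f g by auto
  have [measurable]: "ft f \<in> borel_measurable borel" "ft g \<in> borel_measurable borel" using f g by simp_all
  have aB: "cmod (g t) \<le> \<bar>B\<bar>" for t using gB[of t] by simp
  have g2: "l2_sq g < \<infinity>"
  proof -
    have "integrable lborel (\<lambda>t. (cmod (g t))\<^sup>2)"
      by (rule Bochner_Integration.integrable_bound[OF integrable_mult_right[OF integrable_norm[OF g], of B]])
         (use aB in \<open>auto simp: power2_eq_square abs_mult intro!: AE_I2 mult_right_mono\<close>)
    then show ?thesis by (simp add: integrable_iff_bounded)
  qed
  have L2: "integrable lborel (\<lambda>l. (cmod (ft h l))\<^sup>2)" if "integrable lborel h" "l2_sq h < \<infinity>" for h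
  proof -
    have [measurable]: "ft h \<in> borel_measurable borel" using that by simp
    have "l2_sq (\<lambda>l. ft h l) < \<infinity>"
      using that(2) by (intro le_less_trans[OF ft_bessel[OF that(1)]]) (simp add: ennreal_mult_less_top)
    then show ?thesis by (intro integrableI_bounded) auto
  qed
  have "integrable lborel (\<lambda>l. (cmod (ft g (0 + -1 * l)))\<^sup>2)"
    by (rule lborel_integrable_real_affine[OF L2[OF g g2]]) simp
  then have g2': "integrable lborel (\<lambda>l. (cmod (ft g (- l)))\<^sup>2)" by simp
  have prod: "integrable lborel (\<lambda>l. ft f l * ft g (- l))"
  proof (rule Bochner_Integration.integrable_bound[OF Bochner_Integration.integrable_add[OF L2[OF f] g2']])
    show "AE l in lborel. norm (ft f l * ft g (- l)) \<le> norm ((cmod (ft f l))\<^sup>2 + (cmod (ft g (- l)))\<^sup>2)"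
    proof (rule AE_I2)
      fix l
      have "0 \<le> cmod (ft f l) * cmod (ft g (- l))" by simp
      then have "cmod (ft f l) * cmod (ft g (- l)) \<le> (cmod (ft f l))\<^sup>2 + (cmod (ft g (- l)))\<^sup>2"
        using sum_squares_bound[of "cmod (ft f l)" "cmod (ft g (- l))"] by linarith
      then show "norm (ft f l * ft g (- l)) \<le> norm ((cmod (ft f l))\<^sup>2 + (cmod (ft g (- l)))\<^sup>2)"
        by (simp add: norm_mult)
    qed
  qed simp
  let ?e = "\<lambda>n. 1 / real (Suc n)"
  have lim1: "(\<lambda>n. LINT l|lborel. of_real (exp (- (?e n * l\<^sup>2 / 2))) * (ft f l * ft g (- l))) \<longlonglongrightarrow> (LINT l|lborel. ft f l * ft g (- l))"
  proof (rule integral_dominated_convergence[OF _ _ integrable_norm[OF prod]])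
    show "AE l in lborel. (\<lambda>n. of_real (exp (- (?e n * l\<^sup>2 / 2))) * (ft f l * ft g (- l))) \<longlonglongrightarrow> ft f l * ft g (- l)"
    proof (rule AE_I2)
      fix l
      have "(\<lambda>n. of_real (exp (- (?e n * l\<^sup>2 / 2))) * (ft f l * ft g (- l))) \<longlonglongrightarrow> of_real 1 * (ft f l * ft g (- l))"
        by (intro tendsto_mult tendsto_of_real gauss_seq_tendsto tendsto_const)
      then show "(\<lambda>n. of_real (exp (- (?e n * l\<^sup>2 / 2))) * (ft f l * ft g (- l))) \<longlonglongrightarrow> ft f l * ft g (- l)" by simp
    qed
    show "AE l in lborel. norm (of_real (exp (- (?e n * l\<^sup>2 / 2))) * (ft f l * ft g (- l))) \<le> norm (ft f l * ft g (- l))" for n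
      by (auto simp: norm_mult intro!: AE_I2 mult_left_le_one_le)
  qed simp_all
  \<comment> \<open>Continuity of \<open>g\<close> makes the Gaussian averages converge at every point.\<close>
  have lim2: "(\<lambda>n. 2 * pi * (LINT t|lborel. f t * gauss_avg (?e n) g t)) \<longlonglongrightarrow> 2 * pi * (LINT t|lborel. f t * g t)"
  proof (intro tendsto_mult tendsto_const integral_dominated_convergence)
    have sd: "integrable lborel std_normal_density" by (rule integrable_normal_density) simp
    have sd1: "(LINT z|lborel. std_normal_density z) = 1" by (rule integral_normal_density) simp
    have avg: "cmod (gauss_avg e g t) \<le> B" for e t
    proof -
      have int: "integrable lborel (\<lambda>z. B * std_normal_density z)" using sd by simp
      have "cmod (gauss_avg e g t) \<le> (LINT z|lborel. cmod (of_real (std_normal_density z) * g (t + sqrt e * z)))"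
        unfolding gauss_avg_def by (rule integral_norm_bound)
      also have "\<dots> \<le> (LINT z|lborel. B * std_normal_density z)"
        using gB by (intro integral_mono_AE' int AE_I2) (use order_trans[OF norm_ge_zero gB] in \<open>auto simp: norm_mult mult.commute[of B] intro!: mult_left_mono\<close>)
      finally show ?thesis by (simp add: sd1)
    qed
    show "integrable lborel (\<lambda>t. B * cmod (f t))" using f by simp
    show "AE t in lborel. norm (f t * gauss_avg (?e n) g t) \<le> B * cmod (f t)" for n
      using avg by (auto simp: norm_mult mult.commute[of B] intro!: mult_left_mono)
    show "(\<lambda>t. f t * gauss_avg (?e n) g t) \<in> borel_measurable lborel" for n
      unfolding gauss_avg_def by measurable
    show "AE t in lborel. (\<lambda>n. f t * gauss_avg (?e n) g t) \<longlonglongrightarrow> f t * g t"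
    proof (rule AE_I2, rule tendsto_mult[OF tendsto_const])
      fix t
      have "(\<lambda>n. gauss_avg (?e n) g t) \<longlonglongrightarrow> (LINT z|lborel. of_real (std_normal_density z) * g t)"
        unfolding gauss_avg_def
      proof (rule integral_dominated_convergence)
        show "integrable lborel (\<lambda>z. B * std_normal_density z)" using sd by simp
        show "AE z in lborel. norm (of_real (std_normal_density z) * g (t + sqrt (?e n) * z)) \<le> B * std_normal_density z" for n
          using gB by (auto simp: norm_mult mult.commute[of B] intro!: mult_left_mono)
        show "AE z in lborel. (\<lambda>n. of_real (std_normal_density z) * g (t + sqrt (?e n) * z)) \<longlonglongrightarrow> of_real (std_normal_density z) * g t"
        proof (rule AE_I2, rule tendsto_mult[OF tendsto_const])
          fix z
          have "(\<lambda>n. t + sqrt (?e n) * z) \<longlonglongrightarrow> t + sqrt 0 * z"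
            by (intro tendsto_intros LIMSEQ_Suc[OF lim_1_over_n])
          then have "(\<lambda>n. t + sqrt (?e n) * z) \<longlonglongrightarrow> t" by simp
          moreover have "isCont g t" using gc by (simp add: continuous_on_eq_continuous_at)
          ultimately show "(\<lambda>n. g (t + sqrt (?e n) * z)) \<longlonglongrightarrow> g t" by (rule isCont_tendsto_compose[rotated])
        qed
      qed simp_all
      also have "(LINT z|lborel. of_real (std_normal_density z) * g t) = g t"
      proof -
        have "(LINT z|lborel. complex_of_real (std_normal_density z) * g t) = (LINT z|lborel. complex_of_real (std_normal_density z)) * g t"
          by (rule integral_mult_left_zero)
        then show ?thesis by (simp only: integral_complex_of_real sd1) simp
      qed
      finally show "(\<lambda>n. gauss_avg (?e n) g t) \<longlonglongrightarrow> g t" .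
    qed
  qed simp
  have eq: "(LINT l|lborel. of_real (exp (- (?e n * l\<^sup>2 / 2))) * (ft f l * ft g (- l))) = 2 * pi * (LINT t|lborel. f t * gauss_avg (?e n) g t)" for n
    by (rule gauss_ft_identity[OF f(1) g]) simp
  show ?thesis by (rule LIMSEQ_unique[OF lim1[unfolded eq] lim2])
qed

section \<open>Smooth functions of time with compact support\<close>

text \<open>
  The classical function \<open>exp(-c/(x - a))\<close>, flat at \<open>a\<close>, times a power
  of \<open>1/(x - a)\<close>. The powers make the family closed under differentiation up to
  linear combinations.
\<close>

definition flat_right :: "real \<Rightarrow> real \<Rightarrow> nat \<Rightarrow> real \<Rightarrow> real" where
  "flat_right c a k x = (if a < x then (1 / (x - a)) ^ k * exp (- (c / (x - a))) else 0)"

lemma flat_right_limit: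
  assumes "0 < c"
  shows "((\<lambda>x. flat_right c a k x) \<longlongrightarrow> 0) (at_right a)"
proof -
  have "((\<lambda>y. (c * y) ^ k / exp (c * y)) \<longlongrightarrow> 0) at_top"
    by (rule filterlim_compose[OF tendsto_power_div_exp_0])
       (intro filterlim_tendsto_pos_mult_at_top[OF tendsto_const assms filterlim_ident])
  then have "((\<lambda>y. 1 / c ^ k * ((c * y) ^ k / exp (c * y))) \<longlongrightarrow> 1 / c ^ k * 0) at_top"
    by (intro tendsto_mult tendsto_const)
  then have *: "((\<lambda>y. y ^ k * exp (- (c * y))) \<longlongrightarrow> 0) at_top"
    using assms by (simp add: power_mult_distrib exp_minus field_simps)
  have "filterlim (\<lambda>x. 1 / (x - a)) at_top (at_right a)" by real_asymp
  from filterlim_compose[OF * this]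
  have "((\<lambda>x. (1 / (x - a)) ^ k * exp (- (c * (1 / (x - a))))) \<longlongrightarrow> 0) (at_right a)" .
  then show ?thesis
    by (rule Lim_transform_eventually) (auto simp: flat_right_def eventually_at_right_less intro: eventually_mono[OF eventually_at_right_less[of a]])
qed

text \<open>
  Away from \<open>a\<close> this is calculus; at \<open>a\<close> the difference quotient from
  the right is the function with \<open>k + 1\<close> in place of \<open>k\<close>, which tends to
  \<open>0\<close>.
\<close>

lemma flat_right_deriv:
  assumes "0 < c"
  shows "(flat_right c a k has_real_derivative (c * flat_right c a (k + 2) x - real k * flat_right c a (k + 1) x)) (at x)"
proof -
  consider "x < a" | "x = a" | "a < x" by linarith
  then show ?thesis
  proof cases
    case 1
    have "((\<lambda>x. 0) has_real_derivative 0) (at x)" by simp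
    then have "(flat_right c a k has_real_derivative 0) (at x)"
      by (rule DERIV_cong_ev[THEN iffD1, rotated -1, OF _ refl _ refl])
         (use 1 in \<open>auto simp: flat_right_def eventually_nhds intro!: exI[of _ "{..<a}"]\<close>)
    then show ?thesis using 1 by (simp add: flat_right_def)
  next
    case 2
    have "((\<lambda>y. (flat_right c a k y - flat_right c a k a) / (y - a)) \<longlongrightarrow> 0) (at a)"
    proof (rule filterlim_split_at)
      show "((\<lambda>y. (flat_right c a k y - flat_right c a k a) / (y - a)) \<longlongrightarrow> 0) (at_left a)"
        by (rule Lim_transform_eventually[OF tendsto_const])
           (auto simp: flat_right_def eventually_at_filter)
      show "((\<lambda>y. (flat_right c a k y - flat_right c a k a) / (y - a)) \<longlongrightarrow> 0) (at_right a)"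
        by (rule Lim_transform_eventually[OF flat_right_limit[OF assms, of a "Suc k"]])
           (auto simp: flat_right_def eventually_at_filter)
    qed
    then have "(flat_right c a k has_real_derivative 0) (at a)"
      by (simp add: has_field_derivative_iff)
    then show ?thesis using 2 by (simp add: flat_right_def)
  next
    case 3
    have "((\<lambda>x. (1 / (x - a)) ^ k * exp (- (c / (x - a)))) has_real_derivative
        (c * ((1 / (x - a)) ^ (k + 2) * exp (- (c / (x - a)))) - real k * ((1 / (x - a)) ^ (k + 1) * exp (- (c / (x - a)))))) (at x)"
    proof -
      let ?y = "\<lambda>x. 1 / (x - a)" and ?P = "\<lambda>y. y ^ k * exp (- (c * y))"
      have y: "(?y has_real_derivative - (?y x)\<^sup>2) (at x)"
        using 3 by (auto intro!: derivative_eq_intros simp: power2_eq_square)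
      have "(?P has_real_derivative (real k * ?y x ^ (k - 1) * exp (- (c * ?y x)) - c * (?y x ^ k * exp (- (c * ?y x))))) (at (?y x))"
        by (auto intro!: derivative_eq_intros simp: algebra_simps)
      from DERIV_chain2[OF this y]
      have "((\<lambda>x. ?P (?y x)) has_real_derivative (real k * ?y x ^ (k - 1) * exp (- (c * ?y x)) - c * (?y x ^ k * exp (- (c * ?y x)))) * - (?y x)\<^sup>2) (at x)" .
      moreover have "(real k * Y ^ (k - 1) * e - c * (Y ^ k * e)) * - (Y)\<^sup>2 = c * (Y ^ (k + 2) * e) - real k * (Y ^ (k + 1) * e)" for Y e :: real
        by (cases k) (simp_all add: power2_eq_square algebra_simps)
      ultimately show ?thesis by simp
    qed
    then have "(flat_right c a k has_real_derivative
        (c * ((1 / (x - a)) ^ (k + 2) * exp (- (c / (x - a)))) - real k * ((1 / (x - a)) ^ (k + 1) * exp (- (c / (x - a)))))) (at x)"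
      by (rule DERIV_cong_ev[THEN iffD1, rotated -1, OF _ refl _ refl])
         (use 3 in \<open>auto simp: flat_right_def eventually_nhds intro!: exI[of _ "{a<..}"]\<close>)
    then show ?thesis using 3 by (simp add: flat_right_def)
  qed
qed

text \<open>
  An algebra of functions that contains the bump functions and that is closed under
  differentiation. Its elements are therefore infinitely differentiable, without any computation
  of higher derivatives.
\<close>

inductive flat :: "(real \<Rightarrow> complex) \<Rightarrow> bool" where
  right: "0 < c \<Longrightarrow> flat (\<lambda>x. of_real (flat_right c a k x))"
| reflect: "flat f \<Longrightarrow> flat (\<lambda>x. f (- x))"
| scale: "flat f \<Longrightarrow> flat (\<lambda>x. z * f x)"
| add: "flat f \<Longrightarrow> flat g \<Longrightarrow> flat (\<lambda>x. f x + g x)"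
| mult: "flat f \<Longrightarrow> flat g \<Longrightarrow> flat (\<lambda>x. f x * g x)"

lemma flat_deriv:
  assumes "flat f"
  shows "\<exists>f'. flat f' \<and> (\<forall>x. (f has_vector_derivative f' x) (at x))"
  using assms
proof induction
  case (right c a k)
  have "flat (\<lambda>x. of_real c * of_real (flat_right c a (k + 2) x) + (- of_real (real k)) * of_real (flat_right c a (k + 1) x))"
    by (intro flat.intros right)
  moreover have "((\<lambda>x. complex_of_real (flat_right c a k x)) has_vector_derivative
     (of_real c * of_real (flat_right c a (k + 2) x) + (- of_real (real k)) * of_real (flat_right c a (k + 1) x))) (at x)" for x
    using has_vector_derivative_of_real[OF flat_right_deriv[OF right, of a k x]] by (simp add: algebra_simps)
  ultimately show ?case by blast
next
  case (reflect f)
  then obtain f' where f': "flat f'" "\<And>x. (f has_vector_derivative f' x) (at x)" by blast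
  have "((\<lambda>x. f (- x)) has_vector_derivative (- 1 * f' (- x))) (at x)" for x
  proof -
    have "(uminus has_vector_derivative - 1) (at x)"
      by (auto intro!: derivative_eq_intros)
    from vector_diff_chain_at[OF this f'(2)] show ?thesis by (simp add: o_def)
  qed
  moreover have "flat (\<lambda>x. - 1 * f' (- x))" by (intro flat.intros f')
  ultimately show ?case by blast
next
  case (scale f z)
  then obtain f' where f': "flat f'" "\<And>x. (f has_vector_derivative f' x) (at x)" by blast
  have "((\<lambda>x. z * f x) has_vector_derivative z * f' x) (at x)" for x
    by (intro has_vector_derivative_mult_right f')
  then show ?case using flat.scale[OF f'(1), of z] by blast
next
  case (add f g)
  then obtain f' g' where f': "flat f'" "\<And>x. (f has_vector_derivative f' x) (at x)" and g': "flat g'" "\<And>x. (g has_vector_derivative g' x) (at x)" by blast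
  have "((\<lambda>x. f x + g x) has_vector_derivative f' x + g' x) (at x)" for x
    by (intro has_vector_derivative_add f' g')
  then show ?case using flat.add[OF f'(1) g'(1)] by blast
next
  case (mult f g)
  then obtain f' g' where f': "flat f'" "\<And>x. (f has_vector_derivative f' x) (at x)" and g': "flat g'" "\<And>x. (g has_vector_derivative g' x) (at x)" by blast
  have "((\<lambda>x. f x * g x) has_vector_derivative f x * g' x + f' x * g x) (at x)" for x
    by (intro has_vector_derivative_mult f' g')
  moreover have "flat (\<lambda>x. f x * g' x + f' x * g x)"
    using mult f' g' by (intro flat.add flat.mult)
  ultimately show ?case by blast
qed

text \<open>
  Infinite differentiability together with a choice of all derivatives. Sums, multiples and
  vanishing on open sets are easier to handle for such a sequence than for iterated Frechet
  derivatives.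
\<close>

definition deriv_chain :: "(nat \<Rightarrow> real \<Rightarrow> complex) \<Rightarrow> bool" where
  "deriv_chain D \<longleftrightarrow> (\<forall>k x. (D k has_vector_derivative D (Suc k) x) (at x))"

lemma flat_deriv_chain:
  assumes "flat f"
  obtains D where "D 0 = f" "deriv_chain D"
proof -
  define nxt where "nxt f = (SOME f'. flat f' \<and> (\<forall>x. (f has_vector_derivative f' x) (at x)))" for f
  have nxt: "flat (nxt f) \<and> (\<forall>x. (f has_vector_derivative nxt f x) (at x))" if "flat f" for f
    using someI_ex[OF flat_deriv[OF that]] unfolding nxt_def .
  define D where "D k = (nxt ^^ k) f" for k
  have "flat (D k)" for k
    by (induction k) (auto simp: D_def assms nxt)
  then have "deriv_chain D"
    using nxt by (auto simp: deriv_chain_def D_def)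
  then show ?thesis using that[of D] by (simp add: D_def)
qed

lemma deriv_chain_continuous: "deriv_chain D \<Longrightarrow> continuous_on S (D k)"
  unfolding deriv_chain_def
  by (meson continuous_at_imp_continuous_on has_vector_derivative_continuous)

lemma deriv_chain_vanish:
  assumes D: "deriv_chain D" and U: "open U" and "\<And>x. x \<in> U \<Longrightarrow> D 0 x = 0"
  shows "x \<in> U \<Longrightarrow> D k x = 0"
proof (induction k arbitrary: x)
  case (Suc k)
  have "((\<lambda>x. 0) has_vector_derivative 0) (at x)" by simp
  then have "(D k has_vector_derivative 0) (at x)"
    by (rule has_vector_derivative_transform_within_open[OF _ U Suc.prems]) (simp add: Suc.IH)
  then show ?case using D vector_derivative_unique_at unfolding deriv_chain_def by blast
qed (use assms in auto)

lemma deriv_chain_iter_deriv: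
  assumes D: "deriv_chain D" and "set bs \<subseteq> Basis"
  shows "iter_deriv bs (D 0) = D (length bs)"
  using assms(2)
proof (induction bs)
  case (Cons b bs)
  have "frechet_derivative (D k) (at x) b = D (Suc k) x" if "b = 1" for k x
  proof -
    have "(D k has_derivative (\<lambda>h. h *\<^sub>R D (Suc k) x)) (at x)"
      using D by (simp add: deriv_chain_def has_vector_derivative_def)
    then show ?thesis using that by (simp add: frechet_derivative_at[symmetric])
  qed
  then show ?case using Cons by auto
qed simp

lemma deriv_chain_smooth:
  assumes D: "deriv_chain D"
  shows "smooth (D 0)"
  unfolding smooth_def
proof (intro allI impI)
  fix bs :: "real list" assume "set bs \<subseteq> Basis"
  then have "iter_deriv bs (D 0) = D (length bs)" by (rule deriv_chain_iter_deriv[OF D])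
  moreover have "D (length bs) differentiable_on UNIV"
    using D by (auto simp: deriv_chain_def differentiable_on_def has_vector_derivative_def differentiable_def intro: has_derivative_at_withinI)
  ultimately show "iter_deriv bs (D 0) differentiable_on UNIV" by simp
qed

lemma flat_time_test:
  assumes f: "flat f" and "0 < a" "b < T" and van: "\<And>x. x \<notin> {a..b} \<Longrightarrow> f x = 0"
  shows "time_test T f"
proof -
  obtain D where "D 0 = f" "deriv_chain D" using flat_deriv_chain[OF f] .
  then have "smooth f" using deriv_chain_smooth by blast
  moreover have "closure {x. f x \<noteq> 0} \<subseteq> {a..b}"
  proof (rule closure_minimal)
    show "{x. f x \<noteq> 0} \<subseteq> {a..b}" using van by blast
  qed simp
  ultimately show ?thesis using assms(2,3) by (auto simp: time_test_def)
qed

text \<open>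
  As \<open>m\<close> grows, these functions increase to the indicator function of \<open>(a,
  b)\<close>.
\<close>

definition bump :: "nat \<Rightarrow> real \<Rightarrow> real \<Rightarrow> real \<Rightarrow> real" where
  "bump m a b x = flat_right (1 / real (Suc m)) a 0 x * flat_right (1 / real (Suc m)) (- b) 0 (- x)"

lemma flat_bump: "flat (\<lambda>x. of_real (bump m a b x))"
  unfolding bump_def of_real_mult
  by (intro flat.mult flat.right flat.reflect[of "\<lambda>x. of_real (flat_right _ _ _ x)"]) auto

lemma bump_range: "0 \<le> bump m a b x" "bump m a b x \<le> indicator {a<..<b} x"
proof -
  show "0 \<le> bump m a b x" by (simp add: bump_def flat_right_def)
  have "exp (- (1 / real (Suc m) / (x - a))) * exp (- (1 / real (Suc m) / (- x - - b))) \<le> 1 * 1" if "a < x" "x < b"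
    using that by (intro mult_mono) auto
  then show "bump m a b x \<le> indicator {a<..<b} x"
    by (auto simp: bump_def flat_right_def indicator_def)
qed

lemma bump_pos: "a < x \<Longrightarrow> x < b \<Longrightarrow> 0 < bump m a b x"
  by (simp add: bump_def flat_right_def)

lemma bump_zero: "x \<notin> {a..b} \<Longrightarrow> bump m a b x = 0"
  by (auto simp: bump_def flat_right_def)

lemma bump_tendsto: "(\<lambda>m. bump m a b x) \<longlonglongrightarrow> indicator {a<..<b} x"
proof (cases "a < x \<and> x < b")
  case True
  have "(\<lambda>m. exp (- (1 / real (Suc m) / (x - a))) * exp (- (1 / real (Suc m) / (- x - - b)))) \<longlonglongrightarrow> exp (- (0 / (x - a))) * exp (- (0 / (- x - - b)))"
    using True by (intro tendsto_intros LIMSEQ_Suc[OF lim_1_over_n]) auto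
  then show ?thesis using True by (simp add: bump_def flat_right_def)
next
  case False
  then have "bump m a b x = 0" for m by (auto simp: bump_def flat_right_def)
  then show ?thesis using False by (auto simp: indicator_def)
qed

lemma flat_continuous:
  assumes "flat f" shows "continuous_on UNIV f"
proof -
  obtain D where "D 0 = f" "deriv_chain D" using flat_deriv_chain[OF assms] .
  then show ?thesis using deriv_chain_continuous[of D UNIV 0] by simp
qed

lemma bump_measurable [measurable]: "bump m a b \<in> borel_measurable borel"
proof -
  have "(\<lambda>x. Re (of_real (bump m a b x))) \<in> borel_measurable borel"
    by (intro borel_measurable_continuous_onI continuous_on_Re flat_continuous flat_bump)
  then show ?thesis by simp
qed

section \<open>Density in \<open>L\<^sup>2\<close> and the fundamental lemma\<close>

text \<open>
  Membership of the closure in \<open>L\<^sup>2\<close> of the smooth functions with compact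
  support.
\<close>

definition l2_approx :: "(real \<Rightarrow> complex) \<Rightarrow> bool" where
  "l2_approx f \<longleftrightarrow> f \<in> borel_measurable borel \<and> (\<forall>e>0. \<exists>D R. deriv_chain D \<and> (\<forall>k x. R < \<bar>x\<bar> \<longrightarrow> D k x = 0) \<and>
      l2_sq (\<lambda>x. f x - D 0 x) < ennreal e)"

lemma cmod_add_sq_le: "(cmod (a + b))\<^sup>2 \<le> 2 * (cmod a)\<^sup>2 + 2 * (cmod b)\<^sup>2"
proof -
  have "(cmod (a + b))\<^sup>2 \<le> (cmod a + cmod b)\<^sup>2" by (intro power_mono norm_triangle_ineq) simp
  also have "\<dots> \<le> 2 * (cmod a)\<^sup>2 + 2 * (cmod b)\<^sup>2"
    using sum_squares_bound[of "cmod a" "cmod b"] by (simp add: power2_sum)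
  finally show ?thesis .
qed

lemma l2_sq_add:
  assumes [measurable]: "f \<in> borel_measurable lborel" "g \<in> borel_measurable lborel"
    and f: "l2_sq f < ennreal (e / 4)"
    and g: "l2_sq g < ennreal (e / 4)" and "0 < e"
  shows "l2_sq (\<lambda>x. f x + g x) < ennreal e"
proof -
  have "l2_sq (\<lambda>x. f x + g x) \<le> (\<integral>\<^sup>+x. ennreal 2 * ennreal ((cmod (f x))\<^sup>2) + ennreal 2 * ennreal ((cmod (g x))\<^sup>2) \<partial>lborel)"
  proof (rule nn_integral_mono)
    fix x
    have "ennreal ((cmod (f x + g x))\<^sup>2) \<le> ennreal (2 * (cmod (f x))\<^sup>2 + 2 * (cmod (g x))\<^sup>2)"
      by (intro ennreal_leI cmod_add_sq_le)
    also have "\<dots> = ennreal 2 * ennreal ((cmod (f x))\<^sup>2) + ennreal 2 * ennreal ((cmod (g x))\<^sup>2)"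
      by (subst ennreal_plus) (simp_all add: ennreal_mult del: ennreal_numeral)
    finally show "ennreal ((cmod (f x + g x))\<^sup>2) \<le> ennreal 2 * ennreal ((cmod (f x))\<^sup>2) + ennreal 2 * ennreal ((cmod (g x))\<^sup>2)" .
  qed
  also have "\<dots> = ennreal 2 * l2_sq f + ennreal 2 * l2_sq g"
    by (subst nn_integral_add) (auto simp: nn_integral_cmult)
  also have "\<dots> < ennreal 2 * ennreal (e / 4) + ennreal 2 * ennreal (e / 4)"
    using f g by (intro add_strict_mono ennreal_mult_strict_left_mono) auto
  also have "\<dots> = ennreal e"
    using \<open>0 < e\<close> by (simp only: ennreal_mult[symmetric] ennreal_plus[symmetric] divide_nonneg_pos less_imp_le zero_le_numeral mult_nonneg_nonneg zero_less_numeral) simp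
  finally show ?thesis .
qed

lemma l2_approx_close:
  assumes [measurable]: "f \<in> borel_measurable borel" 
    and g: "\<And>e. 0 < e \<Longrightarrow> \<exists>g. l2_approx g \<and> l2_sq (\<lambda>x. f x - g x) < ennreal e"
  shows "l2_approx f"
  unfolding l2_approx_def
proof (intro conjI allI impI)
  fix e :: real assume "0 < e"
  then have e4: "0 < e / 4" by simp
  obtain g where g: "l2_approx g" "l2_sq (\<lambda>x. f x - g x) < ennreal (e / 4)" using g[OF e4] by blast
  then have [measurable]: "g \<in> borel_measurable borel" by (simp add: l2_approx_def)
  obtain D R where D: "deriv_chain D" "\<forall>k x. R < \<bar>x\<bar> \<longrightarrow> D k x = 0" "l2_sq (\<lambda>x. g x - D 0 x) < ennreal (e / 4)"
    using g(1) e4 unfolding l2_approx_def by blast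
  have [measurable]: "D 0 \<in> borel_measurable borel" by (intro borel_measurable_continuous_onI deriv_chain_continuous D(1))
  have "l2_sq (\<lambda>x. (f x - g x) + (g x - D 0 x)) < ennreal e"
    by (rule l2_sq_add[OF _ _ g(2) D(3) \<open>0 < e\<close>]) auto
  then have "l2_sq (\<lambda>x. f x - D 0 x) < ennreal e" by simp
  then show "\<exists>D R. deriv_chain D \<and> (\<forall>k x. R < \<bar>x\<bar> \<longrightarrow> D k x = 0) \<and> l2_sq (\<lambda>x. f x - D 0 x) < ennreal e"
    using D by blast
qed simp

lemma l2_approx_limit:
  assumes g: "\<And>n. l2_approx (g n)" and [measurable]: "w \<in> borel_measurable borel" "f \<in> borel_measurable borel"
    and w: "(\<integral>\<^sup>+x. ennreal ((w x)\<^sup>2) \<partial>lborel) < \<infinity>"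
    and le: "\<And>n x. cmod (f x - g n x) \<le> w x" and lim: "\<And>x. (\<lambda>n. g n x) \<longlonglongrightarrow> f x"
  shows "l2_approx f"
proof (rule l2_approx_close)
  have [measurable]: "g n \<in> borel_measurable borel" for n using g by (simp add: l2_approx_def)
  fix e :: real assume "0 < e"
  have "(\<lambda>n. \<integral>\<^sup>+x. ennreal ((cmod (f x - g n x))\<^sup>2) \<partial>lborel) \<longlonglongrightarrow> (\<integral>\<^sup>+x. ennreal 0 \<partial>(lborel :: real measure))"
  proof (rule nn_integral_dominated_convergence[where M=lborel and w="\<lambda>x. ennreal ((w x)\<^sup>2)" and u="\<lambda>n x. ennreal ((cmod (f x - g n x))\<^sup>2)" and u'="\<lambda>x. ennreal 0"])
    show "AE x in lborel. ennreal ((cmod (f x - g n x))\<^sup>2) \<le> ennreal ((w x)\<^sup>2)" for n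
      using le by (auto intro!: AE_I2 ennreal_leI power_mono)
    show "AE x in lborel. (\<lambda>n. ennreal ((cmod (f x - g n x))\<^sup>2)) \<longlonglongrightarrow> ennreal 0"
    proof (rule AE_I2, rule tendsto_ennrealI)
      fix x
      have "(\<lambda>n. (cmod (f x - g n x))\<^sup>2) \<longlonglongrightarrow> (cmod (f x - f x))\<^sup>2" by (intro tendsto_intros lim)
      then show "(\<lambda>n. (cmod (f x - g n x))\<^sup>2) \<longlonglongrightarrow> 0" by simp
    qed
  qed (use w in auto)
  then have "(\<lambda>n. \<integral>\<^sup>+x. ennreal ((cmod (f x - g n x))\<^sup>2) \<partial>lborel) \<longlonglongrightarrow> 0" by simp
  moreover have "0 < ennreal e" using \<open>0 < e\<close> by simp
  ultimately have "\<forall>\<^sub>F n in sequentially. l2_sq (\<lambda>x. f x - g n x) < ennreal e"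
    by (rule order_tendstoD(2))
  then obtain n where "l2_sq (\<lambda>x. f x - g n x) < ennreal e"
    by (auto simp: eventually_sequentially)
  then show "\<exists>g. l2_approx g \<and> l2_sq (\<lambda>x. f x - g x) < ennreal e"
    using g by blast
qed simp

lemma l2_approx_add:
  assumes "l2_approx f" "l2_approx g"
  shows "l2_approx (\<lambda>x. f x + g x)"
  unfolding l2_approx_def
proof (intro conjI allI impI)
  have [measurable]: "f \<in> borel_measurable borel" "g \<in> borel_measurable borel" using assms by (auto simp: l2_approx_def)
  show "(\<lambda>x. f x + g x) \<in> borel_measurable borel" by measurable
  fix e :: real assume "0 < e"
  then have e4: "0 < e / 4" by simp
  obtain D R where D: "deriv_chain D" "\<forall>k x. R < \<bar>x\<bar> \<longrightarrow> D k x = 0" "l2_sq (\<lambda>x. f x - D 0 x) < ennreal (e / 4)"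
    using assms(1) e4 unfolding l2_approx_def by blast
  obtain E S where E: "deriv_chain E" "\<forall>k x. S < \<bar>x\<bar> \<longrightarrow> E k x = 0" "l2_sq (\<lambda>x. g x - E 0 x) < ennreal (e / 4)"
    using assms(2) e4 unfolding l2_approx_def by blast
  have [measurable]: "D 0 \<in> borel_measurable borel" "E 0 \<in> borel_measurable borel" by (intro borel_measurable_continuous_onI deriv_chain_continuous D(1) E(1))+
  have "l2_sq (\<lambda>x. (f x - D 0 x) + (g x - E 0 x)) < ennreal e"
    by (rule l2_sq_add[OF _ _ D(3) E(3) \<open>0 < e\<close>]) auto
  then have "l2_sq (\<lambda>x. f x + g x - (D 0 x + E 0 x)) < ennreal e"
    by (simp add: algebra_simps)
  moreover have "deriv_chain (\<lambda>k x. D k x + E k x)"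
    using D(1) E(1) by (auto simp: deriv_chain_def intro!: has_vector_derivative_add)
  moreover have "\<forall>k x. max R S < \<bar>x\<bar> \<longrightarrow> D k x + E k x = 0" using D(2) E(2) by auto
  ultimately show "\<exists>D R. deriv_chain D \<and> (\<forall>k x. R < \<bar>x\<bar> \<longrightarrow> D k x = 0) \<and> l2_sq (\<lambda>x. f x + g x - D 0 x) < ennreal e"
    by (intro exI[of _ "\<lambda>k x. D k x + E k x"] exI[of _ "max R S"]) auto
qed

lemma l2_approx_scale:
  assumes "l2_approx f"
  shows "l2_approx (\<lambda>x. c * f x)"
  unfolding l2_approx_def
proof (intro conjI allI impI)
  have [measurable]: "f \<in> borel_measurable borel" using assms by (auto simp: l2_approx_def)
  show "(\<lambda>x. c * f x) \<in> borel_measurable borel" by measurable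
  fix e :: real assume "0 < e"
  define r where "r = (cmod c)\<^sup>2 + 1"
  have r: "0 < r" by (simp add: r_def add_nonneg_pos)
  then have e4: "0 < e / r" using \<open>0 < e\<close> by simp
  obtain D R where D: "deriv_chain D" "\<forall>k x. R < \<bar>x\<bar> \<longrightarrow> D k x = 0" "l2_sq (\<lambda>x. f x - D 0 x) < ennreal (e / r)"
    using assms(1) e4 unfolding l2_approx_def by blast
  have [measurable]: "D 0 \<in> borel_measurable borel" by (intro borel_measurable_continuous_onI deriv_chain_continuous D(1))+
  have "l2_sq (\<lambda>x. c * f x - c * D 0 x) = ennreal ((cmod c)\<^sup>2) * l2_sq (\<lambda>x. f x - D 0 x)"
    by (subst nn_integral_cmult[symmetric]) (auto simp: norm_mult power_mult_distrib ennreal_mult[symmetric] simp flip: right_diff_distrib)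
  also have "\<dots> \<le> ennreal r * l2_sq (\<lambda>x. f x - D 0 x)"
    by (intro mult_right_mono ennreal_leI) (auto simp: r_def)
  also have "\<dots> < ennreal r * ennreal (e / r)"
    using r by (intro ennreal_mult_strict_left_mono D(3)) auto
  also have "\<dots> = ennreal e" using r \<open>0 < e\<close> by (subst ennreal_mult[symmetric]) auto
  finally have "l2_sq (\<lambda>x. c * f x - c * D 0 x) < ennreal e" .
  moreover have "deriv_chain (\<lambda>k x. c * D k x)"
    using D(1) by (auto simp: deriv_chain_def intro!: has_vector_derivative_mult_right)
  ultimately show "\<exists>D R. deriv_chain D \<and> (\<forall>k x. R < \<bar>x\<bar> \<longrightarrow> D k x = 0) \<and> l2_sq (\<lambda>x. c * f x - D 0 x) < ennreal e"
    using D(2) by (intro exI[of _ "\<lambda>k x. c * D k x"] exI[of _ R]) auto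
qed

lemma l2_approx_flat:
  assumes f: "flat f" and van: "\<And>x. x \<notin> {a<..<b} \<Longrightarrow> f x = 0"
  shows "l2_approx f"
  unfolding l2_approx_def
proof (intro conjI allI impI)
  show "f \<in> borel_measurable borel" by (intro borel_measurable_continuous_onI flat_continuous f)
  fix e :: real assume "0 < e"
  obtain D where D: "D 0 = f" "deriv_chain D" using flat_deriv_chain[OF f] .
  have "D k x = 0" if "max \<bar>a\<bar> \<bar>b\<bar> < \<bar>x\<bar>" for k x
  proof (rule deriv_chain_vanish[OF D(2), of "- {a..b}"])
    show "D 0 x = 0" if "x \<in> - {a..b}" for x using that van[of x] D(1) by auto
  qed (use that in auto)
  then show "\<exists>D R. deriv_chain D \<and> (\<forall>k x. R < \<bar>x\<bar> \<longrightarrow> D k x = 0) \<and> l2_sq (\<lambda>x. f x - D 0 x) < ennreal e"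
    using D \<open>0 < e\<close> by (intro exI[of _ D] exI[of _ "max \<bar>a\<bar> \<bar>b\<bar>"]) auto
qed

lemma indicator_sq_finite: "(\<integral>\<^sup>+x. ennreal ((indicator {a<..<b::real} x)\<^sup>2) \<partial>lborel) < \<infinity>"
proof -
  have "(\<integral>\<^sup>+x. ennreal ((indicator {a<..<b::real} x)\<^sup>2) \<partial>lborel) = (\<integral>\<^sup>+x. indicator {a<..<b} x \<partial>lborel)"
    by (intro nn_integral_cong) (auto simp: indicator_def)
  also have "\<dots> < \<infinity>" by (cases "a \<le> b") auto
  finally show ?thesis .
qed

lemma of_real_indicator: "of_real (indicator A x) = (indicator A x :: complex)"
  by (simp add: indicator_def)

lemma l2_approx_interval: "l2_approx (\<lambda>x. indicator {a<..<b} x)"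
proof (rule l2_approx_limit[where w="indicator {a<..<b}"])
  show "l2_approx (\<lambda>x. of_real (bump m a b x))" for m
  proof (rule l2_approx_flat[OF flat_bump])
    show "complex_of_real (bump m a b x) = 0" if "x \<notin> {a<..<b}" for x
      using bump_range[of m a b x] that by simp
  qed
  show "cmod (indicator {a<..<b} x - of_real (bump m a b x)) \<le> indicator {a<..<b} x" for m x
  proof -
    have "indicator {a<..<b} x - complex_of_real (bump m a b x) = of_real (indicator {a<..<b} x - bump m a b x)"
      by (simp add: indicator_def)
    then show ?thesis using bump_range[of m a b x] by (simp only: norm_of_real)
  qed
  show "(\<lambda>m. complex_of_real (bump m a b x)) \<longlonglongrightarrow> indicator {a<..<b} x" for x
    using tendsto_of_real[OF bump_tendsto[of a b x], where 'a=complex] by (simp only: of_real_indicator)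
qed (use indicator_sq_finite in \<open>auto simp del: power2_eq_1_iff\<close>)

lemma borel_eq_open_intervals: "borel = sigma UNIV (range (\<lambda>(a, b). {a<..<b::real}))"
  using borel_eq_box[where 'a=real] by (simp add: box_real)

lemma indicator_UN_less:
  fixes A :: "nat \<Rightarrow> 'a set"
  assumes "disjoint_family A"
  shows "(indicator (\<Union>i<n. A i) x :: complex) = (\<Sum>i<n. indicator (A i) x)"
proof (induction n)
  case (Suc n)
  have "A i \<inter> A n = {}" if "i < n" for i using assms that by (simp add: disjoint_family_on_def)
  then have "(\<Union>i<n. A i) \<inter> A n = {}" by blast
  then have "(indicator ((\<Union>i<n. A i) \<union> A n) x :: complex) = indicator (\<Union>i<n. A i) x + indicator (A n) x"
    by (auto simp: indicator_def)
  moreover have "(\<Union>i<Suc n. A i) = (\<Union>i<n. A i) \<union> A n" by (auto simp: less_Suc_eq)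
  ultimately show ?case by (simp only: Suc.IH sum.lessThan_Suc)
qed simp

lemma open_intervals_Int_stable:
  "Int_stable (range (\<lambda>(a, b). {a<..<b::real}))" "range (\<lambda>(a, b). {a<..<b::real}) \<subseteq> Pow UNIV"
proof -
  have "{a<..<b} \<inter> {c<..<d} = {max a c<..<min b d}" for a b c d :: real by auto
  then show "Int_stable (range (\<lambda>(a, b). {a<..<b::real}))"
    unfolding Int_stable_def by (auto 4 3)
qed simp

text \<open>
  Intervals are limits of bump functions, and the sets for which the claim holds form a Dynkin
  system. The window \<open>(c, d)\<close> keeps all measures finite, so that complements are
  harmless.
\<close>

lemma l2_approx_set:
  assumes "A \<in> sets borel"
  shows "l2_approx (\<lambda>x. indicator (A \<inter> {c<..<d}) x)"
proof -
  have "A \<in> sigma_sets UNIV (range (\<lambda>(a, b). {a<..<b::real}))"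
    using assms unfolding borel_eq_open_intervals by simp
  from open_intervals_Int_stable this show ?thesis
  proof (induction rule: sigma_sets_induct_disjoint)
    fix A :: "real set" assume "A \<in> range (\<lambda>(a, b). {a<..<b})"
    then obtain a b where "A = {a<..<b}" by auto
    then have "A \<inter> {c<..<d} = {max a c<..<min b d}" by auto
    then show "l2_approx (\<lambda>x. indicator (A \<inter> {c<..<d}) x)" using l2_approx_interval by simp
  next
    show "l2_approx (\<lambda>x. indicator ({} \<inter> {c<..<d}) x)" using l2_approx_interval[of 0 0] by simp
  next
    fix A :: "real set" assume A: "l2_approx (\<lambda>x. indicator (A \<inter> {c<..<d}) x)"
    have "(\<lambda>x. indicator ((UNIV - A) \<inter> {c<..<d}) x) = (\<lambda>x. indicator {c<..<d} x + (- 1) * indicator (A \<inter> {c<..<d}) x :: complex)"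
      by (auto simp: indicator_def)
    then show "l2_approx (\<lambda>x. indicator ((UNIV - A) \<inter> {c<..<d}) x)"
      using l2_approx_add[OF l2_approx_interval l2_approx_scale[OF A, of "- 1"]] by simp
  next
    fix A :: "nat \<Rightarrow> real set"
    assume dis: "disjoint_family A" and A0: "range A \<subseteq> sigma_sets UNIV (range (\<lambda>(a, b). {a<..<b}))" and A: "\<And>i. l2_approx (\<lambda>x. indicator (A i \<inter> {c<..<d}) x)"
    have [measurable]: "A i \<in> sets borel" for i using A0 unfolding borel_eq_open_intervals by auto
    show "l2_approx (\<lambda>x. indicator ((\<Union>i. A i) \<inter> {c<..<d}) x)"
    proof (rule l2_approx_limit[where w="indicator {c<..<d}"])
      have ind: "(\<Sum>i<n. indicator (A i \<inter> {c<..<d}) x) = (indicator ((\<Union>i<n. A i) \<inter> {c<..<d}) x :: complex)" for n x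
      proof -
        have "disjoint_family (\<lambda>i. A i \<inter> {c<..<d})" using dis by (auto simp: disjoint_family_on_def)
        from indicator_UN_less[OF this, of n x]
        have "(indicator (\<Union>i<n. A i \<inter> {c<..<d}) x :: complex) = (\<Sum>i<n. indicator (A i \<inter> {c<..<d}) x)" .
        moreover have "(\<Union>i<n. A i \<inter> {c<..<d}) = (\<Union>i<n. A i) \<inter> {c<..<d}" by blast
        ultimately show ?thesis by (simp only:)
      qed
      show "l2_approx (\<lambda>x. indicator ((\<Union>i<n. A i) \<inter> {c<..<d}) x)" for n
      proof -
        have "l2_approx (\<lambda>x. \<Sum>i<n. indicator (A i \<inter> {c<..<d}) x)"
        proof (induction n)
          case 0
          then show ?case using l2_approx_interval[of 0 0] by simp
        next
          case (Suc n)
          then show ?case using l2_approx_add[OF _ A[of n]] by simp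
        qed
        then show ?thesis by (simp only: ind)
      qed
      show "cmod (indicator ((\<Union>i. A i) \<inter> {c<..<d}) x - indicator ((\<Union>i<n. A i) \<inter> {c<..<d}) x) \<le> indicator {c<..<d} x" for n x
        by (auto simp: indicator_def)
      show "(\<lambda>n. indicator ((\<Union>i<n. A i) \<inter> {c<..<d}) x :: complex) \<longlonglongrightarrow> indicator ((\<Union>i. A i) \<inter> {c<..<d}) x" for x
      proof (cases "x \<in> (\<Union>i. A i) \<inter> {c<..<d}")
        case True
        then obtain i where i: "x \<in> A i" by blast
        have "\<forall>\<^sub>F n in sequentially. indicator ((\<Union>i. A i) \<inter> {c<..<d}) x = (indicator ((\<Union>i<n. A i) \<inter> {c<..<d}) x :: complex)"
          using eventually_gt_at_top[of i] by eventually_elim (use True i in \<open>auto simp: indicator_def\<close>)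
        then show ?thesis by (rule Lim_transform_eventually[OF tendsto_const])
      next
        case False
        then have "indicator ((\<Union>i<n. A i) \<inter> {c<..<d}) x = (0::complex)" for n by (auto simp: indicator_def)
        with False show ?thesis by simp
      qed
    qed (use indicator_sq_finite in auto)
  qed
qed

text \<open>
  Approximation by increasing simple functions. The hypothesis on the \<open>L\<^sup>2\<close>
  norm is part of the induction; for nonnegative functions it passes from a sum to the summands
  and from a limit to the sequence.
\<close>

lemma l2_approx_nonneg:
  fixes u :: "real \<Rightarrow> real"
  assumes u: "u \<in> borel_measurable borel" "\<And>x. 0 \<le> u x" 
    and fin: "(\<integral>\<^sup>+x. ennreal ((u x * indicator {c<..<d} x)\<^sup>2) \<partial>lborel) < \<infinity>"
  shows "l2_approx (\<lambda>x. of_real (u x * indicator {c<..<d} x))"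
  using u fin
proof (induction rule: borel_measurable_induct_real)
  case (set A)
  have "(\<lambda>x. complex_of_real (indicat_real A x * indicat_real {c<..<d} x)) = indicator (A \<inter> {c<..<d})"
    by (auto simp: indicator_def)
  then show ?case using l2_approx_set[of A c d] set by simp
next
  case (mult u z)
  show ?case
  proof (cases "z = 0")
    case True
    then show ?thesis using l2_approx_interval[of 0 0] by simp
  next
    case False
    have [measurable]: "u \<in> borel_measurable borel" using mult by simp
    have "(\<integral>\<^sup>+x. ennreal ((u x * indicator {c<..<d} x)\<^sup>2) \<partial>lborel) = ennreal ((1/z)\<^sup>2) * (\<integral>\<^sup>+x. ennreal ((z * u x * indicator {c<..<d} x)\<^sup>2) \<partial>lborel)"
      using False by (subst nn_integral_cmult[symmetric]) (auto simp: ennreal_mult[symmetric] power_mult_distrib[symmetric] intro!: nn_integral_cong)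
    also have "\<dots> < \<infinity>" using mult.prems by (simp add: ennreal_mult_less_top)
    finally show ?thesis using l2_approx_scale[OF mult.IH, of "of_real z"] by (simp add: mult_ac)
  qed
next
  case (add u v)
  have [measurable]: "u \<in> borel_measurable borel" "v \<in> borel_measurable borel" using add by auto
  have "(\<integral>\<^sup>+x. ennreal ((u x * indicator {c<..<d} x)\<^sup>2) \<partial>lborel) \<le> (\<integral>\<^sup>+x. ennreal (((v x + u x) * indicator {c<..<d} x)\<^sup>2) \<partial>lborel)"
    "(\<integral>\<^sup>+x. ennreal ((v x * indicator {c<..<d} x)\<^sup>2) \<partial>lborel) \<le> (\<integral>\<^sup>+x. ennreal (((v x + u x) * indicator {c<..<d} x)\<^sup>2) \<partial>lborel)"
    using add by (auto intro!: nn_integral_mono ennreal_leI power_mono mult_right_mono mult_nonneg_nonneg)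
  then show ?case using l2_approx_add[OF add.IH(2) add.IH(1)] add.prems by (simp add: distrib_right)
next
  case (seq U)
  have [measurable]: "U i \<in> borel_measurable borel" "u \<in> borel_measurable borel" for i using seq u by auto
  have lim: "(\<lambda>i. U i x) \<longlonglongrightarrow> u x" for x using seq by simp
  have le: "U i x \<le> u x" for i x
  proof -
    have "incseq (\<lambda>i. U i x)" using \<open>incseq U\<close> by (auto simp: incseq_def le_fun_def)
    then show ?thesis using incseq_le[OF _ lim] by blast
  qed
  show ?case
  proof (rule l2_approx_limit[where w="\<lambda>x. u x * indicator {c<..<d} x"])
    show "l2_approx (\<lambda>x. of_real (U i x * indicator {c<..<d} x))" for i
    proof (rule seq.IH)
      have "(\<integral>\<^sup>+x. ennreal ((U i x * indicator {c<..<d} x)\<^sup>2) \<partial>lborel) \<le> (\<integral>\<^sup>+x. ennreal ((u x * indicator {c<..<d} x)\<^sup>2) \<partial>lborel)"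
        using seq(2) le by (intro nn_integral_mono ennreal_leI power_mono mult_right_mono mult_nonneg_nonneg) auto
      then show "(\<integral>\<^sup>+x. ennreal ((U i x * indicator {c<..<d} x)\<^sup>2) \<partial>lborel) < \<infinity>"
        using seq.prems le_less_trans by blast
    qed
    show "cmod (complex_of_real (u x * indicator {c<..<d} x) - complex_of_real (U i x * indicator {c<..<d} x)) \<le> u x * indicator {c<..<d} x" for i x
      unfolding of_real_diff[symmetric] norm_of_real using seq(2)[of i x] le[of i x] by (auto simp: indicator_def)
    show "(\<lambda>i. complex_of_real (U i x * indicator {c<..<d} x)) \<longlonglongrightarrow> complex_of_real (u x * indicator {c<..<d} x)" for x
      by (intro tendsto_intros lim)
  qed (use seq.prems in auto)
qed

theorem l2_approx_supported:
  assumes f: "f \<in> borel_measurable borel" "l2_sq f < \<infinity>"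
    and van: "\<And>x. x \<notin> {c<..<d} \<Longrightarrow> f x = 0"
  shows "l2_approx f"
proof -
  note [measurable] = f(1)
  have nonneg: "l2_approx (\<lambda>x. of_real (u x * indicator {c<..<d} x))"
    if [measurable]: "u \<in> borel_measurable borel" and u: "\<And>x. 0 \<le> u x" "\<And>x. u x \<le> cmod (f x)" for u
  proof (rule l2_approx_nonneg)
    have "(\<integral>\<^sup>+x. ennreal ((u x * indicator {c<..<d} x)\<^sup>2) \<partial>lborel) \<le> l2_sq f"
      using u by (intro nn_integral_mono ennreal_leI power_mono mult_nonneg_nonneg) (auto simp: indicator_def)
    then show "(\<integral>\<^sup>+x. ennreal ((u x * indicator {c<..<d} x)\<^sup>2) \<partial>lborel) < \<infinity>" using f(2) by (rule le_less_trans)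
  qed (use that in auto)
  let ?i = "\<lambda>x. indicator {c<..<d} x :: real"
  have "\<bar>Re z\<bar> \<le> cmod z" "\<bar>Im z\<bar> \<le> cmod z" for z by (rule abs_Re_le_cmod abs_Im_le_cmod)+
  note b = this
  have "l2_approx (\<lambda>x. (of_real (max 0 (Re (f x)) * ?i x) + (- 1) * of_real (max 0 (- Re (f x)) * ?i x))
      + \<i> * (of_real (max 0 (Im (f x)) * ?i x) + (- 1) * of_real (max 0 (- Im (f x)) * ?i x)))"
    using b by (intro l2_approx_add l2_approx_scale nonneg) (auto simp: abs_le_iff intro: order_trans)
  also have "(\<lambda>x. (of_real (max 0 (Re (f x)) * ?i x) + (- 1) * of_real (max 0 (- Re (f x)) * ?i x))
      + \<i> * (of_real (max 0 (Im (f x)) * ?i x) + (- 1) * of_real (max 0 (- Im (f x)) * ?i x))) = f"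
    using van by (auto simp: fun_eq_iff complex_eq_iff indicator_def max_def)
  finally show ?thesis .
qed

text \<open>
  The sets over which \<open>f\<close> has integral zero form a Dynkin system, so they include all
  Borel sets.
\<close>

lemma AE_zero_if_interval_integrals_zero:
  fixes f :: "real \<Rightarrow> complex"
  assumes f: "integrable lborel f" and zero: "\<And>a b. (LINT x|lborel. f x * indicator {a<..<b} x) = 0"
  shows "AE x in lborel. f x = 0"
proof -
  have [measurable]: "f \<in> borel_measurable borel" using f by auto
  have intA: "integrable lborel (\<lambda>x. f x * indicator A x)" if "A \<in> sets borel" for A
    using that by (intro Bochner_Integration.integrable_bound[OF f]) (auto simp: indicator_def norm_mult)
  have all0: "(LINT x|lborel. f x) = 0"
  proof -
    have "(\<lambda>n. LINT x|lborel. f x * indicator {- real n<..<real n} x) \<longlonglongrightarrow> (LINT x|lborel. f x)"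
    proof (rule integral_dominated_convergence[OF _ _ integrable_norm[OF f]])
      show "AE x in lborel. (\<lambda>n. f x * indicator {- real n<..<real n} x) \<longlonglongrightarrow> f x"
      proof (rule AE_I2)
        fix x
        obtain N where N: "\<bar>x\<bar> < real N" using reals_Archimedean2 by blast
        have "\<forall>\<^sub>F n in sequentially. f x = f x * indicator {- real n<..<real n} x"
          using eventually_ge_at_top[of N] by eventually_elim (use N in \<open>auto simp: indicator_def\<close>)
        then show "(\<lambda>n. f x * indicator {- real n<..<real n} x) \<longlonglongrightarrow> f x" by (rule Lim_transform_eventually[OF tendsto_const])
      qed
    qed (auto simp: indicator_def norm_mult)
    then show ?thesis by (simp add: zero LIMSEQ_const_iff)
  qed
  have sets0: "(LINT x|lborel. f x * indicator A x) = 0" if "A \<in> sets borel" for A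
  proof -
    have "A \<in> sigma_sets UNIV (range (\<lambda>(a, b). {a<..<b::real}))"
      using that unfolding borel_eq_open_intervals by simp
    from open_intervals_Int_stable this show ?thesis
    proof (induction rule: sigma_sets_induct_disjoint)
      fix A :: "real set" assume "A \<in> range (\<lambda>(a, b). {a<..<b})"
      then show "(LINT x|lborel. f x * indicator A x) = 0" using zero by auto
    next
      fix A :: "real set" assume A0: "A \<in> sigma_sets UNIV (range (\<lambda>(a, b). {a<..<b}))" and A: "(LINT x|lborel. f x * indicator A x) = 0"
      have "A \<in> sets borel" using A0 unfolding borel_eq_open_intervals by simp
      then have "(LINT x|lborel. f x - f x * indicator A x) = 0"
        using A all0 by (subst Bochner_Integration.integral_diff) (auto intro: f intA)
      moreover have "f x * indicator (UNIV - A) x = f x - f x * indicator A x" for x by (auto simp: indicator_def)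
      ultimately show "(LINT x|lborel. f x * indicator (UNIV - A) x) = 0" by simp
    next
      fix A :: "nat \<Rightarrow> real set"
      assume dis: "disjoint_family A" and A0: "range A \<subseteq> sigma_sets UNIV (range (\<lambda>(a, b). {a<..<b}))" and A: "\<And>i. (LINT x|lborel. f x * indicator (A i) x) = 0"
      have Am [measurable]: "A i \<in> sets borel" for i using A0 unfolding borel_eq_open_intervals by auto
      have "(\<lambda>n. LINT x|lborel. f x * indicator (\<Union>i<n. A i) x) \<longlonglongrightarrow> (LINT x|lborel. f x * indicator (\<Union>i. A i) x)"
      proof (rule integral_dominated_convergence[OF _ _ integrable_norm[OF f]])
        show "AE x in lborel. (\<lambda>n. f x * indicator (\<Union>i<n. A i) x) \<longlonglongrightarrow> f x * indicator (\<Union>i. A i) x"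
          by (intro AE_I2 tendsto_mult tendsto_const LIMSEQ_indicator_UN)
      qed (auto simp: indicator_def norm_mult)
      moreover have "(LINT x|lborel. f x * indicator (\<Union>i<n. A i) x) = 0" for n
      proof -
        have eq: "f x * indicator (\<Union>i<n. A i) x = (\<Sum>i<n. f x * indicator (A i) x)" for x
          by (simp only: indicator_UN_less[OF dis] sum_distrib_left)
        show ?thesis unfolding eq by (simp only: Bochner_Integration.integral_sum intA Am A) simp
      qed
      ultimately show "(LINT x|lborel. f x * indicator (\<Union>i. A i) x) = 0" by (simp add: LIMSEQ_const_iff)
    qed simp
  qed
  have set0: "(LINT x:A|lborel. f x) = 0" if "A \<in> sets borel" for A
    using sets0[OF that] unfolding set_lebesgue_integral_def scaleR_conv_of_real of_real_indicator by (simp only: mult.commute)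
  have si: "set_integrable lborel A f" if "A \<in> sets borel" for A
    using f that by (auto simp: set_integrable_def intro: integrable_mult_indicator)
  have "AE x in lborel. Re (f x) = 0"
  proof (rule density_unique_real)
    fix A :: "real set" assume "A \<in> sets lborel"
    then have A: "A \<in> sets borel" by simp
    have "(LINT x:A|lborel. Re (f x)) = Re (LINT x:A|lborel. f x)"
      using si[OF A] unfolding set_lebesgue_integral_def set_integrable_def by (subst integral_Re[symmetric]) auto
    then show "(LINT x:A|lborel. Re (f x)) = (LINT x:A|lborel. 0)" unfolding set0[OF A] by (simp add: set_lebesgue_integral_def)
  qed (use f in auto)
  moreover have "AE x in lborel. Im (f x) = 0"
  proof (rule density_unique_real)
    fix A :: "real set" assume "A \<in> sets lborel"
    then have A: "A \<in> sets borel" by simp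
    have "(LINT x:A|lborel. Im (f x)) = Im (LINT x:A|lborel. f x)"
      using si[OF A] unfolding set_lebesgue_integral_def set_integrable_def by (subst integral_Im[symmetric]) auto
    then show "(LINT x:A|lborel. Im (f x)) = (LINT x:A|lborel. 0)" unfolding set0[OF A] by (simp add: set_lebesgue_integral_def)
  qed (use f in auto)
  ultimately show ?thesis by eventually_elim (simp add: complex_eq_iff)
qed

text \<open>
  The function \<open>w\<close> itself need not be integrable near \<open>0\<close> and
  \<open>T\<close>. Multiplied by a bump function \<open>\<chi>\<close> on an inner interval it
  is, and since \<open>\<chi>\<close> times any bump function is again a test function, the
  integral of \<open>w \<chi>\<close> over every interval vanishes.
\<close>

theorem fundamental_lemma:
  fixes w :: "real \<Rightarrow> complex"
  assumes int: "\<And>\<phi>. time_test T \<phi> \<Longrightarrow> integrable lborel (\<lambda>t. w t * \<phi> t)"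
    and zero: "\<And>\<phi>. time_test T \<phi> \<Longrightarrow> (LINT t|lborel. w t * \<phi> t) = 0"
  shows "AE t in lborel. t \<in> {0<..<T} \<longrightarrow> w t = 0"
proof -
  have inner: "AE t in lborel. t \<in> {a<..<b} \<longrightarrow> w t = 0" if ab: "0 < a" "b < T" for a b
  proof -
    have test: "time_test T (\<lambda>x. of_real (bump 0 a b x) * of_real (bump m a' b' x))" for m a' b'
      using ab by (intro flat_time_test[where a=a and b=b] flat.mult flat_bump) (simp_all add: bump_zero)
    have test0: "time_test T (\<lambda>x. of_real (bump 0 a b x))"
      using ab by (intro flat_time_test[where a=a and b=b] flat_bump) (simp_all add: bump_zero)
    define W where "W t = w t * of_real (bump 0 a b t)" for t
    have W: "integrable lborel W" unfolding W_def by (rule int[OF test0])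
    have "AE t in lborel. W t = 0"
    proof (rule AE_zero_if_interval_integrals_zero[OF W])
      fix a' b' :: real
      have [measurable]: "W \<in> borel_measurable borel" using W by auto
      have "(\<lambda>m. LINT x|lborel. W x * of_real (bump m a' b' x)) \<longlonglongrightarrow> (LINT x|lborel. W x * indicator {a'<..<b'} x)"
      proof (rule integral_dominated_convergence[OF _ _ integrable_norm[OF W]])
        show "AE x in lborel. (\<lambda>m. W x * of_real (bump m a' b' x)) \<longlonglongrightarrow> W x * indicator {a'<..<b'} x"
        proof (rule AE_I2)
          fix x
          show "(\<lambda>m. W x * of_real (bump m a' b' x)) \<longlonglongrightarrow> W x * indicator {a'<..<b'} x"
            using tendsto_mult[OF tendsto_const tendsto_of_real[OF bump_tendsto[of a' b' x], where 'a=complex], of "W x"] by (simp only: of_real_indicator)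
        qed
        show "AE x in lborel. norm (W x * of_real (bump m a' b' x)) \<le> norm (W x)" for m
        proof (rule AE_I2)
          fix x
          have "bump m a' b' x \<le> 1" using order_trans[OF bump_range(2)[of m a' b' x], of 1] by (simp add: indicator_def)
          then show "norm (W x * of_real (bump m a' b' x)) \<le> norm (W x)"
            using bump_range(1)[of m a' b' x] by (simp add: norm_mult mult_right_le_one_le)
        qed
      qed auto
      moreover have "(LINT x|lborel. W x * of_real (bump m a' b' x)) = 0" for m
        using zero[OF test, of m a' b'] by (simp add: W_def mult.assoc)
      ultimately show "(LINT x|lborel. W x * indicator {a'<..<b'} x) = 0" by (simp add: LIMSEQ_const_iff)
    qed
    then show ?thesis
      by eventually_elim (use bump_pos[of a _ b 0] in \<open>force simp: W_def\<close>)
  qed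
  \<comment> \<open>Countably many inner intervals exhaust \<open>(0, T)\<close>.\<close>
  have "AE t in lborel. \<forall>n::nat. t \<in> {1 / real (Suc n)<..<T - 1 / real (Suc n)} \<longrightarrow> w t = 0"
    unfolding AE_all_countable by (intro allI inner) auto
  then show ?thesis
  proof eventually_elim
    case (elim t)
    show ?case
    proof
      assume t: "t \<in> {0<..<T}"
      obtain n where n: "1 / real (Suc n) < min t (T - t)"
        using nat_approx_posE[of "min t (T - t)"] t by (auto simp: inverse_eq_divide)
      then show "w t = 0" using elim[rule_format, of n] by auto
    qed
  qed
qed

section \<open>From the dispersive norm to bounded functions of time\<close>

lemma dual_slice_measurable [measurable (raw)]:
  assumes [measurable]: "F \<in> borel_measurable dual_measure"
  shows "(\<lambda>l. F (l, n)) \<in> borel_measurable borel"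
proof -
  have "F \<in> borel_measurable (lborel \<Otimes>\<^sub>M count_space UNIV)" using assms by (simp add: dual_measure_def)
  then have "(\<lambda>l. F (l, n)) \<in> borel_measurable lborel"
    by (rule measurable_compose[rotated]) (intro measurable_Pair measurable_const measurable_ident_sets, auto)
  then show ?thesis by simp
qed

lemma dual_measurableI:
  assumes "\<And>n. (\<lambda>l. F (l, n)) \<in> borel_measurable borel"
  shows "F \<in> borel_measurable dual_measure"
proof -
  have "(\<lambda>x. F (snd x, fst x)) \<in> borel_measurable (count_space UNIV \<Otimes>\<^sub>M lborel)"
    by (rule measurable_pair_measure_countable1) (use assms in auto)
  from measurable_compose[OF measurable_pair_swap' this] show ?thesis
    by (simp add: dual_measure_def case_prod_beta)
qed

lemma nn_integral_dual:
  assumes "h \<in> borel_measurable dual_measure"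
  shows "(\<integral>\<^sup>+z. h z \<partial>dual_measure) = (\<integral>\<^sup>+n. (\<integral>\<^sup>+l. h (l, n) \<partial>lborel) \<partial>count_space UNIV)"
proof -
  interpret C: sigma_finite_measure "count_space (UNIV :: (int \<times> int) set)"
    by (rule sigma_finite_measure_count_space_countable) simp
  interpret pair_sigma_finite "lborel :: real measure" "count_space (UNIV :: (int \<times> int) set)" ..
  show ?thesis
    unfolding dual_measure_def
    by (rule nn_integral_snd[symmetric]) (use assms in \<open>simp add: dual_measure_def case_prod_beta\<close>)
qed

text \<open>
  The contribution of the spatial frequency \<open>n\<close> to the square of the norm.
\<close>

definition slice_sq :: "real \<Rightarrow> real \<Rightarrow> (real \<times> int \<times> int \<Rightarrow> complex) \<Rightarrow> int \<times> int \<Rightarrow> ennreal" where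
  "slice_sq s b F n = (\<integral>\<^sup>+l. ennreal ((X_weight s b (l, n) * cmod (F (l, n)))\<^sup>2) \<partial>lborel)"

lemma bracket_measurable [measurable]: "(bracket :: real \<Rightarrow> real) \<in> borel_measurable borel"
  unfolding bracket_def by measurable

lemma X_weight_measurable [measurable]: "X_weight s b \<in> borel_measurable dual_measure"
  by (rule dual_measurableI) (simp add: X_weight_def)

text \<open>
  The norm is a sum over spatial frequencies, so that estimates can be made one frequency at a
  time.
\<close>

lemma X_sq_slices:
  assumes [measurable]: "F \<in> borel_measurable dual_measure"
  shows "X_sq s b F = (\<integral>\<^sup>+n. slice_sq s b F n \<partial>count_space UNIV)"
  unfolding X_sq_def slice_sq_def by (rule nn_integral_dual) measurable

lemma sum_le_nn_integral_count:
  fixes f :: "'a \<Rightarrow> ennreal"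
  assumes "finite A"
  shows "sum f A \<le> (\<integral>\<^sup>+n. f n \<partial>count_space UNIV)"
proof -
  have "sum f A = (\<integral>\<^sup>+n. f n \<partial>count_space A)"
    using assms by (simp add: nn_integral_count_space_finite)
  also have "\<dots> = (\<integral>\<^sup>+n. f n * indicator A n \<partial>count_space UNIV)"
    by (rule nn_integral_count_space_indicator) simp
  also have "\<dots> \<le> (\<integral>\<^sup>+n. f n \<partial>count_space UNIV)"
    by (intro nn_integral_mono) (auto simp: indicator_def)
  finally show ?thesis .
qed

text \<open>
  The square of the \<open>L\<^sup>2\<close> norm of
  \<open>\<langle>\<lambda>\<rangle>\<^sup>-\<^sup>b\<close>, the constant in the embedding.
\<close>

definition disp_integral :: "real \<Rightarrow> ennreal" where
  "disp_integral b = (\<integral>\<^sup>+l. ennreal (bracket l powr (- (2 * b))) \<partial>(lborel :: real measure))"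

lemma disp_integral_finite:
  assumes "1 / 2 < b"
  shows "disp_integral b < \<infinity>"
proof -
  have i: "(\<integral>\<^sup>+l. ennreal (indicator {1..} l * l powr (- (2 * b))) \<partial>lborel) = ennreal (- (1 powr (- (2 * b) + 1)) / (- (2 * b) + 1))"
    by (rule nn_integral_has_integral_lebesgue[OF _ has_integral_powr_to_inf]) (use assms in auto)
  have i2: "(\<integral>\<^sup>+l. ennreal (indicator {1..} (- l) * (- l) powr (- (2 * b))) \<partial>lborel) = (\<integral>\<^sup>+l. ennreal (indicator {1..} l * l powr (- (2 * b))) \<partial>lborel)"
    using nn_integral_real_affine[of "\<lambda>l. ennreal (indicator {1..} l * l powr (- (2 * b)))" "-1" 0] by simp
  have "disp_integral b \<le> (\<integral>\<^sup>+l. indicator {-1..1} l + (ennreal (indicator {1..} l * l powr (- (2 * b))) + ennreal (indicator {1..} (- l) * (- l) powr (- (2 * b)))) \<partial>lborel)"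
    unfolding disp_integral_def
  proof (rule nn_integral_mono)
    fix l :: real
    have pw: "bracket l powr (- (2 * b)) \<le> \<bar>l\<bar> powr (- (2 * b))" if "1 \<le> \<bar>l\<bar>"
      using that assms by (intro powr_mono2') (auto simp: bracket_def intro!: real_le_rsqrt)
    consider "\<bar>l\<bar> \<le> 1" | "1 < l" | "l < -1" by linarith
    then show "ennreal (bracket l powr (- (2 * b))) \<le> indicator {-1..1} l + (ennreal (indicator {1..} l * l powr (- (2 * b))) + ennreal (indicator {1..} (- l) * (- l) powr (- (2 * b))))"
    proof cases
      case 1
      have "bracket l powr (- (2 * b)) \<le> bracket l powr 0"
        using assms bracket_ge_1[of l] by (intro powr_mono) auto
      then have "ennreal (bracket l powr (- (2 * b))) \<le> 1" by (simp add: ennreal_leI)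
      moreover have "indicator {-1..1} l = (1 :: ennreal)" using 1 by (auto simp: indicator_def)
      moreover have "(1 :: ennreal) \<le> 1 + y" for y by simp
      ultimately show ?thesis using order_trans by metis
    next
      case 2
      then have "ennreal (bracket l powr (- (2 * b))) \<le> ennreal (l powr (- (2 * b)))" using pw by (intro ennreal_leI) simp
      with 2 show ?thesis by (simp add: indicator_def)
    next
      case 3
      then have "ennreal (bracket l powr (- (2 * b))) \<le> ennreal ((- l) powr (- (2 * b)))" using pw by (intro ennreal_leI) simp
      with 3 show ?thesis by (simp add: indicator_def)
    qed
  qed
  also have "\<dots> = emeasure lborel {-1..1::real} + (ennreal (- (1 powr (- (2 * b) + 1)) / (- (2 * b) + 1)) + ennreal (- (1 powr (- (2 * b) + 1)) / (- (2 * b) + 1)))"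
    by (subst nn_integral_add, simp, simp, subst nn_integral_add, simp, simp, simp only: i2 i, simp)
  also have "\<dots> < \<infinity>" by simp
  finally show ?thesis .
qed

text \<open>
  The modulation weight \<open>\<langle>|\<lambda>| - c\<rangle>\<close> is, for each sign of
  \<open>\<lambda>\<close>, a translate of \<open>\<langle>\<lambda>\<rangle>\<close> up to
  reflection; hence a bound that does not depend on \<open>c\<close>.
\<close>

lemma disp_integral_shift:
  fixes c :: real
  shows "(\<integral>\<^sup>+l. ennreal (bracket (\<bar>l\<bar> - c) powr (- (2 * b))) \<partial>lborel) \<le> 2 * disp_integral b"
proof -
  let ?\<phi> = "\<lambda>l::real. ennreal (bracket l powr (- (2 * b)))"
  have "(\<integral>\<^sup>+l. ?\<phi> (\<bar>l\<bar> - c) \<partial>lborel) \<le> (\<integral>\<^sup>+l. ?\<phi> (l - c) + ?\<phi> (- l - c) \<partial>lborel)"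
    by (intro nn_integral_mono) (auto simp: abs_if)
  also have "\<dots> = (\<integral>\<^sup>+l. ?\<phi> (l - c) \<partial>lborel) + (\<integral>\<^sup>+l. ?\<phi> (- l - c) \<partial>lborel)"
    by (rule nn_integral_add) auto
  also have "(\<integral>\<^sup>+l. ?\<phi> (l - c) \<partial>lborel) = disp_integral b"
    unfolding disp_integral_def using nn_integral_real_affine[of ?\<phi> 1 "- c"] by simp
  also have "(\<integral>\<^sup>+l. ?\<phi> (- l - c) \<partial>lborel) = disp_integral b"
    unfolding disp_integral_def using nn_integral_real_affine[of ?\<phi> "- 1" "- c"] by (simp add: algebra_simps)
  finally show ?thesis by (simp only: mult_2)
qed

text \<open>
  The Fourier coefficients at time \<open>t\<close> of the function whose space-time Fourier
  transform is \<open>F\<close>.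
\<close>

definition time_coeff :: "(real \<times> int \<times> int \<Rightarrow> complex) \<Rightarrow> real \<Rightarrow> torus_distr" where
  "time_coeff F t n = (LINT l|lborel. F (l, n) * cis (l * t)) / of_real ((2 * pi) ^ 3)"

text \<open>
  Cauchy-Schwarz with the modulation weight \<open>\<langle>|\<lambda>| -
  \<langle>n\<rangle>\<rangle>\<^sup>b\<close> and its inverse. The constant is finite for
  \<open>b > 1/2\<close>, when the square of the inverse weight is integrable.
\<close>

lemma slice_L1:
  assumes [measurable]: "F \<in> borel_measurable dual_measure"
  shows "(ennreal (bracket (freq n) powr s) * (\<integral>\<^sup>+l. ennreal (cmod (F (l, n))) \<partial>lborel))\<^sup>2 \<le> 2 * disp_integral b * slice_sq s b F n"
proof -
  let ?k = "bracket (freq n)"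
  let ?w = "\<lambda>l. bracket (\<bar>l\<bar> - ?k)"
  have "ennreal (?k powr s) * (\<integral>\<^sup>+l. ennreal (cmod (F (l, n))) \<partial>lborel) = (\<integral>\<^sup>+l. ennreal (?w l powr (- b)) * ennreal (X_weight s b (l, n) * cmod (F (l, n))) \<partial>lborel)"
  proof -
    have "ennreal (?k powr s) * ennreal (cmod (F (l, n))) = ennreal (?w l powr (- b)) * ennreal (X_weight s b (l, n) * cmod (F (l, n)))" for l
      by (simp add: ennreal_mult[symmetric] X_weight_def powr_minus)
    then show ?thesis by (subst nn_integral_cmult[symmetric]) auto
  qed
  also have "\<dots>\<^sup>2 \<le> (\<integral>\<^sup>+l. (ennreal (?w l powr (- b)))\<^sup>2 \<partial>lborel) * (\<integral>\<^sup>+l. (ennreal (X_weight s b (l, n) * cmod (F (l, n))))\<^sup>2 \<partial>lborel)"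
    by (rule Cauchy_Schwarz_nn_integral) (auto simp: X_weight_def)
  also have "(\<integral>\<^sup>+l. (ennreal (?w l powr (- b)))\<^sup>2 \<partial>lborel) = (\<integral>\<^sup>+l. ennreal (?w l powr (- (2 * b))) \<partial>lborel)"
    by (intro nn_integral_cong) (simp add: power2_eq_square ennreal_mult[symmetric] powr_add[symmetric])
  also have "(\<integral>\<^sup>+l. (ennreal (X_weight s b (l, n) * cmod (F (l, n))))\<^sup>2 \<partial>lborel) = slice_sq s b F n"
    unfolding slice_sq_def by (intro nn_integral_cong) (simp add: ennreal_power X_weight_def)
  also have "(\<integral>\<^sup>+l. ennreal (?w l powr (- (2 * b))) \<partial>lborel) * slice_sq s b F n \<le> 2 * disp_integral b * slice_sq s b F n"
    by (intro mult_right_mono disp_integral_shift) simp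
  finally show ?thesis .
qed

lemma X_sq_finite_integrable:
  assumes [measurable]: "F \<in> borel_measurable dual_measure" and fin: "X_sq s b F < \<infinity>" and b: "1 / 2 < b"
  shows "integrable lborel (\<lambda>l. F (l, n))"
proof (rule integrableI_bounded)
  have "slice_sq s b F n \<le> X_sq s b F"
    using sum_le_nn_integral_count[of "{n}" "slice_sq s b F"] by (simp add: X_sq_slices)
  then have "2 * disp_integral b * slice_sq s b F n < \<infinity>"
    using fin disp_integral_finite[OF b] by (auto simp: ennreal_mult_less_top)
  then have "(ennreal (bracket (freq n) powr s) * (\<integral>\<^sup>+l. ennreal (cmod (F (l, n))) \<partial>lborel))\<^sup>2 < \<infinity>"
    using slice_L1[of F n s b] le_less_trans by auto
  moreover have "(ennreal x * \<infinity>)\<^sup>2 = \<infinity>" if "0 < x" for x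
    using that by (simp add: power2_eq_square ennreal_mult_top)
  ultimately show "(\<integral>\<^sup>+l. ennreal (cmod (F (l, n))) \<partial>lborel) < \<infinity>"
    by (metis (no_types) bracket_pos(1) infinity_ennreal_def less_top order_less_irrefl powr_gt_zero bracket_pos(3))
qed simp

definition embed_const :: "real \<Rightarrow> real" where
  "embed_const b = sqrt (enn2real (2 * disp_integral b)) / (2 * pi) ^ 3"

text \<open>
  The embedding of \<open>X\<^sup>s\<^sup>,\<^sup>b\<close>, \<open>b > 1/2\<close>, into
  functions bounded in time with values in \<open>H\<^sup>s\<close>.
\<close>

theorem time_coeff_hs_bounded:
  assumes [measurable]: "F \<in> borel_measurable dual_measure" and fin: "X_sq s b F < \<infinity>" and b: "1 / 2 < b"
  shows "hs_bounded s (embed_const b * X_norm s b F) (time_coeff F t)"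
  unfolding hs_bounded_def
proof (intro allI impI)
  fix A :: "(int \<times> int) set" assume A: "finite A"
  let ?L = "\<lambda>n. LINT l|lborel. F (l, n) * cis (l * t)"
  let ?P = "\<lambda>n. bracket (freq n) powr s"
  define K where "K = 2 * disp_integral b"
  have K: "K < \<infinity>" using disp_integral_finite[OF b] by (simp add: K_def ennreal_mult_less_top)
  have one: "ennreal ((?P n * cmod (?L n))\<^sup>2) \<le> K * slice_sq s b F n" for n
  proof -
    have "ennreal ((?P n * cmod (?L n))\<^sup>2) = (ennreal (?P n) * ennreal (cmod (?L n)))\<^sup>2"
      by (simp add: ennreal_power[symmetric] ennreal_mult)
    also have "\<dots> \<le> (ennreal (?P n) * (\<integral>\<^sup>+l. ennreal (cmod (F (l, n))) \<partial>lborel))\<^sup>2"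
      using norm_integral_le_nn[of lborel "\<lambda>l. F (l, n) * cis (l * t)"]
      by (intro power_mono mult_left_mono) (auto simp: norm_mult)
    also have "\<dots> \<le> K * slice_sq s b F n" unfolding K_def by (rule slice_L1) simp
    finally show ?thesis .
  qed
  have "ennreal (\<Sum>n\<in>A. (?P n * cmod (?L n))\<^sup>2) = (\<Sum>n\<in>A. ennreal ((?P n * cmod (?L n))\<^sup>2))"
    by (rule sum_ennreal[symmetric]) simp
  also have "\<dots> \<le> (\<Sum>n\<in>A. K * slice_sq s b F n)" by (intro sum_mono one)
  also have "\<dots> = K * (\<Sum>n\<in>A. slice_sq s b F n)" by (simp add: sum_distrib_left)
  also have "\<dots> \<le> K * X_sq s b F"
    unfolding X_sq_slices[OF assms(1)] by (intro mult_left_mono sum_le_nn_integral_count A) simp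
  also have "\<dots> = ennreal (enn2real K * enn2real (X_sq s b F))"
    using K fin by (simp add: ennreal_mult)
  finally have "(\<Sum>n\<in>A. (?P n * cmod (?L n))\<^sup>2) \<le> enn2real K * enn2real (X_sq s b F)"
    by (simp add: ennreal_le_iff)
  then have "L2_set (\<lambda>n. ?P n * cmod (?L n)) A \<le> sqrt (enn2real K) * X_norm s b F"
    unfolding L2_set_def X_norm_def real_sqrt_mult[symmetric] by (rule real_sqrt_le_mono)
  moreover have "hs_norm s (time_coeff F t) A = 1 / (2 * pi) ^ 3 * L2_set (\<lambda>n. ?P n * cmod (?L n)) A"
    unfolding hs_norm_def
    by (subst L2_set_right_distrib) (auto simp: time_coeff_def norm_divide norm_power norm_mult intro!: L2_set_cong)
  ultimately show "hs_norm s (time_coeff F t) A \<le> embed_const b * X_norm s b F"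
    by (simp add: embed_const_def K_def[symmetric] divide_right_mono)
qed

lemma time_test_props:
  assumes "time_test T \<phi>"
  shows "continuous_on UNIV \<phi>" "integrable lborel \<phi>" "\<exists>B. \<forall>t. cmod (\<phi> t) \<le> B" "\<And>t. t \<notin> {0<..<T} \<Longrightarrow> \<phi> t = 0"
proof -
  have "\<phi> differentiable_on UNIV"
    using assms unfolding time_test_def smooth_def by (metis empty_subsetI iter_deriv.simps(1) list.set(1))
  then show c: "continuous_on UNIV \<phi>" by (rule differentiable_imp_continuous_on)
  show z: "\<phi> t = 0" if "t \<notin> {0<..<T}" for t
    using assms that closure_subset[of "{t. \<phi> t \<noteq> 0}"] by (auto simp: time_test_def)
  have eq: "\<phi> = (\<lambda>t. indicator {0..T} t *\<^sub>R \<phi> t)"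
  proof
    fix t
    show "\<phi> t = indicator {0..T} t *\<^sub>R \<phi> t" using z[of t] by (cases "t \<in> {0<..<T}") auto
  qed
  show "integrable lborel \<phi>"
    by (subst eq, rule borel_integrable_compact) (auto intro: continuous_on_subset[OF c])
  have "compact (\<phi> ` {0..T})" by (intro compact_continuous_image continuous_on_subset[OF c]) auto
  then obtain B where B: "\<And>t. t \<in> {0..T} \<Longrightarrow> cmod (\<phi> t) \<le> B" using compact_imp_bounded bounded_iff by (metis imageI)
  have "cmod (\<phi> t) \<le> max B 0" for t
    using B[of t] z[of t] by (cases "t \<in> {0<..<T}") auto
  then show "\<exists>B. \<forall>t. cmod (\<phi> t) \<le> B" by blast
qed

lemma time_coeff_measurable [measurable]:
  assumes [measurable]: "F \<in> borel_measurable dual_measure"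
  shows "(\<lambda>t. time_coeff F t n) \<in> borel_measurable borel"
proof -
  define f where "f l = F (l, n)" for l
  have [measurable]: "f \<in> borel_measurable borel" unfolding f_def by (rule dual_slice_measurable[OF assms])
  show ?thesis unfolding time_coeff_def f_def[symmetric] by measurable
qed

text \<open>
  Both sides have the same integral against every test function, by the definition of
  \<open>restricts_to\<close> and Fubini's theorem, so the fundamental lemma applies to their
  difference.
\<close>

theorem restricts_to_time_coeff:
  assumes F [measurable]: "F \<in> borel_measurable dual_measure" and fin: "X_sq s b F < \<infinity>" and b: "1 / 2 < b" and r: "restricts_to T F v"
  shows "AE t in lborel. t \<in> {0<..<T} \<longrightarrow> v t = time_coeff F t"
proof -
  have int: "integrable lborel (\<lambda>l. F (l, n))" for n
    using X_sq_finite_integrable[OF F fin b] .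
  have bnd: "cmod (time_coeff F t n) \<le> (LINT l|lborel. cmod (F (l, n))) / (2 * pi) ^ 3" for t n
    unfolding time_coeff_def norm_divide
    by (intro divide_mono order_trans[OF integral_norm_bound]) (auto simp: norm_mult norm_power)
  have "AE t in lborel. t \<in> {0<..<T} \<longrightarrow> v t n - time_coeff F t n = 0" for n
  proof (rule fundamental_lemma)
    fix \<phi> assume \<phi>: "time_test T \<phi>"
    note p = time_test_props[OF \<phi>]
    have [measurable]: "\<phi> \<in> borel_measurable borel" using p(2) by auto
    have v: "integrable lborel (\<lambda>t. v t n * \<phi> t)" 
      "(LINT t|lborel. v t n * \<phi> t) = (LINT l|lborel. F (l, n) * (LINT t|lborel. \<phi> t * cis (l * t))) / of_real ((2 * pi) ^ 3)"
      using r \<phi> unfolding restricts_to_def by blast+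
    have tc: "integrable lborel (\<lambda>t. time_coeff F t n * \<phi> t)"
    proof (rule Bochner_Integration.integrable_bound)
      show "integrable lborel (\<lambda>t. of_real ((LINT l|lborel. cmod (F (l, n))) / (2 * pi) ^ 3) * \<phi> t)"
        using p(2) by (rule integrable_mult_right)
      show "AE t in lborel. norm (time_coeff F t n * \<phi> t) \<le> norm (of_real ((LINT l|lborel. cmod (F (l, n))) / (2 * pi) ^ 3) * \<phi> t)"
        unfolding norm_mult norm_of_real using bnd[of _ n]
        by (intro AE_I2 mult_right_mono order_trans[OF bnd abs_ge_self]) auto
    qed measurable
    have "(LINT t|lborel. time_coeff F t n * \<phi> t) = (LINT t|lborel. \<phi> t * (LINT l|lborel. F (l, n) * cis (1 * (t * l)))) / of_real ((2 * pi) ^ 3)"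
      by (subst integral_divide_zero[symmetric]) (simp add: time_coeff_def mult_ac)
    also have "(LINT t|lborel. \<phi> t * (LINT l|lborel. F (l, n) * cis (1 * (t * l)))) = (LINT l|lborel. F (l, n) * (LINT t|lborel. \<phi> t * cis (1 * (t * l))))"
      by (rule swap_cis[OF p(2) int])
    finally have "(LINT t|lborel. time_coeff F t n * \<phi> t) = (LINT t|lborel. v t n * \<phi> t)"
      unfolding v(2) by (simp add: mult_ac)
    then show "(LINT t|lborel. (v t n - time_coeff F t n) * \<phi> t) = 0"
      unfolding left_diff_distrib using v(1) tc by simp
    show "integrable lborel (\<lambda>t. (v t n - time_coeff F t n) * \<phi> t)"
      unfolding left_diff_distrib using v(1) tc by simp
  qed
  then have "AE t in lborel. \<forall>n. t \<in> {0<..<T} \<longrightarrow> v t n - time_coeff F t n = 0"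
    unfolding AE_all_countable by blast
  then show ?thesis by eventually_elim auto
qed

section \<open>Schwartz functions with finitely many spatial frequencies\<close>

text \<open>
  Finite sums of functions of time times exponentials in space. They are the Schwartz functions
  used as approximants; the coefficients \<open>c\<close> absorb the spatial derivatives.
\<close>

definition trig_wave :: "(int \<times> int) set \<Rightarrow> (int \<times> int \<Rightarrow> complex) \<Rightarrow> (int \<times> int \<Rightarrow> real \<Rightarrow> complex) \<Rightarrow> real \<times> real \<times> real \<Rightarrow> complex" where
  "trig_wave A c D z = (\<Sum>n\<in>A. c n * (D n (fst z) * cis (freq n \<bullet> snd z)))"

lemma trig_wave_derivative:
  assumes D: "\<And>n. n \<in> A \<Longrightarrow> deriv_chain (D n)"
  shows "(trig_wave A c (\<lambda>n. D n j) has_derivative (\<lambda>h. \<Sum>n\<in>A. c n * (D n j (fst z) * (cis (freq n \<bullet> snd z) * (\<i> * of_real (freq n \<bullet> snd h))) + (fst h *\<^sub>R D n (Suc j) (fst z)) * cis (freq n \<bullet> snd z)))) (at z)"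
proof -
  have 1: "((\<lambda>z. D n j (fst z)) has_derivative (\<lambda>h. fst h *\<^sub>R D n (Suc j) (fst z))) (at z)" if "n \<in> A" for n
  proof -
    have "(D n j has_derivative (\<lambda>h. h *\<^sub>R D n (Suc j) (fst z))) (at (fst z))"
      using D[OF that] by (simp add: deriv_chain_def has_vector_derivative_def)
    then show ?thesis
      by (rule has_derivative_compose[rotated]) (rule has_derivative_fst[OF has_derivative_ident])
  qed
  have 2: "((\<lambda>z. cis (freq n \<bullet> snd z)) has_derivative (\<lambda>h. cis (freq n \<bullet> snd z) * (\<i> * of_real (freq n \<bullet> snd h)))) (at z)" for n
  proof -
    have "((\<lambda>z. \<i> * complex_of_real (freq n \<bullet> snd z)) has_derivative (\<lambda>h. \<i> * of_real (freq n \<bullet> snd h))) (at z)"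
      by (intro has_derivative_mult_right has_derivative_of_real has_derivative_inner_right has_derivative_snd has_derivative_ident)
    from has_derivative_compose[OF this DERIV_exp[unfolded has_field_derivative_def]]
    show ?thesis by (simp add: cis_conv_exp)
  qed
  show ?thesis
    unfolding trig_wave_def
    by (intro has_derivative_sum has_derivative_mult_right has_derivative_mult 1 2)
qed

text \<open>
  All terms are differentiated in the same directions, so a single \<open>j\<close> counts the
  time derivatives of all of them.
\<close>

lemma trig_wave_iter_deriv:
  assumes D: "\<And>n. n \<in> A \<Longrightarrow> deriv_chain (D n)" and "set bs \<subseteq> Basis"
  shows "\<exists>c j. iter_deriv bs (trig_wave A (\<lambda>_. 1) (\<lambda>n. D n 0)) = trig_wave A c (\<lambda>n. D n j)"
  using assms(2)
proof (induction bs)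
  case (Cons b bs)
  then obtain c j where IH: "iter_deriv bs (trig_wave A (\<lambda>_. 1) (\<lambda>n. D n 0)) = trig_wave A c (\<lambda>n. D n j)" by auto
  have fd: "frechet_derivative (trig_wave A c (\<lambda>n. D n j)) (at z) b = (\<Sum>n\<in>A. c n * (D n j (fst z) * (cis (freq n \<bullet> snd z) * (\<i> * of_real (freq n \<bullet> snd b))) + (fst b *\<^sub>R D n (Suc j) (fst z)) * cis (freq n \<bullet> snd z)))" for z
    using frechet_derivative_at[OF trig_wave_derivative[OF D], symmetric] by simp
  have "b \<in> Basis" using Cons by simp
  then consider "fst b = 1" "snd b = 0" | "fst b = 0" by (auto simp: Basis_prod_def)
  then show ?case
  proof cases
    case 1
    then have "iter_deriv (b # bs) (trig_wave A (\<lambda>_. 1) (\<lambda>n. D n 0)) = trig_wave A c (\<lambda>n. D n (Suc j))"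
      by (simp add: IH fd fun_eq_iff trig_wave_def)
    then show ?thesis by blast
  next
    case 2
    then have "iter_deriv (b # bs) (trig_wave A (\<lambda>_. 1) (\<lambda>n. D n 0)) = trig_wave A (\<lambda>n. c n * (\<i> * of_real (freq n \<bullet> snd b))) (\<lambda>n. D n j)"
      by (simp add: IH fd fun_eq_iff trig_wave_def mult_ac)
    then show ?thesis by blast
  qed
qed auto

lemma deriv_chain_bounded:
  assumes D: "deriv_chain D" and van: "\<And>k x. R < \<bar>x\<bar> \<Longrightarrow> D k x = 0"
  shows "\<exists>B. \<forall>t. cmod (of_real t ^ k * D j t) \<le> B"
proof -
  have "compact ((\<lambda>t. of_real t ^ k * D j t) ` {-R..R})"
    by (intro compact_continuous_image continuous_intros deriv_chain_continuous D) auto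
  then have "bounded ((\<lambda>t. of_real t ^ k * D j t) ` {-R..R})" by (rule compact_imp_bounded)
  then obtain B where B: "\<And>t. t \<in> {-R..R} \<Longrightarrow> cmod (of_real t ^ k * D j t) \<le> B"
    unfolding bounded_iff by blast
  have "cmod (of_real t ^ k * D j t) \<le> max B 0" for t
  proof (cases "R < \<bar>t\<bar>")
    case True
    then show ?thesis by (simp add: van)
  next
    case False
    then have "t \<in> {-R..R}" by auto
    then show ?thesis using B[of t] by simp
  qed
  then show ?thesis by blast
qed

lemma trig_wave_schwartz:
  assumes D: "\<And>n. n \<in> A \<Longrightarrow> deriv_chain (D n)" and van: "\<And>n k x. n \<in> A \<Longrightarrow> R n < \<bar>x\<bar> \<Longrightarrow> D n k x = 0"
  shows "schwartz (trig_wave A (\<lambda>_. 1) (\<lambda>n. D n 0))"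
  unfolding schwartz_def
proof (intro conjI allI impI)
  fix t x y :: real
  have per: "cis (freq n \<bullet> (x + 2 * pi, y)) = cis (freq n \<bullet> (x, y))" "cis (freq n \<bullet> (x, y + 2 * pi)) = cis (freq n \<bullet> (x, y))" for n
    using cis_int_period[of "- n" x y] by (simp_all add: freq_minus)
  show "trig_wave A (\<lambda>_. 1) (\<lambda>n. D n 0) (t, x + 2 * pi, y) = trig_wave A (\<lambda>_. 1) (\<lambda>n. D n 0) (t, x, y)"
    "trig_wave A (\<lambda>_. 1) (\<lambda>n. D n 0) (t, x, y + 2 * pi) = trig_wave A (\<lambda>_. 1) (\<lambda>n. D n 0) (t, x, y)"
    by (simp_all only: trig_wave_def snd_conv fst_conv per)
next
  show "smooth (trig_wave A (\<lambda>_. 1) (\<lambda>n. D n 0))"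
    unfolding smooth_def
  proof (intro allI impI)
    fix bs :: "(real \<times> real \<times> real) list" assume "set bs \<subseteq> Basis"
    then obtain c j where eq: "iter_deriv bs (trig_wave A (\<lambda>_. 1) (\<lambda>n. D n 0)) = trig_wave A c (\<lambda>n. D n j)"
      using trig_wave_iter_deriv[of A D bs] D by blast
    show "iter_deriv bs (trig_wave A (\<lambda>_. 1) (\<lambda>n. D n 0)) differentiable_on UNIV"
      unfolding eq differentiable_on_def differentiable_def
      using has_derivative_at_withinI[OF trig_wave_derivative[of A D, OF D]] by blast
  qed
next
  fix bs :: "(real \<times> real \<times> real) list" and k assume "set bs \<subseteq> Basis"
  then obtain c j where eq: "iter_deriv bs (trig_wave A (\<lambda>_. 1) (\<lambda>n. D n 0)) = trig_wave A c (\<lambda>n. D n j)"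
    using trig_wave_iter_deriv[of A D bs] D by blast
  have "\<exists>B. \<forall>t. cmod (of_real t ^ k * D n j t) \<le> B" if "n \<in> A" for n
    using deriv_chain_bounded[OF D[OF that] van[OF that]] by blast
  then obtain B where B: "\<And>n t. n \<in> A \<Longrightarrow> cmod (of_real t ^ k * D n j t) \<le> B n" by metis
  have "cmod (of_real (fst z) ^ k * trig_wave A c (\<lambda>n. D n j) z) \<le> (\<Sum>n\<in>A. cmod (c n) * B n)" for z
  proof -
    have "of_real (fst z) ^ k * trig_wave A c (\<lambda>n. D n j) z = (\<Sum>n\<in>A. c n * ((of_real (fst z) ^ k * D n j (fst z)) * cis (freq n \<bullet> snd z)))"
      by (simp add: trig_wave_def sum_distrib_left mult_ac)
    also have "cmod \<dots> \<le> (\<Sum>n\<in>A. cmod (c n * ((of_real (fst z) ^ k * D n j (fst z)) * cis (freq n \<bullet> snd z))))"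
      by (rule norm_sum)
    also have "\<dots> = (\<Sum>n\<in>A. cmod (c n) * cmod (of_real (fst z) ^ k * D n j (fst z)))"
      by (simp only: norm_mult[of "c _"] norm_mult[of _ "cis _"] norm_cis mult_1_right)
    also have "\<dots> \<le> (\<Sum>n\<in>A. cmod (c n) * B n)"
      by (intro sum_mono mult_left_mono B) auto
    finally show ?thesis .
  qed
  then show "bounded (range (\<lambda>z. of_real (fst z) ^ k * iter_deriv bs (trig_wave A (\<lambda>_. 1) (\<lambda>n. D n 0)) z))"
    unfolding eq by (intro boundedI[where B="\<Sum>n\<in>A. cmod (c n) * B n"]) auto
qed

lemma trig_wave_st_fourier:
  assumes "finite A" and D: "\<And>n. n \<in> A \<Longrightarrow> integrable lborel (D n)"
  shows "st_fourier (trig_wave A (\<lambda>_. 1) D) (l, n) = (if n \<in> A then of_real torus_area * ft (D n) l else 0)"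
proof -
  let ?e = "\<lambda>m x. indicator torus x *\<^sub>R cis (- (freq (n - m) \<bullet> x))"
  let ?d = "\<lambda>m t. D m t * cis (- (l * t))"
  have e: "integrable lborel (?e m)" "(LINT x|lborel. ?e m x) = (if n = m then of_real torus_area else 0)" for m
  proof -
    show "integrable lborel (?e m)"
      unfolding torus_def by (rule borel_integrable_compact) (auto intro!: continuous_intros)
    have "(LINT x|lborel. ?e m x) = (LINT x|torus_measure. cis (- (freq (n - m) \<bullet> x)))"
      unfolding torus_measure_def by (rule integral_restrict_space[symmetric]) simp
    then show "(LINT x|lborel. ?e m x) = (if n = m then of_real torus_area else 0)"
      by (simp add: integral_cis_torus)
  qed
  have d: "integrable lborel (?d m)" if "m \<in> A" for m
    using D[OF that] by (intro integrable_mult_cis) auto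
  have eq: "indicator (UNIV \<times> torus) z *\<^sub>R (case z of (t, x) \<Rightarrow> trig_wave A (\<lambda>_. 1) D (t, x) * cis (- (l * t + freq n \<bullet> x)))
     = (\<Sum>m\<in>A. ?d m (fst z) * ?e m (snd z))" for z
  proof -
    obtain t x where z: "z = (t, x)" by (cases z)
    have c: "cis (freq m \<bullet> x) * cis (- (l * t + freq n \<bullet> x)) = cis (- (l * t)) * cis (- (freq (n - m) \<bullet> x))" for m
      by (simp add: cis_mult freq_diff inner_diff_left algebra_simps)
    have "trig_wave A (\<lambda>_. 1) D (t, x) * cis (- (l * t + freq n \<bullet> x)) = (\<Sum>m\<in>A. D m t * (cis (freq m \<bullet> x) * cis (- (l * t + freq n \<bullet> x))))"
      by (simp add: trig_wave_def sum_distrib_right mult.assoc)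
    also have "\<dots> = (\<Sum>m\<in>A. ?d m t * cis (- (freq (n - m) \<bullet> x)))"
      unfolding c by (simp add: mult.assoc)
    finally show ?thesis
      by (simp add: z indicator_times scaleR_sum_right mult_ac)
  qed
  have "st_fourier (trig_wave A (\<lambda>_. 1) D) (l, n) = (LINT z|(lborel \<Otimes>\<^sub>M lborel). (\<Sum>m\<in>A. ?d m (fst z) * ?e m (snd z)))"
    unfolding st_fourier_def set_lebesgue_integral_def prod.case eq lborel_prod ..
  also have "\<dots> = (\<Sum>m\<in>A. (LINT z|(lborel \<Otimes>\<^sub>M lborel). ?d m (fst z) * ?e m (snd z)))"
    by (intro Bochner_Integration.integral_sum lborel_pair.integral_tensor d e)
  also have "\<dots> = (\<Sum>m\<in>A. ft (D m) l * (if n = m then of_real torus_area else 0))"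
    by (intro sum.cong refl) (subst lborel_pair.integral_tensor(2)[OF d e(1)], auto simp: e(2) ft_def)
  also have "\<dots> = (\<Sum>m\<in>A. if n = m then of_real torus_area * ft (D n) l else 0)"
    by (intro sum.cong refl) auto
  finally show ?thesis using assms(1) by (simp add: sum.delta)
qed

section \<open>Extending a bounded flow to the whole line\<close>

text \<open>
  The space-time transform of \<open>q\<close>. Fourier coefficients on the torus carry the factor
  \<open>(2\<pi>)\<^sup>-\<^sup>2\<close> and the space-time transform does not, which accounts
  for the area.
\<close>

definition flow_ft :: "(real \<Rightarrow> torus_distr) \<Rightarrow> real \<times> int \<times> int \<Rightarrow> complex" where
  "flow_ft q = (\<lambda>(l, n). of_real torus_area * ft (\<lambda>t. q t n) l)"

text \<open>
  Monotone convergence along growing boxes.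
\<close>

lemma hs_bounded_nn:
  assumes "hs_bounded s K g"
  shows "(\<integral>\<^sup>+n. ennreal ((bracket (freq n) powr s * cmod (g n))\<^sup>2) \<partial>count_space UNIV) \<le> ennreal (K\<^sup>2)"
proof -
  let ?f = "\<lambda>n. ennreal ((bracket (freq n) powr s * cmod (g n))\<^sup>2)"
  have "(\<integral>\<^sup>+n. ?f n \<partial>count_space UNIV) = (\<integral>\<^sup>+n. (SUP J. ?f n * indicator (freq_box J) n) \<partial>count_space UNIV)"
  proof (intro nn_integral_cong antisym)
    fix n
    obtain J where J: "{n} \<subseteq> freq_box J" using freq_box_exhausts[of "{n}"] by blast
    show "?f n \<le> (SUP J. ?f n * indicator (freq_box J) n)"
      by (rule SUP_upper2[of J]) (use J in auto)
    show "(SUP J. ?f n * indicator (freq_box J) n) \<le> ?f n"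
      by (rule SUP_least) (auto simp: indicator_def)
  qed
  also have "\<dots> = (SUP J. (\<integral>\<^sup>+n. ?f n * indicator (freq_box J) n \<partial>count_space UNIV))"
  proof (rule nn_integral_monotone_convergence_SUP)
    show "incseq (\<lambda>J n. ?f n * indicator (freq_box J) n)"
      using freq_box_mono by (auto simp: incseq_def le_fun_def indicator_def)
  qed simp
  also have "\<dots> \<le> ennreal (K\<^sup>2)"
  proof (rule SUP_least)
    fix J
    have "(\<integral>\<^sup>+n. ?f n * indicator (freq_box J) n \<partial>count_space UNIV) = (\<Sum>n\<in>freq_box J. ?f n)"
      by (subst nn_integral_count_space_indicator[symmetric]) (auto simp: nn_integral_count_space_finite)
    also have "\<dots> = ennreal (\<Sum>n\<in>freq_box J. (bracket (freq n) powr s * cmod (g n))\<^sup>2)"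
      by (rule sum_ennreal) simp
    also have "\<dots> \<le> ennreal (K\<^sup>2)"
    proof (rule ennreal_leI)
      have "hs_norm s g (freq_box J) \<le> K" using assms by (simp add: hs_bounded_def)
      then show "(\<Sum>n\<in>freq_box J. (bracket (freq n) powr s * cmod (g n))\<^sup>2) \<le> K\<^sup>2"
        unfolding hs_norm_def L2_set_def using sqrt_le_D by blast
    qed
    finally show "(\<integral>\<^sup>+n. ?f n * indicator (freq_box J) n \<partial>count_space UNIV) \<le> ennreal (K\<^sup>2)" .
  qed
  finally show ?thesis .
qed

lemma X_weight_le:
  assumes "b \<le> 0"
  shows "0 \<le> X_weight s b (l, n)" "X_weight s b (l, n) \<le> bracket (freq n) powr s"
proof -
  have "bracket (\<bar>l\<bar> - bracket (freq n)) powr b \<le> 1"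
    using powr_mono[OF assms bracket_ge_1[of "\<bar>l\<bar> - bracket (freq n)"]] by simp
  then show "0 \<le> X_weight s b (l, n)" "X_weight s b (l, n) \<le> bracket (freq n) powr s"
    by (auto simp: X_weight_def intro: mult_left_le)
qed

text \<open>
  For \<open>b \<le> 0\<close> the modulation weight is at most \<open>1\<close>; what is left is
  Bessel's inequality.
\<close>

lemma slice_ft:
  assumes f: "integrable lborel f" and b: "b \<le> 0"
  shows "(\<integral>\<^sup>+l. ennreal ((X_weight s b (l, n) * cmod (of_real torus_area * ft f l))\<^sup>2) \<partial>lborel)
     \<le> ennreal (torus_area\<^sup>2 * (2 * pi)) * (\<integral>\<^sup>+t. ennreal ((bracket (freq n) powr s * cmod (f t))\<^sup>2) \<partial>lborel)"
proof -
  have [measurable]: "f \<in> borel_measurable borel" using f by auto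
  have [measurable]: "ft f \<in> borel_measurable borel" using f by simp
  let ?P = "bracket (freq n) powr s"
  have "(\<integral>\<^sup>+l. ennreal ((X_weight s b (l, n) * cmod (of_real torus_area * ft f l))\<^sup>2) \<partial>lborel)
     \<le> (\<integral>\<^sup>+l. ennreal ((?P * torus_area)\<^sup>2) * ennreal ((cmod (ft f l))\<^sup>2) \<partial>lborel)"
  proof (rule nn_integral_mono)
    fix l
    have "X_weight s b (l, n) * cmod (of_real torus_area * ft f l) \<le> ?P * (torus_area * cmod (ft f l))"
      using X_weight_le[OF b, of s l n] by (simp add: norm_mult mult_right_mono)
    then have "(X_weight s b (l, n) * cmod (of_real torus_area * ft f l))\<^sup>2 \<le> (?P * (torus_area * cmod (ft f l)))\<^sup>2"
      using X_weight_le[OF b, of s l n] by (intro power_mono) auto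
    also have "\<dots> = (?P * torus_area)\<^sup>2 * (cmod (ft f l))\<^sup>2" by (simp add: power_mult_distrib)
    finally show "ennreal ((X_weight s b (l, n) * cmod (of_real torus_area * ft f l))\<^sup>2) \<le> ennreal ((?P * torus_area)\<^sup>2) * ennreal ((cmod (ft f l))\<^sup>2)"
      by (subst ennreal_mult[symmetric]) (auto intro: ennreal_leI)
  qed
  also have "\<dots> = ennreal ((?P * torus_area)\<^sup>2) * l2_sq (\<lambda>l. ft f l)"
    by (rule nn_integral_cmult) measurable
  also have "\<dots> \<le> ennreal ((?P * torus_area)\<^sup>2) * (ennreal (2 * pi) * l2_sq f)"
    by (intro mult_left_mono ft_bessel f) simp
  also have "\<dots> = ennreal (torus_area\<^sup>2 * (2 * pi)) * (ennreal (?P\<^sup>2) * l2_sq f)"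
  proof -
    have "ennreal ((?P * torus_area)\<^sup>2) * ennreal (2 * pi) = ennreal (torus_area\<^sup>2 * (2 * pi)) * ennreal (?P\<^sup>2)"
      by (subst (1 2) ennreal_mult[symmetric]) (simp_all add: power_mult_distrib mult_ac)
    then show ?thesis by (simp only: mult.assoc[symmetric])
  qed
  also have "ennreal (?P\<^sup>2) * l2_sq f = (\<integral>\<^sup>+t. ennreal ((?P * cmod (f t))\<^sup>2) \<partial>lborel)"
    by (subst nn_integral_cmult[symmetric]) (auto simp: power_mult_distrib ennreal_mult)
  finally show ?thesis .
qed

text \<open>
  A flow on the torus that is measurable in time, lives on \<open>[0, T]\<close> and is bounded by
  \<open>K\<close> in \<open>H\<^sup>s\<close>. The product of the theorem is of this kind with
  \<open>s - 1\<close> in place of \<open>s\<close>.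
\<close>

locale bounded_flow =
  fixes q :: "real \<Rightarrow> torus_distr" and s K T :: real
  assumes q_meas [measurable]: "\<And>n. (\<lambda>t. q t n) \<in> borel_measurable borel"
    and q_supp: "\<And>t n. t \<notin> {0..T} \<Longrightarrow> q t n = 0"
    and q_bound: "AE t in lborel. t \<in> {0..T} \<longrightarrow> hs_bounded s K (q t)"
    and T_nonneg: "0 \<le> T" and K_nonneg: "0 \<le> K"
begin

lemma q_coeff_bound: "AE t in lborel. bracket (freq n) powr s * cmod (q t n) \<le> K * indicator {0..T} t"
  using q_bound
proof eventually_elim
  case (elim t)
  show ?case
  proof (cases "t \<in> {0..T}")
    case True
    then have "hs_norm s (q t) {n} \<le> K" using elim by (simp add: hs_bounded_def)
    then show ?thesis using True by (simp add: hs_norm_def)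
  qed (simp add: q_supp)
qed

lemma q_coeff_abs_bound: "AE t in lborel. cmod (q t n) \<le> K * bracket (freq n) powr (- s) * indicator {0..T} t"
  using q_coeff_bound[of n]
proof eventually_elim
  case (elim t)
  then have "bracket (freq n) powr (- s) * (bracket (freq n) powr s * cmod (q t n)) \<le> bracket (freq n) powr (- s) * (K * indicator {0..T} t)"
    by (intro mult_left_mono) auto
  then show ?case by (simp add: mult.assoc[symmetric] powr_add[symmetric]) (simp add: mult_ac)
qed

lemma q_integrable: "integrable lborel (\<lambda>t. q t n)"
proof (rule Bochner_Integration.integrable_bound)
  show "integrable lborel (\<lambda>t. K * bracket (freq n) powr (- s) * indicator {0..T} t)"
    using T_nonneg by (intro integrable_mult_right) (simp add: integrable_indicator_iff)
  show "AE t in lborel. norm (q t n) \<le> norm (K * bracket (freq n) powr (- s) * indicator {0..T} t)"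
    using q_coeff_abs_bound[of n] by eventually_elim (use K_nonneg in \<open>auto simp: abs_mult\<close>)
qed measurable

lemma q_L2: "l2_sq (\<lambda>t. q t n) < \<infinity>"
proof -
  have "l2_sq (\<lambda>t. q t n) \<le> (\<integral>\<^sup>+t. ennreal ((K * bracket (freq n) powr (- s))\<^sup>2) * indicator {0..T} t \<partial>lborel)"
  proof (rule nn_integral_mono_AE)
    show "AE t in lborel. ennreal ((cmod (q t n))\<^sup>2) \<le> ennreal ((K * bracket (freq n) powr (- s))\<^sup>2) * indicator {0..T} t"
      using q_coeff_abs_bound[of n]
      by eventually_elim (auto simp: indicator_def split: if_splits intro!: ennreal_leI power_mono)
  qed
  also have "\<dots> < \<infinity>" using T_nonneg by (simp add: nn_integral_cmult ennreal_mult_less_top)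
  finally show ?thesis .
qed

lemma flow_ft_measurable [measurable]: "flow_ft q \<in> borel_measurable dual_measure"
  by (rule dual_measurableI) (simp add: flow_ft_def q_integrable)

lemma q_slice: "b \<le> 0 \<Longrightarrow> slice_sq s b (flow_ft q) n \<le> ennreal (torus_area\<^sup>2 * (2 * pi)) * (\<integral>\<^sup>+t. ennreal ((bracket (freq n) powr s * cmod (q t n))\<^sup>2) \<partial>lborel)"
  unfolding slice_sq_def flow_ft_def prod.case by (rule slice_ft[OF q_integrable])

text \<open>
  Sum the bounds of the slices and exchange sum and integral; the length of the interval gives the
  factor \<open>T\<close>.
\<close>

lemma q_X_sq:
  assumes b: "b \<le> 0"
  shows "X_sq s b (flow_ft q) \<le> ennreal (torus_area\<^sup>2 * (2 * pi) * T * K\<^sup>2)"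
proof -
  interpret C: sigma_finite_measure "count_space (UNIV :: (int \<times> int) set)"
    by (rule sigma_finite_measure_count_space_countable) simp
  interpret P: pair_sigma_finite "count_space (UNIV :: (int \<times> int) set)" "lborel :: real measure" ..
  let ?h = "\<lambda>n t. ennreal ((bracket (freq n) powr s * cmod (q t n))\<^sup>2)"
  have [measurable]: "(\<lambda>(n, t). ?h n t) \<in> borel_measurable (count_space UNIV \<Otimes>\<^sub>M lborel)"
    by (rule measurable_pair_measure_countable1) auto
  have "X_sq s b (flow_ft q) \<le> (\<integral>\<^sup>+n. ennreal (torus_area\<^sup>2 * (2 * pi)) * (\<integral>\<^sup>+t. ?h n t \<partial>lborel) \<partial>count_space UNIV)"
    unfolding X_sq_slices[OF flow_ft_measurable] by (intro nn_integral_mono q_slice b)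
  also have "\<dots> = ennreal (torus_area\<^sup>2 * (2 * pi)) * (\<integral>\<^sup>+n. (\<integral>\<^sup>+t. ?h n t \<partial>lborel) \<partial>count_space UNIV)"
    by (rule nn_integral_cmult) simp
  also have "(\<integral>\<^sup>+n. (\<integral>\<^sup>+t. ?h n t \<partial>lborel) \<partial>count_space UNIV) = (\<integral>\<^sup>+t. (\<integral>\<^sup>+n. ?h n t \<partial>count_space UNIV) \<partial>lborel)"
    by (rule P.Fubini'[symmetric]) measurable
  also have "\<dots> \<le> (\<integral>\<^sup>+t. ennreal (K\<^sup>2) * indicator {0..T} t \<partial>lborel)"
  proof (rule nn_integral_mono_AE)
    show "AE t in lborel. (\<integral>\<^sup>+n. ?h n t \<partial>count_space UNIV) \<le> ennreal (K\<^sup>2) * indicator {0..T} t"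
      using q_bound
    proof eventually_elim
      case (elim t)
      show ?case
      proof (cases "t \<in> {0..T}")
        case True
        then show ?thesis using elim hs_bounded_nn[of s K "q t"] by simp
      qed (simp add: q_supp)
    qed
  qed
  also have "\<dots> = ennreal (K\<^sup>2) * ennreal T" using T_nonneg by (simp add: nn_integral_cmult)
  finally have "X_sq s b (flow_ft q) \<le> ennreal (torus_area\<^sup>2 * (2 * pi)) * (ennreal (K\<^sup>2) * ennreal T)"
    by (simp add: mult_left_mono)
  also have "\<dots> = ennreal (torus_area\<^sup>2 * (2 * pi) * T * K\<^sup>2)"
    using T_nonneg by (simp add: ennreal_mult mult_ac)
  finally show ?thesis .
qed

lemma q_restricts_to: "restricts_to T (flow_ft q) q"
  unfolding restricts_to_def
proof (intro allI impI conjI)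
  fix n \<phi> assume \<phi>: "time_test T \<phi>"
  note p = time_test_props[OF \<phi>]
  obtain B where B: "\<And>t. cmod (\<phi> t) \<le> B" using p(3) by blast
  have [measurable]: "\<phi> \<in> borel_measurable borel" using p(2) by auto
  show "integrable lborel (\<lambda>t. q t n * \<phi> t)"
  proof (rule Bochner_Integration.integrable_bound)
    show "integrable lborel (\<lambda>t. of_real B * q t n)" by (intro integrable_mult_right q_integrable)
    show "AE t in lborel. norm (q t n * \<phi> t) \<le> norm (of_real B * q t n)"
    proof (rule AE_I2)
      fix t
      have "cmod (\<phi> t) \<le> \<bar>B\<bar>" using B[of t] by simp
      then show "norm (q t n * \<phi> t) \<le> norm (of_real B * q t n)"
        by (simp add: norm_mult mult.commute[of "cmod (q t n)"] mult_right_mono)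
    qed
  qed measurable
  have "(LINT l|lborel. flow_ft q (l, n) * (LINT t|lborel. \<phi> t * cis (l * t))) = (LINT l|lborel. of_real torus_area * (ft (\<lambda>t. q t n) l * ft \<phi> (- l)))"
    by (simp add: flow_ft_def ft_def mult.assoc)
  also have "\<dots> = of_real torus_area * (LINT l|lborel. ft (\<lambda>t. q t n) l * ft \<phi> (- l))"
    by (rule integral_mult_right_zero)
  also have "\<dots> = of_real torus_area * (2 * pi * (LINT t|lborel. q t n * \<phi> t))"
    by (simp only: ft_parseval[OF q_integrable q_L2 p(2) p(1) B])
  finally show "(LINT t|lborel. q t n * \<phi> t) = (LINT l|lborel. flow_ft q (l, n) * (LINT t|lborel. \<phi> t * cis (l * t))) / of_real ((2 * pi) ^ 3)"
    by (simp add: torus_area_def power2_eq_square power3_eq_cube)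
qed

text \<open>
  Frequencies outside a large box contribute little, as the norm is finite. Each of the finitely
  many remaining coefficients is close in \<open>L\<^sup>2\<close> to a smooth function with
  compact support, and by \<open>slice_ft\<close> the Fourier transforms are then close in the
  norm.
\<close>

lemma q_X_space:
  assumes b: "b \<le> 0"
  shows "flow_ft q \<in> X_space s b"
  unfolding X_space_def
proof (intro CollectI conjI allI impI)
  show "flow_ft q \<in> borel_measurable dual_measure" by measurable
  show fin: "X_sq s b (flow_ft q) < \<infinity>" using q_X_sq[OF b] by (rule le_less_trans) simp
  fix e :: real assume e: "0 < e"
  let ?G = "slice_sq s b (flow_ft q)"
  have "(\<lambda>J. \<integral>\<^sup>+n. ?G n * indicator (- freq_box J) n \<partial>count_space UNIV) \<longlonglongrightarrow> (\<integral>\<^sup>+n. 0 \<partial>count_space (UNIV :: (int \<times> int) set))"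
  proof (rule nn_integral_dominated_convergence[where w="?G"])
    show "(\<integral>\<^sup>+n. ?G n \<partial>count_space UNIV) < \<infinity>" using fin by (simp add: X_sq_slices)
    show "AE n in count_space UNIV. (\<lambda>J. ?G n * indicator (- freq_box J) n) \<longlonglongrightarrow> 0"
    proof (rule AE_I2)
      fix n :: "int \<times> int"
      obtain J where J: "{n} \<subseteq> freq_box J" using freq_box_exhausts[of "{n}"] by blast
      have "\<forall>\<^sub>F k in sequentially. 0 = ?G n * indicator (- freq_box k) n"
        using eventually_ge_at_top[of J] by eventually_elim (use J freq_box_mono in \<open>auto simp: indicator_def\<close>)
      then show "(\<lambda>J. ?G n * indicator (- freq_box J) n) \<longlonglongrightarrow> 0" by (rule Lim_transform_eventually[OF tendsto_const])
    qed
  qed (auto simp: indicator_def)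
  then have "(\<lambda>J. \<integral>\<^sup>+n. ?G n * indicator (- freq_box J) n \<partial>count_space UNIV) \<longlonglongrightarrow> 0" by simp
  moreover have "0 < ennreal (e / 2)" using e by simp
  ultimately have "\<forall>\<^sub>F J in sequentially. (\<integral>\<^sup>+n. ?G n * indicator (- freq_box J) n \<partial>count_space UNIV) < ennreal (e / 2)"
    by (rule order_tendstoD(2))
  then obtain J where J: "(\<integral>\<^sup>+n. ?G n * indicator (- freq_box J) n \<partial>count_space UNIV) < ennreal (e / 2)"
    by (auto simp: eventually_sequentially)
  let ?A = "freq_box J"
  define C where "C n = torus_area\<^sup>2 * (2 * pi) * (bracket (freq n) powr s)\<^sup>2" for n
  \<comment> \<open>Any positive number that is at least the number of frequencies in the box would do.\<close>
  define N where "N = real (card ?A) + 1"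
  have C: "0 < C n" for n by (simp add: C_def)
  have N: "0 < N" by (simp add: N_def)
  have "\<exists>D R. deriv_chain D \<and> (\<forall>k x. R < \<bar>x\<bar> \<longrightarrow> D k x = 0) \<and> l2_sq (\<lambda>t. q t n - D 0 t) < ennreal (e / (2 * N * C n))" for n
  proof -
    have "l2_approx (\<lambda>t. q t n)"
    \<comment> \<open>Any bounded open interval around \<open>[0, T]\<close> would do.\<close>
    proof (rule l2_approx_supported[where c="-1" and d="T + 1"])
      show "q x n = 0" if "x \<notin> {-1<..<T + 1}" for x using that by (intro q_supp) auto
    qed (use q_L2 in auto)
    moreover have "0 < e / (2 * N * C n)" using e N C by simp
    ultimately show ?thesis unfolding l2_approx_def by blast
  qed
  then obtain D R where D: "\<And>n. deriv_chain (D n)" "\<And>n k x. R n < \<bar>x\<bar> \<Longrightarrow> D n k x = 0"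
    "\<And>n. l2_sq (\<lambda>t. q t n - D n 0 t) < ennreal (e / (2 * N * C n))"
    by metis
  have Dint: "integrable lborel (D n 0)" for n
  proof -
    have "D n 0 = (\<lambda>t. indicator {- R n..R n} t *\<^sub>R D n 0 t)" using D(2)[of n _ 0] by (force simp: indicator_def)
    moreover have "integrable lborel (\<lambda>t. indicator {- R n..R n} t *\<^sub>R D n 0 t)"
      by (rule borel_integrable_compact) (auto intro: deriv_chain_continuous D)
    ultimately show ?thesis by simp
  qed
  define \<phi> where "\<phi> = trig_wave ?A (\<lambda>_. 1) (\<lambda>n. D n 0)"
  have sch: "schwartz \<phi>" unfolding \<phi>_def by (rule trig_wave_schwartz[of _ _ R]) (use D in auto)
  have st: "st_fourier \<phi> (l, n) = (if n \<in> ?A then of_real torus_area * ft (D n 0) l else 0)" for l n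
    unfolding \<phi>_def by (rule trig_wave_st_fourier) (use Dint in auto)
  let ?F = "\<lambda>z. flow_ft q z - st_fourier \<phi> z"
  have [measurable]: "st_fourier \<phi> \<in> borel_measurable dual_measure"
    by (rule dual_measurableI) (simp add: st Dint)
  have slice: "slice_sq s b ?F n \<le> ennreal (e / (2 * N)) * indicator ?A n + ?G n * indicator (- ?A) n" for n
  proof (cases "n \<in> ?A")
    case True
    \<comment> \<open>On the box, the difference is the transform of \<open>q - D\<close>, to which Bessel's
      inequality applies.\<close>
    have ftd: "ft (\<lambda>t. q t n) l - ft (D n 0) l = ft (\<lambda>t. q t n - D n 0 t) l" for l
      unfolding ft_def left_diff_distrib
      by (rule Bochner_Integration.integral_diff[symmetric]) (auto intro!: integrable_mult_cis q_integrable Dint)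
    have "slice_sq s b ?F n = (\<integral>\<^sup>+l. ennreal ((X_weight s b (l, n) * cmod (of_real torus_area * ft (\<lambda>t. q t n - D n 0 t) l))\<^sup>2) \<partial>lborel)"
      unfolding slice_sq_def using True by (simp add: st flow_ft_def ftd[symmetric] right_diff_distrib)
    also have "\<dots> \<le> ennreal (torus_area\<^sup>2 * (2 * pi)) * (\<integral>\<^sup>+t. ennreal ((bracket (freq n) powr s * cmod (q t n - D n 0 t))\<^sup>2) \<partial>lborel)"
      by (rule slice_ft[OF _ b]) (intro Bochner_Integration.integrable_diff q_integrable Dint)
    also have "(\<integral>\<^sup>+t. ennreal ((bracket (freq n) powr s * cmod (q t n - D n 0 t))\<^sup>2) \<partial>lborel) = ennreal ((bracket (freq n) powr s)\<^sup>2) * l2_sq (\<lambda>t. q t n - D n 0 t)"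
    proof -
      have [measurable]: "D n 0 \<in> borel_measurable borel" using Dint[of n] by auto
      show ?thesis by (subst nn_integral_cmult[symmetric]) (auto simp: power_mult_distrib ennreal_mult)
    qed
    also have "ennreal (torus_area\<^sup>2 * (2 * pi)) * (ennreal ((bracket (freq n) powr s)\<^sup>2) * l2_sq (\<lambda>t. q t n - D n 0 t)) \<le> ennreal (C n) * ennreal (e / (2 * N * C n))"
      unfolding C_def mult.assoc[symmetric] 
      by (subst ennreal_mult[symmetric], simp, simp, intro mult_left_mono less_imp_le) (use D(3)[of n] in \<open>simp_all add: C_def mult.assoc\<close>)
    also have "\<dots> = ennreal (e / (2 * N))"
      using C[of n] N e by (subst ennreal_mult[symmetric]) auto
    finally show ?thesis using True by simp
  next
    case False
    then show ?thesis unfolding slice_sq_def by (simp add: st)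
  qed
  have "X_sq s b ?F \<le> (\<integral>\<^sup>+n. ennreal (e / (2 * N)) * indicator ?A n + ?G n * indicator (- ?A) n \<partial>count_space UNIV)"
    by (subst X_sq_slices) (auto intro!: nn_integral_mono slice)
  also have "\<dots> = (\<integral>\<^sup>+n. ennreal (e / (2 * N)) * indicator ?A n \<partial>count_space UNIV) + (\<integral>\<^sup>+n. ?G n * indicator (- ?A) n \<partial>count_space UNIV)"
    by (rule nn_integral_add) auto
  also have "(\<integral>\<^sup>+n. ennreal (e / (2 * N)) * indicator ?A n \<partial>count_space UNIV) = ennreal (e / (2 * N)) * of_nat (card ?A)"
    by (simp add: nn_integral_cmult_indicator)
  also have "\<dots> = ennreal (e / (2 * N) * real (card ?A))"
    unfolding ennreal_of_nat_eq_real_of_nat using e N by (intro ennreal_mult[symmetric]) auto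
  also have "\<dots> + (\<integral>\<^sup>+n. ?G n * indicator (- ?A) n \<partial>count_space UNIV) < ennreal (e / 2) + ennreal (e / 2)"
  proof -
    have "real (card ?A) \<le> N" by (simp add: N_def)
    then have "e / (2 * N) * real (card ?A) \<le> e / (2 * N) * N" using e N by (intro mult_left_mono) auto
    then have "ennreal (e / (2 * N) * real (card ?A)) \<le> ennreal (e / 2)" using N by (intro ennreal_leI) simp
    then have "ennreal (e / (2 * N) * real (card ?A)) + (\<integral>\<^sup>+n. ?G n * indicator (- ?A) n \<partial>count_space UNIV)
        \<le> ennreal (e / 2) + (\<integral>\<^sup>+n. ?G n * indicator (- ?A) n \<partial>count_space UNIV)"
      by (rule add_right_mono)
    also have "\<dots> < ennreal (e / 2) + ennreal (e / 2)"
      using J by (subst ennreal_add_left_cancel_less) auto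
    finally show ?thesis .
  qed
  also have "\<dots> = ennreal e" using e by (subst ennreal_plus[symmetric]) auto
  finally show "\<exists>\<phi>. schwartz \<phi> \<and> X_sq s b (\<lambda>z. flow_ft q z - st_fourier \<phi> z) < ennreal e"
    using sch by blast
qed

lemma q_X_norm:
  assumes b: "b \<le> 0"
  shows "X_norm s b (flow_ft q) \<le> torus_area * sqrt (2 * pi) * sqrt T * K"
proof -
  have "enn2real (X_sq s b (flow_ft q)) \<le> torus_area\<^sup>2 * (2 * pi) * T * K\<^sup>2"
    using q_X_sq[OF b] T_nonneg by (intro enn2real_leI) auto
  then have "X_norm s b (flow_ft q) \<le> sqrt (torus_area\<^sup>2 * (2 * pi) * T * K\<^sup>2)"
    unfolding X_norm_def by (rule real_sqrt_le_mono)
  also have "\<dots> = torus_area * sqrt (2 * pi) * sqrt T * K"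
    using K_nonneg by (simp only: real_sqrt_mult real_sqrt_abs) simp
  finally show ?thesis .
qed

end

section \<open>The estimate of the product\<close>

lemma W_bounded_of_W_inf_norm:
  assumes "W_inf_norm (- \<sigma>) f < ennreal L" "0 < L"
  shows "W_bounded \<sigma> (L / torus_area) f"
proof -
  obtain g where g: "esssup torus_measure (\<lambda>x. ennreal (cmod (g x))) < ennreal L" "g \<in> borel_measurable torus_measure"
    "\<And>n. torus_coeff g n = of_real (bracket (freq n) powr (- \<sigma>)) * f n"
    using assms(1) unfolding W_inf_norm_def Inf_less_iff by blast
  have "AE x in torus_measure. ennreal (cmod (g x)) \<le> esssup torus_measure (\<lambda>x. ennreal (cmod (g x)))"
    by (rule esssup_AE)
  then have "AE x in torus_measure. cmod (g x) \<le> L"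
  proof eventually_elim
    case (elim x)
    then have "ennreal (cmod (g x)) \<le> ennreal L" using g(1) by simp
    then show ?case using assms(2) by (simp add: ennreal_le_iff)
  qed
  then have "dual_bounded (L / (2 * pi)\<^sup>2) (torus_coeff g)"
    using dual_bounded_torus_coeff[OF g(2), of L] assms(2) by (simp add: torus_area_def)
  moreover have "f k = of_real (bracket (freq k) powr \<sigma>) * torus_coeff g k" for k
    unfolding g(3) by (simp add: mult.assoc[symmetric] powr_add[symmetric] flip: of_real_mult)
  ultimately show ?thesis unfolding W_bounded_def torus_area_def by blast
qed

text \<open>
  The infimum in \<open>W_inf_norm\<close> need not be attained by definition, so the bound is
  first obtained for every constant \<open>L + e\<close> and then for \<open>L\<close>.
\<close>

lemma product_bound_of_W_inf_norm:
  assumes u: "W_inf_norm (- \<sigma>) f \<le> ennreal L" "0 \<le> L" and g: "hs_bounded s G g" and h: "hs_bounded s H h"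
    and \<sigma>: "0 < \<sigma>" "\<sigma> < s" "s \<le> 1 / 2"
  shows "is_product f g h (torus_product f g h)"
    and "hs_bounded (s - 1) (trilinear_const s \<sigma> * (L / torus_area) * (G * H)) (torus_product f g h)"
proof -
  have W: "W_bounded \<sigma> ((L + e) / torus_area) f" if "0 < e" for e
  proof (rule W_bounded_of_W_inf_norm)
    show "W_inf_norm (- \<sigma>) f < ennreal (L + e)"
      using u(1) that u(2) by (intro le_less_trans[OF u(1)]) (simp add: ennreal_lessI)
  qed (use that u(2) in simp)
  show "is_product f g h (torus_product f g h)"
    by (rule torus_product_is_product[OF W[OF zero_less_one] g h \<sigma>])
  have GH: "0 \<le> G * H"
    using g h hs_norm_nonneg[of s g "{}"] hs_norm_nonneg[of s h "{}"] unfolding hs_bounded_def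
    by (intro mult_nonneg_nonneg) (metis finite.emptyI order_trans)+
  define X where "X = trilinear_const s \<sigma> * (G * H) / torus_area"
  have X: "0 \<le> X" using trilinear_const_nonneg[OF \<sigma>] GH by (simp add: X_def)
  show "hs_bounded (s - 1) (trilinear_const s \<sigma> * (L / torus_area) * (G * H)) (torus_product f g h)"
    unfolding hs_bounded_def
  proof (intro allI impI)
    fix A :: "(int \<times> int) set" assume A: "finite A"
    have le: "hs_norm (s - 1) (torus_product f g h) A \<le> X * L + X * e" if "0 < e" for e
    proof -
      have "hs_norm (s - 1) (torus_product f g h) A \<le> trilinear_const s \<sigma> * ((L + e) / torus_area) * (G * H)"
        using torus_product_bound[OF W[OF that] g h \<sigma>] A by (simp add: hs_bounded_def)
      also have "\<dots> = X * L + X * e" by (simp add: X_def field_simps)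
      finally show ?thesis .
    qed
    have "hs_norm (s - 1) (torus_product f g h) A \<le> X * L"
    proof (rule field_le_epsilon)
      fix e :: real assume e: "0 < e"
      have "X * (e / (X + 1)) \<le> e" using X e by (simp add: field_simps)
      moreover have "0 < e / (X + 1)" using X e by simp
      ultimately show "hs_norm (s - 1) (torus_product f g h) A \<le> X * L + e"
        using le[of "e / (X + 1)"] by linarith
    qed
    then show "hs_norm (s - 1) (torus_product f g h) A \<le> trilinear_const s \<sigma> * (L / torus_area) * (G * H)"
      by (simp add: X_def field_simps)
  qed
qed

lemma X_spaceD:
  assumes "F \<in> X_space s b"
  shows "F \<in> borel_measurable dual_measure" "X_sq s b F < \<infinity>"
  using assms by (auto simp: X_space_def)

lemma X_norm_nonneg: "0 \<le> X_norm s b F"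
  by (simp add: X_norm_def)

lemma XT_norm_le:
  assumes "F \<in> X_space s b" "restricts_to T F u"
  shows "XT_norm T s b u \<le> X_norm s b F"
  unfolding XT_norm_def
  by (rule cInf_lower) (use assms X_norm_nonneg in \<open>auto intro!: bdd_belowI\<close>)

text \<open>
  Bounds that hold for every extension hold for the infimum over extensions.
\<close>

lemma le_mult_XT_norm:
  assumes u: "u \<in> XT_space T s b" and k: "0 \<le> k"
    and le: "\<And>F. F \<in> X_space s b \<Longrightarrow> restricts_to T F u \<Longrightarrow> y \<le> k * X_norm s b F"
  shows "y \<le> k * XT_norm T s b u"
proof (cases "k = 0")
  case True
  then show ?thesis using u le by (auto simp: XT_space_def)
next
  case False
  then have k: "0 < k" using k by simp
  have "y / k \<le> XT_norm T s b u"
    unfolding XT_norm_def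
  proof (rule cInf_greatest)
    show "{X_norm s b F |F. F \<in> X_space s b \<and> restricts_to T F u} \<noteq> {}"
      using u by (auto simp: XT_space_def)
    show "y / k \<le> x" if "x \<in> {X_norm s b F |F. F \<in> X_space s b \<and> restricts_to T F u}" for x
      using that le k by (auto simp: field_simps)
  qed
  then show ?thesis using k by (simp add: field_simps)
qed

lemma XT_norm_nonneg:
  assumes "u \<in> XT_space T s b"
  shows "0 \<le> XT_norm T s b u"
  using le_mult_XT_norm[OF assms, of 1 0] X_norm_nonneg by simp

text \<open>
  The factor \<open>(2\<pi>)\<^sup>1\<^sup>/\<^sup>2\<close> is Bessel's; the area in the
  transform of the product cancels the one in the pairing of \<open>f\<close> with
  \<open>L\<^sup>1\<close>.
\<close>

definition product_const :: "real \<Rightarrow> real \<Rightarrow> real \<Rightarrow> real" where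
  "product_const s \<sigma> b = sqrt (2 * pi) * trilinear_const s \<sigma> * (embed_const b)\<^sup>2"

text \<open>
  The product is constructed from one extension of \<open>v\<close> and one of \<open>w\<close>.
  Its values do not depend on them up to null sets of times, so the bound holds with the norms of
  all extensions, and then with the infima.
\<close>

theorem product_estimate:
  assumes \<sigma>: "0 < \<sigma>" "\<sigma> < s" "s \<le> 1 / 2" and b: "1 / 2 < b" "b' \<le> 0" and T: "0 < T"
    and u: "u \<in> LW_space T (- \<sigma>)" and v: "v \<in> XT_space T s b" and w: "w \<in> XT_space T s b"
  shows "\<exists>p \<in> XT_space T (s - 1) b'.
     (AE t in lborel. t \<in> {0..T} \<longrightarrow> is_product (u t) (v t) (w t) (p t)) \<and>
     XT_norm T (s - 1) b' p \<le> product_const s \<sigma> b * sqrt T * LW_norm T (- \<sigma>) u * XT_norm T s b v * XT_norm T s b w"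
proof -
  define L where "L = LW_norm T (- \<sigma>) u"
  have L0: "0 \<le> L" by (simp add: L_def LW_norm_def)
  have "LW_esssup T (- \<sigma>) u < \<infinity>" using u by (simp add: LW_space_def)
  then have L: "LW_esssup T (- \<sigma>) u = ennreal L" by (simp add: L_def LW_norm_def)
  have "AE t in restrict_space lborel {0..T}. W_inf_norm (- \<sigma>) (u t) \<le> ennreal L"
    unfolding L[symmetric] LW_esssup_def by (rule esssup_AE)
  then have AEu: "AE t in lborel. t \<in> {0..T} \<longrightarrow> W_inf_norm (- \<sigma>) (u t) \<le> ennreal L"
    by (subst (asm) AE_restrict_space_iff) auto
  have AEr: "AE t in lborel. t \<in> {0..T} \<longrightarrow> v' t = time_coeff F t" if "F \<in> X_space s b" "restricts_to T F v'" for F v'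
  proof -
    \<comment> \<open>Restriction determines the function on the open interval only; the endpoints are null sets.\<close>
    have "AE t in lborel. t \<noteq> 0 \<and> t \<noteq> T"
      using AE_lborel_singleton[of 0] AE_lborel_singleton[of T] by eventually_elim auto
    with restricts_to_time_coeff[OF X_spaceD[OF that(1)] b(1) that(2)] show ?thesis
      by eventually_elim auto
  qed
  obtain F0 where F0: "F0 \<in> X_space s b" "restricts_to T F0 v" using v by (auto simp: XT_space_def)
  obtain G0 where G0: "G0 \<in> X_space s b" "restricts_to T G0 w" using w by (auto simp: XT_space_def)
  note [measurable] = X_spaceD(1)[OF F0(1)] X_spaceD(1)[OF G0(1)]
  \<comment> \<open>Only on \<open>[0, T]\<close> is \<open>u\<close> known to be measurable.\<close>
  define u' where "u' t n = (if t \<in> {0..T} then u t n else 0)" for t n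
  have [measurable]: "(\<lambda>t. u' t n) \<in> borel_measurable borel" for n
  proof -
    have "(\<lambda>t. u t n) \<in> borel_measurable (restrict_space lborel {0..T})" using u unfolding LW_space_def by blast
    then have "(\<lambda>t. if t \<in> {0..T} then u t n else 0) \<in> borel_measurable lborel"
      by (subst (asm) measurable_restrict_space_iff[where c=0]) auto
    then show ?thesis by (simp add: u'_def)
  qed
  define p where "p t n = (if t \<in> {0..T} then torus_product (u' t) (time_coeff F0 t) (time_coeff G0 t) n else 0)" for t n
  have p_meas: "(\<lambda>t. p t n) \<in> borel_measurable borel" for n
    unfolding p_def torus_product_def trilinear_coeff_def by measurable
  have p_eq: "AE t in lborel. t \<in> {0..T} \<longrightarrow> p t = torus_product (u t) (v t) (w t)"
    using AEr[OF F0] AEr[OF G0]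
  proof eventually_elim
    case (elim t)
    show ?case
    proof
      assume t: "t \<in> {0..T}"
      then have u': "u' t = u t" by (simp add: u'_def fun_eq_iff)
      have vw: "time_coeff F0 t = v t" "time_coeff G0 t = w t" using elim t by auto
      show "p t = torus_product (u t) (v t) (w t)"
        by (rule ext) (simp only: p_def t if_True u' vw)
    qed
  qed
  have flow: "bounded_flow p (s - 1) (trilinear_const s \<sigma> * (L / torus_area) * ((embed_const b * X_norm s b F) * (embed_const b * X_norm s b G))) T"
    if F: "F \<in> X_space s b" "restricts_to T F v" and G: "G \<in> X_space s b" "restricts_to T G w" for F G
  proof
    show "(\<lambda>t. p t n) \<in> borel_measurable borel" for n by (rule p_meas)
    show "p t n = 0" if "t \<notin> {0..T}" for t n using that by (simp only: p_def if_False)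
    show "0 \<le> T" using T by simp
    have "0 \<le> embed_const b" by (simp add: embed_const_def)
    then show "0 \<le> trilinear_const s \<sigma> * (L / torus_area) * ((embed_const b * X_norm s b F) * (embed_const b * X_norm s b G))"
      using trilinear_const_nonneg[OF \<sigma>] L0 X_norm_nonneg by (intro mult_nonneg_nonneg divide_nonneg_pos) auto
    show "AE t in lborel. t \<in> {0..T} \<longrightarrow> hs_bounded (s - 1) (trilinear_const s \<sigma> * (L / torus_area) * ((embed_const b * X_norm s b F) * (embed_const b * X_norm s b G))) (p t)"
      using p_eq AEu AEr[OF F] AEr[OF G]
    proof eventually_elim
      case (elim t)
      show ?case
      proof
        assume t: "t \<in> {0..T}"
        have "hs_bounded s (embed_const b * X_norm s b F) (v t)" "hs_bounded s (embed_const b * X_norm s b G) (w t)"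
          using time_coeff_hs_bounded[OF X_spaceD[OF F(1)] b(1), of t] time_coeff_hs_bounded[OF X_spaceD[OF G(1)] b(1), of t] elim t by auto
        from product_bound_of_W_inf_norm(2)[OF _ L0 this \<sigma>, of "u t"] elim t
        show "hs_bounded (s - 1) (trilinear_const s \<sigma> * (L / torus_area) * ((embed_const b * X_norm s b F) * (embed_const b * X_norm s b G))) (p t)"
          by simp
      qed
    qed
  qed
  have prod: "AE t in lborel. t \<in> {0..T} \<longrightarrow> is_product (u t) (v t) (w t) (p t)"
    using p_eq AEu AEr[OF F0] AEr[OF G0]
  proof eventually_elim
    case (elim t)
    show ?case
    proof
      assume t: "t \<in> {0..T}"
      have "hs_bounded s (embed_const b * X_norm s b F0) (v t)" "hs_bounded s (embed_const b * X_norm s b G0) (w t)"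
        using time_coeff_hs_bounded[OF X_spaceD[OF F0(1)] b(1), of t] time_coeff_hs_bounded[OF X_spaceD[OF G0(1)] b(1), of t] elim t by auto
      from product_bound_of_W_inf_norm(1)[OF _ L0 this \<sigma>, of "u t"] elim t
      show "is_product (u t) (v t) (w t) (p t)" by simp
    qed
  qed
  have p_space: "p \<in> XT_space T (s - 1) b'"
    unfolding XT_space_def
    using bounded_flow.q_X_space[OF flow[OF F0 G0] b(2)] bounded_flow.q_restricts_to[OF flow[OF F0 G0]] by blast
  define C where "C = product_const s \<sigma> b * sqrt T * L"
  have C: "0 \<le> C" using trilinear_const_nonneg[OF \<sigma>] T L0 by (simp add: C_def product_const_def)
  have le: "XT_norm T (s - 1) b' p \<le> C * X_norm s b F * X_norm s b G"
    if F: "F \<in> X_space s b" "restricts_to T F v" and G: "G \<in> X_space s b" "restricts_to T G w" for F G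
  proof -
    interpret bounded_flow p "s - 1" "trilinear_const s \<sigma> * (L / torus_area) * ((embed_const b * X_norm s b F) * (embed_const b * X_norm s b G))" T
      by (rule flow[OF F G])
    have "XT_norm T (s - 1) b' p \<le> X_norm (s - 1) b' (flow_ft p)"
      by (rule XT_norm_le[OF q_X_space[OF b(2)] q_restricts_to])
    also have "\<dots> \<le> torus_area * sqrt (2 * pi) * sqrt T * (trilinear_const s \<sigma> * (L / torus_area) * ((embed_const b * X_norm s b F) * (embed_const b * X_norm s b G)))"
      by (rule q_X_norm[OF b(2)])
    also have "\<dots> = C * X_norm s b F * X_norm s b G"
      by (simp add: C_def product_const_def power2_eq_square)
    finally show ?thesis .
  qed
  have "XT_norm T (s - 1) b' p \<le> C * XT_norm T s b v * X_norm s b G" if G: "G \<in> X_space s b" "restricts_to T G w" for G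
  proof -
    have "XT_norm T (s - 1) b' p \<le> (C * X_norm s b G) * XT_norm T s b v"
      by (rule le_mult_XT_norm[OF v]) (use C X_norm_nonneg le[OF _ _ G] in \<open>auto simp: mult_ac\<close>)
    then show ?thesis by (simp add: mult_ac)
  qed
  then have "XT_norm T (s - 1) b' p \<le> (C * XT_norm T s b v) * XT_norm T s b w"
    by (intro le_mult_XT_norm[OF w]) (use C XT_norm_nonneg[OF v] in auto)
  then show ?thesis using p_space prod by (auto simp: C_def L_def)
qed

theorem proposition5p7:
  fixes \<alpha> \<epsilon> :: real
  assumes "1 / 4 \<le> \<alpha>" "\<alpha> < 3 / 8"
    and "0 < \<epsilon>"
    and "\<epsilon> < min ((3 - 8 * \<alpha>) / 4) ((5 - 8 * \<alpha>) * (24 * \<alpha> - 5) / (12 * (1 + 8 * \<alpha>)))"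
  shows "\<exists>\<eta>>0. \<forall>\<delta>. 0 < \<delta> \<and> \<delta> < 2 * \<epsilon> / (5 - 8 * \<alpha>) \<longrightarrow>
    (\<exists>C>0. \<forall>T. 0 < T \<and> T \<le> 1 \<longrightarrow>
      (\<forall>u \<in> LW_space T (- \<alpha> - \<epsilon> / 2).
       \<forall>v \<in> XT_space T (2 * \<alpha> - 1 / 4 + \<epsilon>) (1 / 2 + \<delta>).
       \<forall>w \<in> XT_space T (2 * \<alpha> - 1 / 4 + \<epsilon>) (1 / 2 + \<delta>).
       \<exists>p \<in> XT_space T (2 * \<alpha> - 1 / 4 + \<epsilon> - 1) (- 1 / 2 + \<delta>).
         (AE t in lborel. t \<in> {0..T} \<longrightarrow> is_product (u t) (v t) (w t) (p t)) \<and>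
         XT_norm T (2 * \<alpha> - 1 / 4 + \<epsilon> - 1) (- 1 / 2 + \<delta>) p
           \<le> C * T powr \<eta> * LW_norm T (- \<alpha> - \<epsilon> / 2) u
               * XT_norm T (2 * \<alpha> - 1 / 4 + \<epsilon>) (1 / 2 + \<delta>) v
               * XT_norm T (2 * \<alpha> - 1 / 4 + \<epsilon>) (1 / 2 + \<delta>) w))"
proof (rule exI[of _ "1 / 2 :: real"], intro conjI allI impI)
  fix \<delta> assume \<delta>: "0 < \<delta> \<and> \<delta> < 2 * \<epsilon> / (5 - 8 * \<alpha>)"
  define s where "s = 2 * \<alpha> - 1 / 4 + \<epsilon>"
  define \<sigma> where "\<sigma> = \<alpha> + \<epsilon> / 2"
  have \<sigma>: "0 < \<sigma>" "\<sigma> < s" "s \<le> 1 / 2" using assms by (auto simp: s_def \<sigma>_def)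
  have "2 * \<epsilon> / (5 - 8 * \<alpha>) \<le> 1 / 2" using assms by (simp add: field_simps)
  with \<delta> have \<delta>': "- 1 / 2 + \<delta> \<le> 0" by simp
  \<comment> \<open>The maximum makes the constant positive.\<close>
  define C where "C = max 1 (product_const s \<sigma> (1 / 2 + \<delta>))"
  have eq: "- \<alpha> - \<epsilon> / 2 = - \<sigma>" by (simp add: \<sigma>_def)
  show "\<exists>C>0. \<forall>T. 0 < T \<and> T \<le> 1 \<longrightarrow>
      (\<forall>u \<in> LW_space T (- \<alpha> - \<epsilon> / 2).
       \<forall>v \<in> XT_space T (2 * \<alpha> - 1 / 4 + \<epsilon>) (1 / 2 + \<delta>).
       \<forall>w \<in> XT_space T (2 * \<alpha> - 1 / 4 + \<epsilon>) (1 / 2 + \<delta>).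
       \<exists>p \<in> XT_space T (2 * \<alpha> - 1 / 4 + \<epsilon> - 1) (- 1 / 2 + \<delta>).
         (AE t in lborel. t \<in> {0..T} \<longrightarrow> is_product (u t) (v t) (w t) (p t)) \<and>
         XT_norm T (2 * \<alpha> - 1 / 4 + \<epsilon> - 1) (- 1 / 2 + \<delta>) p
           \<le> C * T powr (1 / 2) * LW_norm T (- \<alpha> - \<epsilon> / 2) u
               * XT_norm T (2 * \<alpha> - 1 / 4 + \<epsilon>) (1 / 2 + \<delta>) v
               * XT_norm T (2 * \<alpha> - 1 / 4 + \<epsilon>) (1 / 2 + \<delta>) w)"
    unfolding eq s_def[symmetric]
  proof (rule exI[of _ C], intro conjI allI impI ballI)
    show "0 < C" by (simp add: C_def)
    fix T u v w
    assume T: "0 < T \<and> T \<le> 1" and u: "u \<in> LW_space T (- \<sigma>)"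
      and v: "v \<in> XT_space T s (1 / 2 + \<delta>)" and w: "w \<in> XT_space T s (1 / 2 + \<delta>)"
    obtain p where p: "p \<in> XT_space T (s - 1) (- 1 / 2 + \<delta>)"
      "AE t in lborel. t \<in> {0..T} \<longrightarrow> is_product (u t) (v t) (w t) (p t)"
      "XT_norm T (s - 1) (- 1 / 2 + \<delta>) p \<le> product_const s \<sigma> (1 / 2 + \<delta>) * sqrt T * LW_norm T (- \<sigma>) u * XT_norm T s (1 / 2 + \<delta>) v * XT_norm T s (1 / 2 + \<delta>) w"
      using product_estimate[OF \<sigma> _ \<delta>' _ u v w] \<delta> T by auto
    note p(3)
    also have "\<dots> \<le> C * sqrt T * LW_norm T (- \<sigma>) u * XT_norm T s (1 / 2 + \<delta>) v * XT_norm T s (1 / 2 + \<delta>) w"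
      using T XT_norm_nonneg[OF v] XT_norm_nonneg[OF w]
      by (intro mult_right_mono) (auto simp: C_def LW_norm_def)
    also have "sqrt T = T powr (1 / 2)" using T by (simp add: powr_half_sqrt)
    finally show "\<exists>p \<in> XT_space T (s - 1) (- 1 / 2 + \<delta>).
         (AE t in lborel. t \<in> {0..T} \<longrightarrow> is_product (u t) (v t) (w t) (p t)) \<and>
         XT_norm T (s - 1) (- 1 / 2 + \<delta>) p
           \<le> C * T powr (1 / 2) * LW_norm T (- \<sigma>) u * XT_norm T s (1 / 2 + \<delta>) v * XT_norm T s (1 / 2 + \<delta>) w"
      using p by blast
  qed
qed simp

end
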